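(* Let $\Lambda:\mathcal D\to\mathbb R^m$ be an admissible Lagrange multiplier function, let $\Delta t>0$, and let $\Psi_{\Delta t}^{\rm rev}:T^*\mathcal M\to T^*\mathcal M$ be the associated RATTLE map with momentum reversal and reverse projection check (see context). Consider the Markov chain $(q^n,p^n)_{n\ge0}$ on $T^*\mathcal M$ (constrained Hybrid Monte Carlo) defined as follows. Given $(q^n,p^n)\in T^*\mathcal M$: (i) sample $\tilde p^n\in T^*_{q^n}\mathcal M$ according to $\kappa_{q^n}$, independently of the past given $q^n$; (ii) set $(\tilde q^{n+1},\tilde p^{n+1})=\Psi_{\Delta t}^{\rm rev}(q^n,\tilde p^n)$; (iii) draw $U^n$ uniformly on $(0,1)$, independently of everything else; if $U^n\le\exp\big(-H(\tilde q^{n+1},\tilde p^{n+1})+H(q^n,\tilde p^n)\big)$, set $(q^{n+1},p^{n+1})=(\tilde q^{n+1},\tilde p^{n+1})$; otherwise set $(q^{n+1},p^{n+1})=(q^n,\tilde p^n)$. Then this Markov chain admits $\mu$ as an invariant measure.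
   Context: **Geometric setting.** Let $1\le m<d$ be integers, $M\in\mathbb R^{d\times d}$ a fixed symmetric positive definite matrix, and $\xi=(\xi_1,\dots,\xi_m):\mathbb R^d\to\mathbb R^m$ a smooth function. $\nabla\xi(q)\in\mathbb R^{d\times m}$ is the matrix whose columns are the gradients $\nabla\xi_i(q)$. Set $\mathcal M=\{q\in\mathbb R^d:\xi(q)=0\}$, and assume that $G_M(q)=[\nabla\xi(q)]^TM^{-1}\nabla\xi(q)\in\mathbb R^{m\times m}$ is invertible for all $q$ in a neighborhood of $\mathcal M$ (so $\mathcal M$ is a smooth submanifold of codimension $m$). Let $V:\mathbb R^d\to\mathbb R$ be smooth. Put $T_q^*\mathcal M=\{p\in\mathbb R^d:[\nabla\xi(q)]^TM^{-1}p=0\}$ and $T^*\mathcal M=\{(q,p)\in\mathbb R^d\times\mathbb R^d:\xi(q)=0,\ [\nabla\xi(q)]^TM^{-1}p=0\}$. The phase-space Liouville measure on $T^*\mathcal M$ is $\sigma_{T^*\mathcal M}(dq\,dp)=\sigma^M_{\mathcal M}(dq)\,\sigma^{M^{-1}}_{T_q^*\mathcal M}(dp)$, where $\sigma^M_{\mathcal M}$ is the Riemannian measure on $\mathcal M$ induced by the scalar product $q^TM\tilde q$ on $\mathbb R^d$ and $\sigma^{M^{-1}}_{T_q^*\mathcal M}$ is the Lebesgue measure on $T_q^*\mathcal M$ induced by the scalar product $p^TM^{-1}\tilde p$. **Target measure.** $H(q,p)=V(q)+\frac12p^TM^{-1}p$. The constant $Z_\nu=\int_{\mathcal M}e^{-V}d\sigma^M_{\mathcal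 M}$ is assumed finite (and positive), and $\mu(dq\,dp)=Z_\mu^{-1}e^{-H(q,p)}\sigma_{T^*\mathcal M}(dq\,dp)$ with $Z_\mu=\int_{T^*\mathcal M}e^{-H}d\sigma_{T^*\mathcal M}$. For $q\in\mathcal M$, $\kappa_q(dp)=(2\pi)^{(m-d)/2}\exp(-\frac12p^TM^{-1}p)\,\sigma^{M^{-1}}_{T_q^*\mathcal M}(dp)$ is a Gaussian probability measure on $T_q^*\mathcal M$. **Admissible Lagrange multiplier function.** A $C^1$ function $\Lambda:\mathcal D\to\mathbb R^m$ defined on an open set $\mathcal D$ of $\mathcal M\times\mathbb R^d$ such that for all $(q,\tilde q)\in\mathcal D$: (projection) $\tilde q+M^{-1}\nabla\xi(q)\Lambda(q,\tilde q)\in\mathcal M$; and (non-tangential projection) the $m\times m$ matrix $\left[\nabla\xi\big(\tilde q+M^{-1}\nabla\xi(q)\Lambda(q,\tilde q)\big)\right]^TM^{-1}\nabla\xi(q)$ is invertible. **RATTLE map.** Given $\Lambda$ and a timestep $\Delta t>0$, let $$A=\Big\{(q,p)\in T^*\mathcal M:\ \big(q,\,q+\Delta t\,M^{-1}[p-\tfrac{\Delta t}{2}\nabla V(q)]\big)\in\mathcal D\Big\},$$ an open subset of $T^*\mathcal M$. For $(q,p)\in A$, set $\Psi_{\Delta t}(q,p)=(q^1,-p^1)\in T^*\mathcal M$, where $\lambda^{1/2}=\frac1{\Delta t}\Lambda\big(q,q+\Delta tM^{-1}[p-\frac{\Delta t}2\nabla V(q)]\big)$, $p^{1/2}=p-\frac{\Delta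 t}2\nabla V(q)+\nabla\xi(q)\lambda^{1/2}$, $q^1=q+\Delta t\,M^{-1}p^{1/2}$, $p^1=p^{1/2}-\frac{\Delta t}2\nabla V(q^1)+\nabla\xi(q^1)\lambda^1$, with $\lambda^1\in\mathbb R^m$ the unique vector such that $[\nabla\xi(q^1)]^TM^{-1}p^1=0$. **Map with reverse projection check.** Let $$B=\big\{(q,p)\in A:\ \Psi_{\Delta t}(q,p)\in A\ \text{ and }\ (\Psi_{\Delta t}\circ\Psi_{\Delta t})(q,p)=(q,p)\big\},$$ and for $(q,p)\in T^*\mathcal M$ let $\Psi_{\Delta t}^{\rm rev}(q,p)=\Psi_{\Delta t}(q,p)$ if $(q,p)\in B$ and $\Psi_{\Delta t}^{\rm rev}(q,p)=(q,p)$ if $(q,p)\notin B$. *)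

theory Defs
  imports "HOL-Probability.Probability"
begin

type_synonym 'a dbl = "'a \<times> 'a"

section \<open>Differentiability classes\<close>

text \<open>
  On an open set, \<open>f\<close> is of class \<open>C\<^sup>n\<^sup>+\<^sup>1\<close> iff it is differentiable and all its directional
  derivatives are of class \<open>C\<^sup>n\<close>.  Only used for open \<open>S\<close>.
\<close>

primrec Ck_on :: "nat \<Rightarrow> 'a::real_normed_vector set \<Rightarrow> ('a \<Rightarrow> 'b::real_normed_vector) \<Rightarrow> bool" where
  "Ck_on 0 S f \<longleftrightarrow> continuous_on S f"
| "Ck_on (Suc n) S f \<longleftrightarrow>
     (\<forall>x\<in>S. f differentiable (at x)) \<and> (\<forall>v. Ck_on n S (\<lambda>x. frechet_derivative f (at x) v))"

definition smooth_on :: "'a::real_normed_vector set \<Rightarrow> ('a \<Rightarrow> 'b::real_normed_vector) \<Rightarrow> bool" where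
  "smooth_on S f \<longleftrightarrow> (\<forall>n. Ck_on n S f)"

text \<open>
  \<open>C\<^sup>1\<close> on a set that is open in a submanifold but not in the ambient space: locally the restriction
  of a \<open>C\<^sup>1\<close> function defined on an open subset of the ambient space.
\<close>

definition C1_on_relopen :: "'a::real_normed_vector set \<Rightarrow> ('a \<Rightarrow> 'b::real_normed_vector) \<Rightarrow> bool" where
  "C1_on_relopen D f \<longleftrightarrow>
     (\<forall>x\<in>D. \<exists>W F. open W \<and> x \<in> W \<and> Ck_on 1 W F \<and> (\<forall>y\<in>W \<inter> D. F y = f y))"

definition grad :: "(real^'d \<Rightarrow> real) \<Rightarrow> real^'d \<Rightarrow> real^'d" where
  "grad f q = (\<chi> i. frechet_derivative f (at q) (axis i 1))"

text \<open>The \<open>d \<times> m\<close> matrix whose columns are the gradients of the components.\<close>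

definition grad_mat :: "(real^'d \<Rightarrow> real^'m) \<Rightarrow> real^'d \<Rightarrow> real^'m^'d" where
  "grad_mat f q = (\<chi> i j. grad (\<lambda>x. f x $ j) q $ i)"

definition sym_pos_def :: "real^'d^'d \<Rightarrow> bool" where
  "sym_pos_def M \<longleftrightarrow> transpose M = M \<and> (\<forall>x. x \<noteq> 0 \<longrightarrow> 0 < x \<bullet> (M *v x))"


section \<open>Riemannian and Lebesgue measures induced by a scalar product\<close>

text \<open>
  In this section \<open>A\<close> is the matrix of the scalar product \<open>x \<bullet> (A *v y)\<close> on the ambient space, and
  \<open>TYPE('k)\<close> carries the dimension \<open>CARD('k)\<close> of the submanifold or subspace: coordinates live
  in \<open>real^'k\<close>.
\<close>

definition local_parametrization ::
    "(real^'d) set \<Rightarrow> (real^'k) set \<Rightarrow> (real^'k \<Rightarrow> real^'d) \<Rightarrow> bool" where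
  "local_parametrization S U \<phi> \<longleftrightarrow>
     open U \<and> smooth_on U \<phi> \<and>
     (\<forall>x\<in>U. inj (frechet_derivative \<phi> (at x))) \<and>
     openin (top_of_set S) (\<phi> ` U) \<and>
     (\<exists>\<psi>. homeomorphism U (\<phi> ` U) \<phi> \<psi>)"

definition countable_atlas ::
    "(real^'d) set \<Rightarrow> (nat \<Rightarrow> (real^'k) set \<times> (real^'k \<Rightarrow> real^'d)) \<Rightarrow> bool" where
  "countable_atlas S \<A> \<longleftrightarrow>
     (\<forall>n. local_parametrization S (fst (\<A> n)) (snd (\<A> n))) \<and>
     S = (\<Union>n. snd (\<A> n) ` fst (\<A> n))"

text \<open>The square root of the determinant of the first fundamental form.\<close>

definition volume_density :: "real^'d^'d \<Rightarrow> (real^'k \<Rightarrow> real^'d) \<Rightarrow> real^'k \<Rightarrow> real" where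
  "volume_density A \<phi> x =
     (let J = matrix (frechet_derivative \<phi> (at x)) in sqrt (det (transpose J ** A ** J)))"

text \<open>
  The images of the charts of an atlas are cut into disjoint pieces, and on each piece the measure is
  the volume density times Lebesgue measure in the coordinates.  By the change of variables formula
  the result does not depend on the atlas, so that an arbitrary one may be chosen.
\<close>

definition riemannian_measure ::
    "'k::finite itself \<Rightarrow> real^'d^'d \<Rightarrow> (real^'d) set \<Rightarrow> (real^'d) measure" where
  "riemannian_measure k A S =
     (let \<A> = (SOME \<A> :: nat \<Rightarrow> (real^'k) set \<times> (real^'k \<Rightarrow> real^'d). countable_atlas S \<A>);
          U = (\<lambda>n. fst (\<A> n)); \<phi> = (\<lambda>n. snd (\<A> n))
      in measure_of S (sets (restrict_space borel S))
           (\<lambda>E. \<Sum>n. \<integral>\<^sup>+ x \<in> {x \<in> U n. \<phi> n x \<in> E - (\<Union>j<n. \<phi> j ` U j)}.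
                       ennreal (volume_density A (\<phi> n) x) \<partial>lborel))"

text \<open>
  Lebesgue measure on a linear subspace \<open>T\<close> is transported from \<open>real^'k\<close> by a linear isometry onto
  \<open>T\<close>.  Its choice is irrelevant, since \<open>lborel\<close> is invariant under orthogonal transformations.
\<close>

definition subspace_measure ::
    "'k::finite itself \<Rightarrow> real^'d^'d \<Rightarrow> (real^'d) set \<Rightarrow> (real^'d) measure" where
  "subspace_measure k A T =
     distr lborel (restrict_space borel T)
       (SOME L :: real^'k \<Rightarrow> real^'d.
          linear L \<and> range L = T \<and> (\<forall>x y. L x \<bullet> (A *v L y) = x \<bullet> y))"


section \<open>Constrained phase space\<close>

definition submfd :: "(real^'d \<Rightarrow> real^'m) \<Rightarrow> (real^'d) set" where
  "submfd \<xi> = {q. \<xi> q = 0}"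

definition gram :: "real^'d^'d \<Rightarrow> (real^'d \<Rightarrow> real^'m) \<Rightarrow> real^'d \<Rightarrow> real^'m^'m" where
  "gram M \<xi> q = transpose (grad_mat \<xi> q) ** matrix_inv M ** grad_mat \<xi> q"

definition cotangent_space :: "real^'d^'d \<Rightarrow> (real^'d \<Rightarrow> real^'m) \<Rightarrow> real^'d \<Rightarrow> (real^'d) set" where
  "cotangent_space M \<xi> q = {p. (transpose (grad_mat \<xi> q) ** matrix_inv M) *v p = 0}"

definition cotangent_bundle ::
    "real^'d^'d \<Rightarrow> (real^'d \<Rightarrow> real^'m) \<Rightarrow> (real^'d) dbl set" where
  "cotangent_bundle M \<xi> = {(q, p). q \<in> submfd \<xi> \<and> p \<in> cotangent_space M \<xi> q}"

definition phase_space ::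
    "real^'d^'d \<Rightarrow> (real^'d \<Rightarrow> real^'m) \<Rightarrow> (real^'d) dbl measure" where
  "phase_space M \<xi> = restrict_space borel (cotangent_bundle M \<xi>)"

definition position_measure ::
    "'k::finite itself \<Rightarrow> real^'d^'d \<Rightarrow> (real^'d \<Rightarrow> real^'m) \<Rightarrow> (real^'d) measure" where
  "position_measure k M \<xi> = riemannian_measure k M (submfd \<xi>)"

definition momentum_measure ::
    "'k::finite itself \<Rightarrow> real^'d^'d \<Rightarrow> (real^'d \<Rightarrow> real^'m) \<Rightarrow> real^'d \<Rightarrow> (real^'d) measure" where
  "momentum_measure k M \<xi> q = subspace_measure k (matrix_inv M) (cotangent_space M \<xi> q)"

definition liouville_measure ::
    "'k::finite itself \<Rightarrow> real^'d^'d \<Rightarrow> (real^'d \<Rightarrow> real^'m) \<Rightarrow> (real^'d) dbl measure" where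
  "liouville_measure k M \<xi> =
     measure_of (cotangent_bundle M \<xi>) (sets (phase_space M \<xi>))
       (\<lambda>E. \<integral>\<^sup>+ q. emeasure (momentum_measure k M \<xi> q) {p. (q, p) \<in> E} \<partial>position_measure k M \<xi>)"

definition hamiltonian :: "real^'d^'d \<Rightarrow> (real^'d \<Rightarrow> real) \<Rightarrow> (real^'d) dbl \<Rightarrow> real" where
  "hamiltonian M V = (\<lambda>(q, p). V q + (p \<bullet> (matrix_inv M *v p)) / 2)"

definition Z_nu :: "'k::finite itself \<Rightarrow> real^'d^'d \<Rightarrow> (real^'d \<Rightarrow> real^'m) \<Rightarrow> (real^'d \<Rightarrow> real) \<Rightarrow> ennreal"
  where "Z_nu k M \<xi> V = (\<integral>\<^sup>+ q. ennreal (exp (- V q)) \<partial>position_measure k M \<xi>)"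

definition Z_mu :: "'k::finite itself \<Rightarrow> real^'d^'d \<Rightarrow> (real^'d \<Rightarrow> real^'m) \<Rightarrow> (real^'d \<Rightarrow> real) \<Rightarrow> ennreal"
  where "Z_mu k M \<xi> V = (\<integral>\<^sup>+ z. ennreal (exp (- hamiltonian M V z)) \<partial>liouville_measure k M \<xi>)"

definition target_measure ::
    "'k::finite itself \<Rightarrow> real^'d^'d \<Rightarrow> (real^'d \<Rightarrow> real^'m) \<Rightarrow> (real^'d \<Rightarrow> real)
      \<Rightarrow> (real^'d) dbl measure" where
  "target_measure k M \<xi> V =
     density (liouville_measure k M \<xi>)
       (\<lambda>z. ennreal (exp (- hamiltonian M V z)) / Z_mu k M \<xi> V)"

definition momentum_kernel ::
    "'k::finite itself \<Rightarrow> real^'d^'d \<Rightarrow> (real^'d \<Rightarrow> real^'m) \<Rightarrow> real^'d \<Rightarrow> (real^'d) measure" where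
  "momentum_kernel k M \<xi> q =
     density (momentum_measure k M \<xi> q)
       (\<lambda>p. ennreal ((2 * pi) powr ((real CARD('m) - real CARD('d)) / 2)
                       * exp (- (p \<bullet> (matrix_inv M *v p)) / 2)))"


section \<open>RATTLE with momentum reversal and reverse projection check\<close>

definition admissible_multiplier ::
    "real^'d^'d \<Rightarrow> (real^'d \<Rightarrow> real^'m) \<Rightarrow> (real^'d) dbl set
      \<Rightarrow> ((real^'d) dbl \<Rightarrow> real^'m) \<Rightarrow> bool" where
  "admissible_multiplier M \<xi> D \<Lambda> \<longleftrightarrow>
     openin (top_of_set (submfd \<xi> \<times> UNIV)) D \<and> C1_on_relopen D \<Lambda> \<and>
     (\<forall>(q, q') \<in> D.
        let r = q' + (matrix_inv M ** grad_mat \<xi> q) *v \<Lambda> (q, q')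
        in r \<in> submfd \<xi> \<and>
           invertible (transpose (grad_mat \<xi> r) ** matrix_inv M ** grad_mat \<xi> q))"

text \<open>The second argument of the multiplier function at the phase space point \<open>(q, p)\<close>.\<close>

definition unconstrained_step ::
    "real^'d^'d \<Rightarrow> (real^'d \<Rightarrow> real) \<Rightarrow> real \<Rightarrow> (real^'d) dbl \<Rightarrow> real^'d" where
  "unconstrained_step M V \<Delta>t =
     (\<lambda>(q, p). q + \<Delta>t *\<^sub>R (matrix_inv M *v (p - (\<Delta>t / 2) *\<^sub>R grad V q)))"

definition rattle_domain ::
    "real^'d^'d \<Rightarrow> (real^'d \<Rightarrow> real^'m) \<Rightarrow> (real^'d \<Rightarrow> real) \<Rightarrow> (real^'d) dbl set
      \<Rightarrow> real \<Rightarrow> (real^'d) dbl set" where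
  "rattle_domain M \<xi> V D \<Delta>t =
     {(q, p) \<in> cotangent_bundle M \<xi>. (q, unconstrained_step M V \<Delta>t (q, p)) \<in> D}"

definition rattle ::
    "real^'d^'d \<Rightarrow> (real^'d \<Rightarrow> real^'m) \<Rightarrow> (real^'d \<Rightarrow> real) \<Rightarrow> ((real^'d) dbl \<Rightarrow> real^'m)
      \<Rightarrow> real \<Rightarrow> (real^'d) dbl \<Rightarrow> (real^'d) dbl" where
  "rattle M \<xi> V \<Lambda> \<Delta>t = (\<lambda>(q, p).
     let l_half = (1 / \<Delta>t) *\<^sub>R \<Lambda> (q, unconstrained_step M V \<Delta>t (q, p));
         ph = p - (\<Delta>t / 2) *\<^sub>R grad V q + grad_mat \<xi> q *v l_half;
         q1 = q + \<Delta>t *\<^sub>R (matrix_inv M *v ph);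
         p1 = (\<lambda>l. ph - (\<Delta>t / 2) *\<^sub>R grad V q1 + grad_mat \<xi> q1 *v l);
         l1 = (THE l. p1 l \<in> cotangent_space M \<xi> q1)
     in (q1, - p1 l1))"

definition reversible_set ::
    "real^'d^'d \<Rightarrow> (real^'d \<Rightarrow> real^'m) \<Rightarrow> (real^'d \<Rightarrow> real) \<Rightarrow> (real^'d) dbl set
      \<Rightarrow> ((real^'d) dbl \<Rightarrow> real^'m) \<Rightarrow> real \<Rightarrow> (real^'d) dbl set" where
  "reversible_set M \<xi> V D \<Lambda> \<Delta>t =
     {z \<in> rattle_domain M \<xi> V D \<Delta>t.
        rattle M \<xi> V \<Lambda> \<Delta>t z \<in> rattle_domain M \<xi> V D \<Delta>t \<and>
        (rattle M \<xi> V \<Lambda> \<Delta>t \<circ> rattle M \<xi> V \<Lambda> \<Delta>t) z = z}"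

definition rattle_rev ::
    "real^'d^'d \<Rightarrow> (real^'d \<Rightarrow> real^'m) \<Rightarrow> (real^'d \<Rightarrow> real) \<Rightarrow> (real^'d) dbl set
      \<Rightarrow> ((real^'d) dbl \<Rightarrow> real^'m) \<Rightarrow> real \<Rightarrow> (real^'d) dbl \<Rightarrow> (real^'d) dbl" where
  "rattle_rev M \<xi> V D \<Lambda> \<Delta>t z =
     (if z \<in> reversible_set M \<xi> V D \<Lambda> \<Delta>t then rattle M \<xi> V \<Lambda> \<Delta>t z else z)"


section \<open>Constrained Hybrid Monte Carlo\<close>

definition metropolis ::
    "('a \<Rightarrow> real) \<Rightarrow> ('a \<Rightarrow> 'a) \<Rightarrow> real \<Rightarrow> 'a \<Rightarrow> 'a" where
  "metropolis H \<Psi> u z = (if u \<le> exp (- H (\<Psi> z) + H z) then \<Psi> z else z)"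

definition chmc_kernel ::
    "'k::finite itself \<Rightarrow> real^'d^'d \<Rightarrow> (real^'d \<Rightarrow> real^'m) \<Rightarrow> (real^'d \<Rightarrow> real)
      \<Rightarrow> (real^'d) dbl set \<Rightarrow> ((real^'d) dbl \<Rightarrow> real^'m) \<Rightarrow> real
      \<Rightarrow> (real^'d) dbl \<Rightarrow> (real^'d) dbl measure" where
  "chmc_kernel k M \<xi> V D \<Lambda> \<Delta>t = (\<lambda>(q, p).
     momentum_kernel k M \<xi> q \<bind> (\<lambda>p'.
     uniform_measure lborel {0<..<1} \<bind> (\<lambda>u.
     return (phase_space M \<xi>)
       (metropolis (hamiltonian M V) (rattle_rev M \<xi> V D \<Lambda> \<Delta>t) u (q, p')))))"

definition markov_kernel :: "'a measure \<Rightarrow> ('a \<Rightarrow> 'a measure) \<Rightarrow> bool" where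
  "markov_kernel S K \<longleftrightarrow> K \<in> S \<rightarrow>\<^sub>M prob_algebra S"

definition invariant_measure :: "('a \<Rightarrow> 'a measure) \<Rightarrow> 'a measure \<Rightarrow> bool" where
  "invariant_measure K \<mu> \<longleftrightarrow> markov_kernel \<mu> K \<and> \<mu> \<bind> K = \<mu>"

end

theory Submission
  imports Defs
begin

text \<open>
  One step of the chain refreshes the momentum and then makes a Metropolis step along the map with
  reverse projection check.  The refreshment preserves the target measure, because given the position the
  momentum has the Gaussian law from which it is drawn (\<open>refreshment_average\<close>).  The Metropolis step
  preserves it, because the map is an involution that preserves the Liouville measure, and then the
  accepted weight, the minimum of \<open>exp (- H)\<close> at a point and at its image, is invariant under the map
  (\<open>metropolis_balance\<close>).  What has to be understood is why RATTLE preserves the Liouville measure on the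
  reversible set (\<open>liouville_invariant\<close>).

  The argument replaces the symplectic form by generating functions.  Instead of a
  position \<open>q\<close> and a momentum \<open>p\<close>, take as coordinates the position \<open>q\<close> and the next position
  \<open>q1\<close>.  The momentum is recovered as the projection onto the cotangent space at \<open>q\<close> of
  \<open>M (q1 - q) / h + h / 2 \<nabla>V(q)\<close>, since Lagrange multipliers act in normal directions.  The
  map \<open>lift\<close> sends \<open>(q, q1)\<close> to this phase space point, and RATTLE with momentum reversal sends
  \<open>lift (q, q1)\<close> to \<open>lift (q1, q)\<close> (\<open>rattle_lift\<close>, \<open>pairs_rattle\<close>): it exchanges the two positions.  In
  the new coordinates the Liouville measure on the reversible set has a density with respect to \<open>\<sigma> \<otimes> \<sigma>\<close>, where \<open>\<sigma>\<close> is the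
  Riemannian measure.  It is found by substituting \<open>q1\<close> for \<open>p\<close> in each fiber
  (\<open>nn_integral_fiber_change\<close>) and equals the absolute value of the determinant of the mixed second derivative, in orthonormal bases of the tangent spaces, of the
  discrete action \<open>(q1 - q)\<^sup>T M (q1 - q) / (2 h) - h (V q + V q1) / 2\<close>, which is symmetric in \<open>q\<close> and \<open>q1\<close>.  Fubini's theorem concludes.

  To compute with the measures, they are first written as integrals in coordinates.  This takes an
  atlas of the level set, obtained from the inverse function theorem with smooth inverse
  (\<open>countable_atlas_exists\<close>), a basis of the tangent spaces that depends on the point in a Borel way (\<open>frame\<close>), and
  the formula for Lebesgue measure on a subspace in an arbitrary basis
  (\<open>nn_integral_subspace_measure\<close>).
\<close>

section \<open>Change of variables in real coordinate space\<close>

text \<open>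
  The change of variables theorem for \<open>real^'n\<close> asks for a well-ordered index type, whereas the
  coordinates of a manifold are indexed by an arbitrary finite type.  A finite type has no canonical
  order, but a copy of it can be ordered through any injection into the natural numbers, and neither
  Lebesgue measure nor the determinant depends on how the coordinates are named.
\<close>

typedef 'a wo = "UNIV :: 'a set" by auto

definition wo_index :: "'a::finite \<Rightarrow> nat" where
  "wo_index = (SOME f. inj f)"

lemma inj_wo_index: "inj (wo_index :: 'a::finite \<Rightarrow> nat)"
proof -
  have "\<exists>f :: 'a \<Rightarrow> nat. inj f"
    using finite_imp_inj_to_nat_seg[of "UNIV :: 'a set"] by auto
  then show ?thesis unfolding wo_index_def by (rule someI_ex)
qed

instantiation wo :: (finite) "{finite,wellorder}"
begin

definition less_eq_wo :: "'a wo \<Rightarrow> 'a wo \<Rightarrow> bool" where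
  "less_eq_wo x y \<longleftrightarrow> wo_index (Rep_wo x) \<le> wo_index (Rep_wo y)"

definition less_wo :: "'a wo \<Rightarrow> 'a wo \<Rightarrow> bool" where
  "less_wo x y \<longleftrightarrow> wo_index (Rep_wo x) < wo_index (Rep_wo y)"

instance
proof
  show "finite (UNIV :: 'a wo set)"
    using finite_imageI[of "UNIV :: 'a set" Abs_wo] type_definition.Abs_image[OF type_definition_wo]
    by (metis finite)
next
  fix P :: "'a wo \<Rightarrow> bool" and a
  assume step: "\<And>x. (\<And>y. y < x \<Longrightarrow> P y) \<Longrightarrow> P x"
  show "P a"
    by (induction a rule: measure_induct_rule[where f = "\<lambda>x. wo_index (Rep_wo x)"])
       (rule step, simp add: less_wo_def)
qed (auto simp: less_eq_wo_def less_wo_def Rep_wo_inject inj_eq[OF inj_wo_index])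

end

lemma bij_Rep_wo: "bij Rep_wo"
  by (metis Abs_wo_inverse Rep_wo_inverse UNIV_I bijI')

lemma bij_Abs_wo: "bij Abs_wo"
  by (metis Abs_wo_inverse Rep_wo_inverse UNIV_I bijI')

definition to_wo :: "real^'k \<Rightarrow> real^('k::finite) wo" where
  "to_wo x = (\<chi> i. x $ Rep_wo i)"

definition of_wo :: "real^('k::finite) wo \<Rightarrow> real^'k" where
  "of_wo x = (\<chi> i. x $ Abs_wo i)"

lemma of_to_wo [simp]: "of_wo (to_wo x) = x" and to_of_wo [simp]: "to_wo (of_wo y) = y"
  by (simp_all add: to_wo_def of_wo_def vec_eq_iff Rep_wo_inverse Abs_wo_inverse)

lemma linear_to_wo: "linear to_wo" and linear_of_wo: "linear of_wo"
  by (auto intro!: linearI simp: to_wo_def of_wo_def vec_eq_iff)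

lemma measurable_to_wo [measurable]: "to_wo \<in> borel_measurable borel"
  and measurable_of_wo [measurable]: "of_wo \<in> borel_measurable borel"
  by (auto intro!: borel_measurable_continuous_onI linear_continuous_on
      simp: linear_conv_bounded_linear[symmetric] linear_to_wo linear_of_wo)

lemma prod_Basis_vec:
  fixes x :: "real^'n"
  shows "(\<Prod>b\<in>Basis. f (x \<bullet> b)) = (\<Prod>i\<in>UNIV. f (x $ i))"
proof -
  have inj: "inj (\<lambda>i::'n. axis i (1::real))" by (auto simp: inj_def axis_eq_axis)
  have B: "(Basis :: (real^'n) set) = range (\<lambda>i. axis i 1)" by (auto simp: Basis_vec_def)
  show ?thesis unfolding B by (subst prod.reindex[OF inj]) (simp add: inner_axis)
qed

lemma box_vec: "box l u = {x :: real^'n. \<forall>i. l $ i < x $ i \<and> x $ i < u $ i}"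
  by (auto simp: mem_box_cart)

lemma lborel_distr_to_wo: "distr lborel borel to_wo = (lborel :: (real^('k::finite) wo) measure)"
proof (rule sym, rule lborel_eqI)
  fix l u :: "real^'k wo" assume le: "\<And>b. b \<in> Basis \<Longrightarrow> l \<bullet> b \<le> u \<bullet> b"
  have le': "l $ i \<le> u $ i" for i using le[of "axis i 1"] by (auto simp: inner_axis)
  have "to_wo -` box l u = box (of_wo l) (of_wo u)"
    unfolding box_vec to_wo_def of_wo_def by (auto) (metis Rep_wo_inverse Abs_wo_inverse UNIV_I)+
  then have "emeasure (distr lborel borel to_wo) (box l u) = emeasure lborel (box (of_wo l) (of_wo u))"
    by (simp add: emeasure_distr)
  also have "\<dots> = ennreal (\<Prod>b\<in>Basis. (of_wo u - of_wo l) \<bullet> b)"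
    by (rule emeasure_lborel_box) (auto simp: Basis_vec_def inner_axis of_wo_def le')
  also have "(\<Prod>b\<in>Basis. (of_wo u - of_wo l) \<bullet> b) = (\<Prod>i\<in>UNIV. (u - l) $ Abs_wo i)"
    by (subst prod_Basis_vec[where f="\<lambda>x. x"]) (simp add: of_wo_def)
  also have "\<dots> = (\<Prod>i\<in>UNIV. (u - l) $ i)"
    by (rule prod.reindex_bij_witness[where i="Rep_wo" and j="Abs_wo"])
       (auto simp: Rep_wo_inverse Abs_wo_inverse)
  also have "\<dots> = (\<Prod>b\<in>Basis. (u - l) \<bullet> b)"
    by (subst prod_Basis_vec[where f="\<lambda>x. x"]) simp
  finally show "emeasure (distr lborel borel to_wo) (box l u) = ennreal (\<Prod>b\<in>Basis. (u - l) \<bullet> b)" .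
qed simp

lemma nn_integral_to_wo:
  assumes "f \<in> borel_measurable borel"
  shows "(\<integral>\<^sup>+x. f (to_wo x) \<partial>lborel) = (\<integral>\<^sup>+y. f y \<partial>(lborel :: (real^('k::finite) wo) measure))"
  by (subst lborel_distr_to_wo[symmetric], subst nn_integral_distr) (use assms in auto)

text \<open>
  Renaming the indices conjugates the permutations in the Leibniz formula, which keeps their signs.
\<close>

lemma det_reindex:
  fixes A :: "real^('k::finite)^'k"
  shows "det (\<chi> i j. A $ Rep_wo i $ Rep_wo j) = det A"
proof -
  let ?P = "map_permutation (UNIV::'k wo set) Rep_wo"
  have Rep: "inj Rep_wo" "range Rep_wo = UNIV" using bij_Rep_wo by (auto simp: bij_def)
  have P: "?P p = Rep_wo \<circ> p \<circ> Abs_wo" for p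
  proof -
    have "inv Rep_wo = (Abs_wo :: 'k \<Rightarrow> _)" using bij_Rep_wo by (intro inv_equality) (auto simp: Rep_wo_inverse Abs_wo_inverse)
    then show ?thesis unfolding map_permutation_def restrict_id_def Rep by (auto simp: o_def)
  qed
  have perm: "p permutes UNIV \<longleftrightarrow> bij p" for p :: "'b \<Rightarrow> 'b"
    by (metis bij_imp_permutes permutes_bij UNIV_I)
  have conj: "Rep_wo \<circ> (Abs_wo \<circ> a \<circ> Rep_wo) \<circ> Abs_wo = a" for a :: "'k \<Rightarrow> 'k"
    by (auto simp: fun_eq_iff Abs_wo_inverse)
  have "det A = (\<Sum>p | p permutes UNIV. of_int (sign p) * (\<Prod>i\<in>UNIV. A $ i $ p i))"
    by (simp add: det_def)
  also have "\<dots> = (\<Sum>p | p permutes UNIV. of_int (sign (?P p)) * (\<Prod>i\<in>UNIV. A $ i $ ?P p i))"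
    by (rule sum.reindex_bij_witness[where i="?P" and j="\<lambda>p. Abs_wo \<circ> p \<circ> Rep_wo"])
       (auto simp: P perm fun_eq_iff Rep_wo_inverse Abs_wo_inverse conj intro!: bij_comp bij_Rep_wo bij_Abs_wo)
  also have "\<dots> = (\<Sum>p | p permutes (UNIV::'k wo set). of_int (sign p) * (\<Prod>i\<in>UNIV. A $ Rep_wo i $ Rep_wo (p i)))"
  proof (intro sum.cong refl arg_cong2[where f="(*)"])
    fix p :: "'k wo \<Rightarrow> 'k wo" assume "p \<in> {p. p permutes UNIV}"
    then show "of_int (sign (?P p)) = (of_int (sign p) :: real)"
      by (simp add: sign_map_permutation Rep)
    show "(\<Prod>i\<in>UNIV. A $ i $ ?P p i) = (\<Prod>i\<in>UNIV. A $ Rep_wo i $ Rep_wo (p i))"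
      by (rule prod.reindex_bij_witness[where i="Rep_wo" and j="Abs_wo"])
         (auto simp: P Rep_wo_inverse Abs_wo_inverse)
  qed
  finally show ?thesis by (simp add: det_def)
qed

text \<open>
  The image has finite measure iff the Jacobian is integrable.  With values in \<open>ennreal\<close> no such
  condition is left, because otherwise both sides are infinite.
\<close>

lemma emeasure_differentiable_image_wo:
  fixes g :: "real^'n::{finite,wellorder} \<Rightarrow> real^'n::_"
  assumes S: "S \<in> sets lebesgue"
    and der: "\<And>x. x \<in> S \<Longrightarrow> (g has_derivative g' x) (at x within S)"
    and inj: "inj_on g S"
    and meas: "(\<lambda>x. indicator S x * \<bar>det (matrix (g' x))\<bar>) \<in> borel_measurable borel"
  shows "emeasure lebesgue (g ` S) = (\<integral>\<^sup>+x. ennreal (\<bar>det (matrix (g' x))\<bar>) * indicator S x \<partial>lborel)"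
proof (cases "(\<integral>\<^sup>+x. ennreal (\<bar>det (matrix (g' x))\<bar>) * indicator S x \<partial>lborel) < \<infinity> \<or> g ` S \<in> lmeasurable")
  case True
  have "(\<lambda>x. \<bar>det (matrix (g' x))\<bar>) integrable_on S"
  proof (cases "g ` S \<in> lmeasurable")
    case True
    then show ?thesis using measurable_differentiable_image_eq[OF S der inj] by simp
  next
    case False
    have "(\<integral>\<^sup>+x. ennreal (indicator S x * \<bar>det (matrix (g' x))\<bar>) \<partial>lborel)
        = (\<integral>\<^sup>+x. ennreal (\<bar>det (matrix (g' x))\<bar>) * indicator S x \<partial>lborel)"
      by (intro nn_integral_cong) (auto simp: indicator_def)
    with False True have "(\<lambda>x. indicator S x * \<bar>det (matrix (g' x))\<bar>) integrable_on UNIV"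
      by (intro nn_integral_integrable_on meas) auto
    moreover have "(\<lambda>x. indicator S x * \<bar>det (matrix (g' x))\<bar>) = (\<lambda>x. if x \<in> S then \<bar>det (matrix (g' x))\<bar> else 0)"
      by (auto simp: indicator_def)
    ultimately show ?thesis by (simp add: integrable_restrict_UNIV)
  qed
  then obtain m where m: "((\<lambda>x. \<bar>det (matrix (g' x))\<bar>) has_integral m) S" by blast
  have 1: "g ` S \<in> lmeasurable" "measure lebesgue (g ` S) = m"
    using has_measure_differentiable_image[OF S der inj] m by auto
  have "(\<integral>\<^sup>+x. ennreal (\<bar>det (matrix (g' x))\<bar>) * indicator S x \<partial>lborel) = ennreal m"
    by (rule nn_integral_has_integral_lebesgue'[OF _ m]) auto
  then show ?thesis using 1 by (simp add: emeasure_eq_measure2 fmeasurableD)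
next
  case False
  have "g ` S \<in> sets lebesgue"
    using S der by (intro differentiable_image_in_sets_lebesgue)
       (auto simp: differentiable_on_def differentiable_def)
  with False have "emeasure lebesgue (g ` S) = \<infinity>"
    by (metis fmeasurableI infinity_ennreal_def top.not_eq_extremum)
  with False show ?thesis by (metis infinity_ennreal_def top.not_eq_extremum)
qed

lemma det_matrix_wo:
  assumes "linear h"
  shows "det (matrix (to_wo \<circ> h \<circ> of_wo)) = det (matrix (h :: real^'k \<Rightarrow> real^'k::finite))"
proof -
  have ax: "of_wo (axis j 1) = axis (Rep_wo j) (1::real)" for j :: "'k wo"
    by (auto simp: of_wo_def axis_def vec_eq_iff Abs_wo_inverse Rep_wo_inverse)
  have "matrix (to_wo \<circ> h \<circ> of_wo) = (\<chi> i j. matrix h $ Rep_wo i $ Rep_wo j)"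
    by (simp add: matrix_def to_wo_def vec_eq_iff ax)
  then show ?thesis by (simp add: det_reindex)
qed

lemma emeasure_differentiable_image:
  fixes g :: "real^'k::finite \<Rightarrow> real^'k"
  assumes S: "S \<in> sets borel" and gS: "g ` S \<in> sets borel"
    and der: "\<And>x. x \<in> S \<Longrightarrow> (g has_derivative g' x) (at x within S)"
    and inj: "inj_on g S"
    and meas: "(\<lambda>x. indicator S x * \<bar>det (matrix (g' x))\<bar>) \<in> borel_measurable borel"
  shows "emeasure lborel (g ` S) = (\<integral>\<^sup>+x. ennreal (\<bar>det (matrix (g' x))\<bar>) * indicator S x \<partial>lborel)"
proof -
  let ?S = "to_wo ` S" and ?g = "to_wo \<circ> g \<circ> of_wo" and ?g' = "\<lambda>y. to_wo \<circ> g' (of_wo y) \<circ> of_wo"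
  have im: "to_wo ` X = of_wo -` X" for X :: "(real^'k) set" by force
  have S': "?S \<in> sets borel" and gS': "?g ` ?S = to_wo ` g ` S" "to_wo ` g ` S \<in> sets borel"
    using measurable_sets_borel[OF measurable_of_wo S] measurable_sets_borel[OF measurable_of_wo gS]
    by (auto simp: im[symmetric] image_image)
  have der': "(?g has_derivative ?g' y) (at y within ?S)" if "y \<in> ?S" for y
  proof -
    from that have y: "of_wo y \<in> S" by auto
    have l: "(of_wo has_derivative of_wo) F" "(to_wo has_derivative to_wo) G" for F G
      using linear_of_wo linear_to_wo by (auto intro!: linear_imp_has_derivative)
    have "(g has_derivative g' (of_wo y)) (at (of_wo y) within of_wo ` ?S)"
      using der[OF y] by (simp add: image_image)
    from diff_chain_within[OF diff_chain_within[OF l(1) this] l(2)]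
    show ?thesis by (simp add: o_assoc)
  qed
  have lin: "linear (g' x)" if "x \<in> S" for x using der[OF that] has_derivative_linear by blast
  have J: "indicator ?S y * \<bar>det (matrix (?g' y))\<bar> = indicator S (of_wo y) * \<bar>det (matrix (g' (of_wo y)))\<bar>" for y
    using det_matrix_wo[OF lin] by (auto simp: indicator_def im)
  have inj': "inj_on ?g ?S" using inj by (auto simp: inj_on_def) (metis of_to_wo)+
  have meas': "(\<lambda>y. indicator ?S y * \<bar>det (matrix (?g' y))\<bar>) \<in> borel_measurable borel"
    unfolding J using measurable_compose[OF measurable_of_wo meas] by simp
  have "emeasure lborel (g ` S) = emeasure lborel (to_wo ` g ` S)"
  proof -
    have "to_wo -` to_wo ` g ` S = g ` S" by (auto) (metis of_to_wo imageI)
    then show ?thesis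
      by (subst lborel_distr_to_wo[symmetric], subst emeasure_distr) (use gS' in auto)
  qed
  also have "\<dots> = emeasure lebesgue (?g ` ?S)" using gS' by simp
  also have "\<dots> = (\<integral>\<^sup>+y. ennreal (\<bar>det (matrix (?g' y))\<bar>) * indicator ?S y \<partial>lborel)"
    by (rule emeasure_differentiable_image_wo[OF _ der' inj' meas']) (use S' in auto)
  also have "\<dots> = (\<integral>\<^sup>+y. ennreal (indicator ?S y * \<bar>det (matrix (?g' y))\<bar>) \<partial>lborel)"
    by (intro nn_integral_cong) (auto simp: indicator_def)
  also have "\<dots> = (\<integral>\<^sup>+x. ennreal (indicator ?S (to_wo x) * \<bar>det (matrix (?g' (to_wo x)))\<bar>) \<partial>lborel)"
    by (rule nn_integral_to_wo[symmetric]) (use meas' in simp)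
  also have "\<dots> = (\<integral>\<^sup>+x. ennreal (\<bar>det (matrix (g' x))\<bar>) * indicator S x \<partial>lborel)"
    unfolding J by (intro nn_integral_cong) (auto simp: indicator_def)
  finally show ?thesis .
qed

text \<open>
  Both sides integrate \<open>f\<close> against a measure.  The two measures agree on every Borel set \<open>B\<close>, since
  \<open>g\<close> maps the part of \<open>S\<close> lying over \<open>B\<close> injectively onto \<open>g ` S \<inter> B\<close>.
\<close>

lemma nn_integral_change_of_variables:
  fixes g :: "real^'k::finite \<Rightarrow> real^'k"
  assumes S: "S \<in> sets borel" and gS: "g ` S \<in> sets borel"
    and der: "\<And>x. x \<in> S \<Longrightarrow> (g has_derivative g' x) (at x within S)"
    and inj: "inj_on g S"
    and meas: "(\<lambda>x. indicator S x * \<bar>det (matrix (g' x))\<bar>) \<in> borel_measurable borel"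
    and f: "f \<in> borel_measurable borel"
  shows "(\<integral>\<^sup>+y. f y * indicator (g ` S) y \<partial>lborel)
       = (\<integral>\<^sup>+x. f (g x) * ennreal (\<bar>det (matrix (g' x))\<bar>) * indicator S x \<partial>lborel)"
proof -
  let ?D = "\<lambda>x. ennreal (indicator S x * \<bar>det (matrix (g' x))\<bar>)"
  let ?g = "\<lambda>x. if x \<in> S then g x else 0"
  have cont: "continuous_on S g"
    using der by (meson continuous_on_eq_continuous_within has_derivative_continuous)
  have g: "?g \<in> borel_measurable borel"
    using borel_measurable_continuous_on_if[OF S cont, of "\<lambda>_. 0"] by simp
  have D: "?D \<in> borel_measurable lborel" using meas by simp
  have eq: "density lborel (indicator (g ` S)) = distr (density lborel ?D) borel ?g"
  proof (rule measure_eqI)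
    fix B assume "B \<in> sets (density lborel (indicator (g ` S)))"
    then have B: "B \<in> sets borel" by simp
    define E where "E = S \<inter> ?g -` B"
    have E: "E \<in> sets borel" "E \<subseteq> S" unfolding E_def using S measurable_sets_borel[OF g B] by auto
    have gE: "g ` E = g ` S \<inter> B" unfolding E_def by (auto split: if_splits)
    have DE: "indicator E x * \<bar>det (matrix (g' x))\<bar> = indicator E x * (indicator S x * \<bar>det (matrix (g' x))\<bar>)" for x
      using E(2) by (auto simp: indicator_def)
    have mE: "(\<lambda>x. indicator E x * \<bar>det (matrix (g' x))\<bar>) \<in> borel_measurable borel"
      unfolding DE using meas E(1) by measurable
    have "emeasure (density lborel (indicator (g ` S))) B = emeasure lborel (g ` E)"
      using gS B unfolding gE by (simp add: emeasure_density indicator_inter_arith[symmetric] sets.Int)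
    also have "\<dots> = (\<integral>\<^sup>+x. ennreal (\<bar>det (matrix (g' x))\<bar>) * indicator E x \<partial>lborel)"
      by (rule emeasure_differentiable_image)
         (use E gE gS B der inj mE in \<open>auto intro: has_derivative_subset inj_on_subset\<close>)
    also have "\<dots> = (\<integral>\<^sup>+x. ?D x * indicator (?g -` B) x \<partial>lborel)"
      by (intro nn_integral_cong) (auto simp: E_def indicator_def)
    also have "\<dots> = emeasure (distr (density lborel ?D) borel ?g) B"
      using B g measurable_sets_borel[OF g B] D by (simp add: emeasure_distr emeasure_density)
    finally show "emeasure (density lborel (indicator (g ` S))) B = emeasure (distr (density lborel ?D) borel ?g) B" .
  qed simp
  have "(\<integral>\<^sup>+y. f y * indicator (g ` S) y \<partial>lborel) = (\<integral>\<^sup>+y. f y \<partial>density lborel (indicator (g ` S)))"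
    using gS f by (subst nn_integral_density) (auto simp: mult.commute)
  also have "\<dots> = (\<integral>\<^sup>+x. ?D x * f (?g x) \<partial>lborel)"
    unfolding eq using f g D by (simp add: nn_integral_distr nn_integral_density)
  also have "\<dots> = (\<integral>\<^sup>+x. f (g x) * ennreal (\<bar>det (matrix (g' x))\<bar>) * indicator S x \<partial>lborel)"
    by (intro nn_integral_cong) (auto simp: indicator_def mult.commute)
  finally show ?thesis .
qed

section \<open>Positive definite forms\<close>

lemma inner_transpose: "(transpose A *v x) \<bullet> y = x \<bullet> (A *v y)"
  for A :: "real^'n^'m"
  by (simp add: dot_lmul_matrix)

lemma inner_congruence:
  fixes P :: "real^'d^'d" and A :: "real^'k^'d"
  shows "x \<bullet> ((transpose A ** P ** A) *v y) = (A *v x) \<bullet> (P *v (A *v y))"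
proof -
  have "x \<bullet> ((transpose A ** P ** A) *v y) = (transpose A *v (P *v (A *v y))) \<bullet> x"
    by (simp only: matrix_vector_mul_assoc matrix_mul_assoc inner_commute)
  also have "\<dots> = (P *v (A *v y)) \<bullet> (A *v x)" by (rule inner_transpose)
  finally show ?thesis by (simp only: inner_commute)
qed

lemma transpose_annihilates:
  fixes A :: "real^'k^'d" and N :: "real^'m^'d"
  assumes "\<And>x. transpose N *v (A *v x) = 0"
  shows "transpose A *v (N *v y) = 0"
proof -
  have "x \<bullet> (transpose A *v (N *v y)) = 0" for x
  proof -
    have "x \<bullet> (transpose A *v (N *v y)) = (transpose A *v (N *v y)) \<bullet> x" by (rule inner_commute)
    also have "\<dots> = (A *v x) \<bullet> (N *v y)" unfolding inner_transpose by (rule inner_commute)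
    also have "\<dots> = (transpose N *v (A *v x)) \<bullet> y" by (simp only: inner_transpose)
    finally show ?thesis by (simp only: assms inner_zero_left)
  qed
  then show ?thesis by (metis inner_eq_zero_iff)
qed

lemma sym_pos_def_invertible:
  fixes P :: "real^'n^'n"
  assumes "sym_pos_def P" shows "invertible P"
proof -
  have "x = 0" if "P *v x = 0" for x
    using assms that unfolding sym_pos_def_def by (metis inner_zero_right less_irrefl)
  then show ?thesis by (simp add: invertible_left_inverse matrix_left_invertible_ker)
qed

lemma invertible_matrix_inv:
  assumes "invertible (A :: real^'n^'n)"
  shows "A ** matrix_inv A = mat 1" "matrix_inv A ** A = mat 1"
  using someI_ex[OF assms[unfolded invertible_def]] by (auto simp: matrix_inv_def)

lemma matrix_inv_mult [simp]:
  assumes "sym_pos_def (P :: real^'n^'n)"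
  shows "P ** matrix_inv P = mat 1" "matrix_inv P ** P = mat 1"
    "P *v (matrix_inv P *v x) = x" "matrix_inv P *v (P *v x) = x"
  using invertible_matrix_inv[OF sym_pos_def_invertible[OF assms]]
  by (simp_all add: matrix_vector_mul_assoc)

lemma sym_pos_def_matrix_inv:
  assumes P: "sym_pos_def (P :: real^'n^'n)"
  shows "sym_pos_def (matrix_inv P)"
  unfolding sym_pos_def_def
proof (intro conjI allI impI)
  have sym: "transpose P = P" using P by (simp add: sym_pos_def_def)
  have "transpose (matrix_inv P) = transpose (matrix_inv P) ** (P ** matrix_inv P)"
    using P by simp
  also have "\<dots> = transpose (P ** matrix_inv P) ** matrix_inv P"
    by (simp add: matrix_transpose_mul sym matrix_mul_assoc)
  finally show tr: "transpose (matrix_inv P) = matrix_inv P" using P by (simp add: transpose_mat)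
  fix x :: "real^'n" assume "x \<noteq> 0"
  then have "matrix_inv P *v x \<noteq> 0" using matrix_inv_mult(3)[OF P, of x] by auto
  then have "0 < (matrix_inv P *v x) \<bullet> (P *v (matrix_inv P *v x))" using P unfolding sym_pos_def_def by blast
  then show "0 < x \<bullet> (matrix_inv P *v x)"
    unfolding matrix_inv_mult(3)[OF P] by (simp only: inner_commute)
qed

lemma sym_pos_def_inner_commute:
  "sym_pos_def P \<Longrightarrow> x \<bullet> (P *v y) = y \<bullet> (P *v x)"
  by (metis inner_commute inner_transpose sym_pos_def_def)

lemma sym_pos_def_congruence:
  fixes P :: "real^'d^'d" and A :: "real^'k^'d"
  assumes P: "sym_pos_def P" and A: "inj ((*v) A)"
  shows "sym_pos_def (transpose A ** P ** A)"
  unfolding sym_pos_def_def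
proof (intro conjI allI impI)
  show "transpose (transpose A ** P ** A) = transpose A ** P ** A"
    using P by (simp add: sym_pos_def_def matrix_transpose_mul matrix_mul_assoc)
  fix x :: "real^'k" assume "x \<noteq> 0"
  then have "A *v x \<noteq> 0" using A by (metis injD matrix_vector_mult_0_right)
  then have "0 < (A *v x) \<bullet> (P *v (A *v x))" using P by (simp add: sym_pos_def_def)
  then show "0 < x \<bullet> ((transpose A ** P ** A) *v x)" by (simp only: inner_congruence)
qed

text \<open>
  The Gram--Schmidt process for the scalar product of \<open>P\<close>.
\<close>

lemma orthonormal_set_exists:
  fixes P :: "real^'d^'d"
  assumes P: "sym_pos_def P" and T: "subspace T" and n: "n \<le> dim T"
  shows "\<exists>B \<subseteq> T. finite B \<and> card B = n \<and> (\<forall>b\<in>B. \<forall>c\<in>B. b \<bullet> (P *v c) = (if b = c then 1 else 0))"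
  using n
proof (induction n)
  case 0
  then show ?case by (intro exI[of _ "{}"]) auto
next
  case (Suc n)
  then obtain B where B: "B \<subseteq> T" "finite B" "card B = n"
      "\<And>b c. b \<in> B \<Longrightarrow> c \<in> B \<Longrightarrow> b \<bullet> (P *v c) = (if b = c then 1 else 0)" by auto
  have "dim (span B) \<le> n" using B(2,3) dim_le_card'[of B] by simp
  with Suc.prems have "\<not> T \<subseteq> span B" using dim_subset[of T "span B"] by linarith
  then obtain a where a: "a \<in> T" "a \<notin> span B" by auto
  define a' where "a' = a - (\<Sum>b\<in>B. (a \<bullet> (P *v b)) *\<^sub>R b)"
  have a'T: "a' \<in> T" unfolding a'_def
    using a B(1) T by (intro subspace_diff subspace_sum subspace_scale) auto
  have "(\<Sum>b\<in>B. (a \<bullet> (P *v b)) *\<^sub>R b) \<in> span B"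
    by (intro span_sum span_scale span_base)
  with a(2) have "a' \<noteq> 0" unfolding a'_def by auto
  then have pos: "0 < a' \<bullet> (P *v a')" using P by (simp add: sym_pos_def_def)
  have orth: "a' \<bullet> (P *v c) = 0" if "c \<in> B" for c
  proof -
    have "(\<Sum>b\<in>B. (a \<bullet> (P *v b)) * (b \<bullet> (P *v c))) = (\<Sum>b\<in>B. if b = c then a \<bullet> (P *v c) else 0)"
      using that by (intro sum.cong) (auto simp: B(4))
    then show ?thesis using that B(2)
      by (simp add: a'_def inner_diff_left inner_sum_left)
  qed
  define e where "e = (1 / sqrt (a' \<bullet> (P *v a'))) *\<^sub>R a'"
  have e1: "e \<bullet> (P *v e) = 1"
    using pos by (simp add: e_def matrix_vector_mult_scaleR real_sqrt_mult_self divide_simps)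
  have e2: "e \<bullet> (P *v c) = 0" "c \<bullet> (P *v e) = 0" if "c \<in> B" for c
    using orth[OF that] sym_pos_def_inner_commute[OF P, of c e] by (auto simp: e_def)
  have "e \<notin> B" using e1 e2 by fastforce
  then show ?case
    using B e1 e2 a'T T
    by (intro exI[of _ "insert e B"]) (auto simp: e_def intro: subspace_scale)
qed

lemma isometry_exists:
  fixes P :: "real^'d^'d"
  assumes P: "sym_pos_def P" and T: "subspace T" and dim: "dim T = CARD('k)"
  shows "\<exists>L :: real^'k \<Rightarrow> real^'d. linear L \<and> range L = T \<and> (\<forall>x y. L x \<bullet> (P *v L y) = x \<bullet> y)"
proof -
  obtain B where B: "B \<subseteq> T" "finite B" "card B = CARD('k)"
      "\<And>b c. b \<in> B \<Longrightarrow> c \<in> B \<Longrightarrow> b \<bullet> (P *v c) = (if b = c then 1 else 0)"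
    using orthonormal_set_exists[OF P T, of "CARD('k)"] dim by auto
  obtain h :: "'k \<Rightarrow> real^'d" where h: "bij_betw h UNIV B"
    using finite_same_card_bij[of "UNIV :: 'k set" B] B by auto
  have hB: "h i \<in> B" "h i = h j \<longleftrightarrow> i = j" for i j
    using h by (auto simp: bij_betw_def inj_eq)
  define L where "L = (\<lambda>x. \<Sum>i\<in>UNIV. (x $ i) *\<^sub>R h i)"
  have lin: "linear L" unfolding L_def
    by (intro linearI) (auto simp: sum.distrib scaleR_add_left scaleR_sum_right)
  have iso: "L x \<bullet> (P *v L y) = x \<bullet> y" for x y
  proof -
    have "P *v L y = (\<Sum>j\<in>UNIV. (y $ j) *\<^sub>R (P *v h j))"
      by (simp add: L_def matrix_vector_mult_scaleR linear_sum[OF matrix_vector_mul_linear])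
    then have "L x \<bullet> (P *v L y) = (\<Sum>i\<in>UNIV. \<Sum>j\<in>UNIV. x $ i * (y $ j * (h i \<bullet> (P *v h j))))"
      by (simp add: L_def inner_sum_left inner_sum_right sum_distrib_left) (subst sum.swap, simp add: mult_ac)
    also have "\<dots> = (\<Sum>i\<in>UNIV. \<Sum>j\<in>UNIV. if j = i then x $ i * y $ i else 0)"
      by (intro sum.cong) (auto simp: B(4) hB)
    finally show ?thesis by (simp add: inner_vec_def)
  qed
  have "inj L" using iso by (auto simp: linear_injective_0[OF lin]) (metis inner_eq_zero_iff inner_zero_left)
  then have "dim (range L) = CARD('k)"
    using dim_image_eq[of L "UNIV :: (real^'k) set"] lin by (simp add: dim_UNIV)
  moreover have "range L \<subseteq> T"
    unfolding L_def using B(1) hB T by (auto intro!: subspace_sum subspace_scale)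
  moreover have "subspace (range L)" using lin by (simp add: linear_subspace_image)
  ultimately have "range L = T" using T dim by (intro subspace_dim_equal) auto
  then show ?thesis using lin iso by blast
qed

lemma isometry_matrix:
  fixes P :: "real^'d^'d" and B :: "real^'k^'d"
  assumes "\<And>x y. (B *v x) \<bullet> (P *v (B *v y)) = x \<bullet> y"
  shows "transpose B ** P ** B = mat 1"
proof -
  have "x \<bullet> ((transpose B ** P ** B) *v y) = x \<bullet> y" for x y
    by (simp only: inner_congruence assms)
  then have "(transpose B ** P ** B) *v y = mat 1 *v y" for y by (metis vector_eq_ldot matrix_vector_mul_lid)
  then show ?thesis by (simp add: matrix_eq)
qed

lemma sym_pos_def_det_pos:
  fixes Q :: "real^'k^'k"
  assumes Q: "sym_pos_def Q"
  shows "0 < det Q"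
proof -
  obtain L :: "real^'k \<Rightarrow> real^'k" where L: "linear L" "\<And>x y. L x \<bullet> (Q *v L y) = x \<bullet> y"
    using isometry_exists[OF Q subspace_UNIV, where 'k='k] by (auto simp: dim_UNIV)
  define B where "B = matrix L"
  have LB: "L x = B *v x" for x unfolding B_def by (simp add: matrix_works L(1))
  have "transpose B ** Q ** B = mat 1" using L(2) unfolding LB by (intro isometry_matrix)
  then have "det (transpose B ** Q ** B) = det (mat 1 :: real^'k^'k)" by (simp only:)
  then have "(det B)\<^sup>2 * det Q = 1"
    unfolding det_mul det_transpose det_I power2_eq_square by (simp only: mult_ac)
  then have "0 < (det B)\<^sup>2 * det Q" by linarith
  moreover have "0 \<le> (det B)\<^sup>2" by (rule zero_le_power2)
  ultimately show ?thesis unfolding zero_less_mult_iff by linarith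
qed

lemmas det_congruence_pos = sym_pos_def_det_pos[OF sym_pos_def_congruence]

section \<open>Lebesgue measure on a subspace\<close>

text \<open>
  Any injective matrix with range \<open>T\<close> computes the measure, not only an isometry.  If \<open>L\<close> is the chosen
  isometry, with matrix \<open>B\<close>, then \<open>A = B ** R\<close> for a square matrix \<open>R\<close>, and \<open>transpose B ** P ** B = mat 1\<close>
  turns the Gram matrix of \<open>A\<close> into \<open>transpose R ** R\<close>.  Hence the root of its determinant is the
  Jacobian \<open>\<bar>det R\<bar>\<close> of the change of coordinates.
\<close>

lemma nn_integral_subspace_measure:
  fixes P :: "real^'d^'d" and A :: "real^'k^'d"
  assumes P: "sym_pos_def P" and A: "inj ((*v) A)" and T: "range ((*v) A) = T"
    and f: "f \<in> borel_measurable (restrict_space borel T)"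
  shows "(\<integral>\<^sup>+p. f p \<partial>subspace_measure (k :: 'k itself) P T)
       = (\<integral>\<^sup>+v. f (A *v v) * ennreal (sqrt (det (transpose A ** P ** A))) \<partial>lborel)"
proof -
  define L where "L = (SOME L :: real^'k \<Rightarrow> real^'d.
          linear L \<and> range L = T \<and> (\<forall>x y. L x \<bullet> (P *v L y) = x \<bullet> y))"
  have sub: "subspace T" unfolding T[symmetric]
    by (rule linear_subspace_image) (auto simp: matrix_vector_mul_linear)
  have dim: "dim T = CARD('k)"
    unfolding T[symmetric] using dim_image_eq[of "(*v) A" "UNIV :: (real^'k) set"] A
    by (simp add: dim_UNIV matrix_vector_mul_linear)
  have L: "linear L" "range L = T" "\<And>x y. L x \<bullet> (P *v L y) = x \<bullet> y"
    using someI_ex[OF isometry_exists[OF P sub dim]] unfolding L_def by auto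
  define B where "B = matrix L"
  have LB: "L x = B *v x" for x using L(1) by (simp add: B_def matrix_works)
  define R where "R = transpose B ** P ** A"
  have B1: "transpose B ** P ** B = mat 1"
    using L(3) by (intro isometry_matrix) (simp add: LB)
  have BR: "B *v (R *v x) = A *v x" for x
  proof -
    obtain y where y: "A *v x = B *v y" using T L(2) LB by (metis rangeE rangeI)
    have "R *v x = (transpose B ** P ** B) *v y"
      by (simp add: R_def matrix_vector_mul_assoc[symmetric] y)
    then show ?thesis by (simp add: B1 y)
  qed
  have AB: "A = B ** R" by (simp add: matrix_eq matrix_vector_mul_assoc[symmetric] BR)
  have "transpose A ** P ** A = transpose R ** (transpose B ** P ** B) ** R"
    by (simp add: AB matrix_transpose_mul matrix_mul_assoc)
  then have det: "sqrt (det (transpose A ** P ** A)) = \<bar>det R\<bar>"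
    by (simp add: B1 det_mul power2_eq_square[symmetric])
  have injR: "inj ((*v) R)" using A BR by (metis inj_def)
  then have surjR: "range ((*v) R) = UNIV"
    using linear_injective_imp_surjective[OF matrix_vector_mul_linear injR] by auto
  have Lm: "L \<in> lborel \<rightarrow>\<^sub>M restrict_space borel T"
    using L by (intro measurable_restrict_space2)
       (auto intro!: borel_measurable_continuous_onI linear_continuous_on simp: linear_conv_bounded_linear)
  have fm: "(\<lambda>x. f (L x)) \<in> borel_measurable borel"
    using measurable_compose[OF Lm f] by simp
  have "(\<integral>\<^sup>+p. f p \<partial>subspace_measure (k :: 'k itself) P T) = (\<integral>\<^sup>+y. f (L y) \<partial>lborel)"
    unfolding subspace_measure_def L_def[symmetric] by (rule nn_integral_distr[OF Lm]) (simp add: f)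
  also have "\<dots> = (\<integral>\<^sup>+y. f (L y) * indicator ((*v) R ` UNIV) y \<partial>lborel)"
    by (simp add: surjR)
  also have "\<dots> = (\<integral>\<^sup>+x. f (L (R *v x)) * ennreal \<bar>det (matrix ((*v) R))\<bar> * indicator UNIV x \<partial>lborel)"
    by (rule nn_integral_change_of_variables[OF _ _ _ _ _ fm])
       (use injR surjR in \<open>auto intro!: linear_imp_has_derivative matrix_vector_mul_linear\<close>)
  also have "\<dots> = (\<integral>\<^sup>+v. f (A *v v) * ennreal (sqrt (det (transpose A ** P ** A))) \<partial>lborel)"
    by (simp add: det LB BR)
  finally show ?thesis .
qed

lemma nn_integral_gaussian:
  "(\<integral>\<^sup>+x. ennreal (exp (- (x \<bullet> x) / 2)) \<partial>(lborel :: (real^'k) measure)) = ennreal ((2 * pi) powr (real CARD('k) / 2))"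
proof -
  have 1: "(\<integral>\<^sup>+x. ennreal (exp (- x\<^sup>2 / 2)) \<partial>lborel) = ennreal (sqrt (2 * pi))"
  proof -
    have "(\<integral>\<^sup>+x. ennreal (exp (- x\<^sup>2 / 2)) \<partial>lborel)
        = (\<integral>\<^sup>+x. ennreal (sqrt (2 * pi)) * ennreal (std_normal_density x) \<partial>lborel)"
      by (intro nn_integral_cong) (simp add: std_normal_density_def ennreal_mult[symmetric])
    also have "\<dots> = ennreal (sqrt (2 * pi)) * (\<integral>\<^sup>+x. ennreal (std_normal_density x) \<partial>lborel)"
      by (rule nn_integral_cmult) simp
    also have "(\<integral>\<^sup>+x. ennreal (std_normal_density x) \<partial>lborel) = 1"
      using prob_space.emeasure_space_1[OF prob_space_normal_density[of 1 0]]
      by (simp add: emeasure_density)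
    finally show ?thesis by simp
  qed
  have e: "exp (- (x \<bullet> x) / 2) = (\<Prod>b\<in>Basis. exp (- (x \<bullet> b)\<^sup>2 / 2))" for x :: "real^'k"
  proof -
    have "(\<Prod>b\<in>Basis. exp (- (x \<bullet> b)\<^sup>2 / 2)) = exp (\<Sum>b\<in>Basis. - (x \<bullet> b)\<^sup>2 / 2)"
      by (simp add: exp_sum)
    also have "(\<Sum>b\<in>Basis. - (x \<bullet> b)\<^sup>2 / 2) = - (x \<bullet> x) / 2"
      by (simp add: euclidean_inner[of x x] power2_eq_square sum_negf sum_divide_distrib)
    finally show ?thesis by simp
  qed
  have "(\<integral>\<^sup>+x. ennreal (exp (- (x \<bullet> x) / 2)) \<partial>(lborel :: (real^'k) measure))
      = (\<integral>\<^sup>+x. (\<Prod>b\<in>Basis. ennreal (exp (- (x \<bullet> b)\<^sup>2 / 2))) \<partial>(lborel :: (real^'k) measure))"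
    unfolding e by (simp add: prod_ennreal)
  also have "\<dots> = (\<Prod>b\<in>(Basis :: (real^'k) set). (\<integral>\<^sup>+x. ennreal (exp (- x\<^sup>2 / 2)) \<partial>lborel))"
    by (rule nn_integral_lborel_prod) auto
  also have "\<dots> = ennreal (sqrt (2 * pi) ^ CARD('k))"
    unfolding 1 by (simp add: ennreal_power)
  also have "sqrt (2 * pi) ^ CARD('k) = (2 * pi) powr (real CARD('k) / 2)"
    by (simp add: powr_half_sqrt[symmetric] powr_realpow[symmetric] powr_powr)
  finally show ?thesis .
qed

lemma nn_integral_gaussian_subspace:
  fixes P :: "real^'d^'d" and T :: "(real^'d) set"
  assumes P: "sym_pos_def P" and T: "subspace T" "dim T = CARD('k::finite)"
  shows "(\<integral>\<^sup>+p. ennreal (exp (- (p \<bullet> (P *v p)) / 2)) \<partial>subspace_measure (k :: 'k itself) P T)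
    = ennreal ((2 * pi) powr (real CARD('k) / 2))"
proof -
  obtain L :: "real^'k \<Rightarrow> real^'d" where L: "linear L" "range L = T" "\<And>x y. L x \<bullet> (P *v L y) = x \<bullet> y"
    using isometry_exists[OF P T] by auto
  define B where "B = matrix L"
  have LB: "L = (*v) B" using L(1) by (auto simp: B_def matrix_works)
  have B1: "transpose B ** P ** B = mat 1" using L(3) by (intro isometry_matrix) (simp add: LB)
  have inj: "inj ((*v) B)"
    using L(3) unfolding linear_injective_0[OF matrix_vector_mul_linear]
    by (metis LB inner_eq_zero_iff inner_zero_left)
  have "(\<integral>\<^sup>+p. ennreal (exp (- (p \<bullet> (P *v p)) / 2)) \<partial>subspace_measure (k :: 'k itself) P T)
      = (\<integral>\<^sup>+v. ennreal (exp (- ((B *v v) \<bullet> (P *v (B *v v))) / 2)) * ennreal (sqrt (det (transpose B ** P ** B))) \<partial>lborel)"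
    using L(2) unfolding LB
    by (intro nn_integral_subspace_measure[OF P inj])
       (auto intro!: measurable_restrict_space1 borel_measurable_continuous_onI continuous_intros
          bounded_linear.continuous_on[OF matrix_vector_mul_bounded_linear])
  also have "\<dots> = (\<integral>\<^sup>+v. ennreal (exp (- (v \<bullet> v) / 2)) \<partial>(lborel :: (real^'k) measure))"
    using L(3) by (simp add: B1 LB)
  also have "\<dots> = ennreal ((2 * pi) powr (real CARD('k) / 2))" by (rule nn_integral_gaussian)
  finally show ?thesis .
qed

declare transpose_matrix_vector [simp del]

section \<open>Calculus of functions of class \<open>C\<^sup>n\<close>\<close>

lemma Ck_on_cong:
  assumes "open S" "\<And>x. x \<in> S \<Longrightarrow> f x = g x" "Ck_on n S f"
  shows "Ck_on n S g"
  using assms(2,3)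
proof (induction n arbitrary: f g)
  case 0
  then show ?case by (simp cong: continuous_on_cong)
next
  case (Suc n)
  have d: "f differentiable (at x)" if "x \<in> S" for x using Suc.prems(2) that by simp
  have g: "g differentiable (at x)" if "x \<in> S" for x
    using d[OF that] has_derivative_transform_within_open[OF _ assms(1) that] Suc.prems(1)
    unfolding differentiable_def by blast
  have e: "frechet_derivative f (at x) v = frechet_derivative g (at x) v" if "x \<in> S" for x v
    using frechet_derivative_transform_within_open[OF d[OF that] assms(1) that Suc.prems(1)] by simp
  show ?case
    using g Suc.prems(2) by (auto intro!: Suc.IH[OF e])
qed

text \<open>
  Lets the derivative be given by any explicit formula that is valid on \<open>S\<close>, so that the induction on the
  class can work with the formulas of the derivative calculus.
\<close>

lemma Ck_on_SucI:
  assumes "open S" "\<And>x. x \<in> S \<Longrightarrow> (f has_derivative f' x) (at x)"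
    and "\<And>v. Ck_on n S (\<lambda>x. f' x v)"
  shows "Ck_on (Suc n) S f"
proof -
  have "f differentiable (at x)" if "x \<in> S" for x
    using assms(2)[OF that] by (auto simp: differentiable_def)
  moreover have "Ck_on n S (\<lambda>x. frechet_derivative f (at x) v)" for v
    by (rule Ck_on_cong[OF assms(1) _ assms(3)[of v]]) (simp add: frechet_derivative_at[OF assms(2), symmetric])
  ultimately show ?thesis by simp
qed

lemma Ck_on_SucD:
  assumes "Ck_on (Suc n) S f" "x \<in> S"
  shows "(f has_derivative frechet_derivative f (at x)) (at x)"
  using assms frechet_derivative_works by auto

lemma smooth_on_has_derivative:
  "smooth_on S f \<Longrightarrow> x \<in> S \<Longrightarrow> (f has_derivative frechet_derivative f (at x)) (at x)"
  unfolding smooth_on_def by (rule Ck_on_SucD) auto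

lemma Ck_on_subset: "Ck_on n T f \<Longrightarrow> S \<subseteq> T \<Longrightarrow> Ck_on n S f"
  by (induction n arbitrary: f) (auto intro: continuous_on_subset)

lemma Ck_on_Suc_imp: "Ck_on (Suc n) S f \<Longrightarrow> Ck_on n S f"
proof (induction n arbitrary: f)
  case 0
  then show ?case
    by (auto intro!: continuous_at_imp_continuous_on differentiable_imp_continuous_within)
next
  case (Suc n)
  have "Ck_on n S (\<lambda>x. frechet_derivative f (at x) v)" for v
    using Suc.prems by (intro Suc.IH) (simp only: Ck_on.simps(2)[of "Suc n"])
  with Suc.prems show ?case by simp
qed

lemma Ck_on_imp_continuous_on: "Ck_on n S f \<Longrightarrow> continuous_on S f"
  by (induction n) (use Ck_on_Suc_imp in auto)

lemma Ck_on_const: "open S \<Longrightarrow> Ck_on n S (\<lambda>_. c)"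
proof (induction n arbitrary: c)
  case (Suc n)
  then show ?case by (intro Ck_on_SucI[where f'="\<lambda>_ _. 0"]) auto
qed simp

lemma Ck_on_bounded_linear:
  assumes "bounded_linear L" "open S" shows "Ck_on n S L"
proof (cases n)
  case 0
  then show ?thesis using assms by (simp add: linear_continuous_on)
next
  case (Suc n)
  have "Ck_on (Suc n) S L"
    using assms by (intro Ck_on_SucI[where f'="\<lambda>_. L"] bounded_linear_imp_has_derivative Ck_on_const)
  with Suc show ?thesis by simp
qed

lemma Ck_on_bounded_linear_comp:
  assumes "bounded_linear L" "open S" "Ck_on n S f" shows "Ck_on n S (\<lambda>x. L (f x))"
  using assms(3)
proof (induction n arbitrary: f)
  case 0
  then show ?case using assms by (simp add: bounded_linear.continuous_on)
next
  case (Suc n)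
  show ?case
    using Suc.prems
    by (intro Ck_on_SucI[where f'="\<lambda>x v. L (frechet_derivative f (at x) v)"] assms(2) Suc.IH
          bounded_linear.has_derivative[OF assms(1)] Ck_on_SucD[OF Suc.prems]) auto
qed

lemma Ck_on_add:
  assumes "open S" "Ck_on n S f" "Ck_on n S g" shows "Ck_on n S (\<lambda>x. f x + g x)"
  using assms(2,3)
proof (induction n arbitrary: f g)
  case 0
  then show ?case by (simp add: continuous_on_add)
next
  case (Suc n)
  show ?case
    using Suc.prems
    by (intro Ck_on_SucI[where f'="\<lambda>x v. frechet_derivative f (at x) v + frechet_derivative g (at x) v"]
          assms(1) Suc.IH has_derivative_add Ck_on_SucD[OF Suc.prems(1)] Ck_on_SucD[OF Suc.prems(2)]) auto
qed

lemma Ck_on_bilinear: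
  assumes "bounded_bilinear B" "open S" "Ck_on n S f" "Ck_on n S g" shows "Ck_on n S (\<lambda>x. B (f x) (g x))"
  using assms(3,4)
proof (induction n arbitrary: f g)
  case 0
  then show ?case using assms by (simp add: bounded_bilinear.continuous_on)
next
  case (Suc n)
  have "Ck_on n S (\<lambda>x. B (f x) (frechet_derivative g (at x) v) + B (frechet_derivative f (at x) v) (g x))" for v
    using Suc.prems Ck_on_Suc_imp[OF Suc.prems(1)] Ck_on_Suc_imp[OF Suc.prems(2)]
    by (intro Ck_on_add assms(2) Suc.IH) auto
  then show ?case
    using bounded_bilinear.FDERIV[OF assms(1) Ck_on_SucD[OF Suc.prems(1)] Ck_on_SucD[OF Suc.prems(2)]]
    by (intro Ck_on_SucI[where f'="\<lambda>x v. B (f x) (frechet_derivative g (at x) v) + B (frechet_derivative f (at x) v) (g x)"] assms(2))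
qed

lemmas Ck_on_mult = Ck_on_bilinear[OF bounded_bilinear_mult]
  and Ck_on_scaleR = Ck_on_bilinear[OF bounded_bilinear_scaleR]

lemma Ck_on_inverse:
  fixes f :: "'a::real_normed_vector \<Rightarrow> real"
  assumes "open S" "\<And>x. x \<in> S \<Longrightarrow> f x \<noteq> 0" "Ck_on n S f" shows "Ck_on n S (\<lambda>x. inverse (f x))"
  using assms(3)
proof (induction n)
  case 0
  then show ?case using assms by (auto intro!: continuous_on_inverse)
next
  case (Suc n)
  have "Ck_on n S (\<lambda>x. - 1 * (inverse (f x) * frechet_derivative f (at x) v * inverse (f x)))" for v
    using Suc.prems Ck_on_Suc_imp[OF Suc.prems]
    by (intro Ck_on_mult Ck_on_const assms(1) Suc.IH) auto
  then show ?case
    using Ck_on_SucD[OF Suc.prems] assms(2)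
    by (intro Ck_on_SucI[where f'="\<lambda>x v. - (inverse (f x) * frechet_derivative f (at x) v * inverse (f x))"] assms(1))
       (auto intro!: has_derivative_inverse)
qed

lemma Ck_on_sum:
  assumes "open S" "\<And>i. i \<in> I \<Longrightarrow> Ck_on n S (f i)"
  shows "Ck_on n S (\<lambda>x. \<Sum>i\<in>I. f i x)"
  using assms(2) by (induction I rule: infinite_finite_induct) (auto intro!: Ck_on_const Ck_on_add assms(1))

lemma Ck_on_prod:
  fixes f :: "'i \<Rightarrow> 'a::real_normed_vector \<Rightarrow> real"
  assumes "open S" "\<And>i. i \<in> I \<Longrightarrow> Ck_on n S (f i)"
  shows "Ck_on n S (\<lambda>x. \<Prod>i\<in>I. f i x)"
  using assms(2) by (induction I rule: infinite_finite_induct) (auto intro!: Ck_on_const Ck_on_mult assms(1))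

lemma Ck_on_det:
  fixes A :: "'a::real_normed_vector \<Rightarrow> real^'n^'n"
  assumes "open S" "\<And>i j. Ck_on n S (\<lambda>x. A x $ i $ j)"
  shows "Ck_on n S (\<lambda>x. det (A x))"
  unfolding det_def by (intro Ck_on_sum Ck_on_mult Ck_on_const Ck_on_prod assms)

lemma Ck_on_vec:
  fixes f :: "'a::real_normed_vector \<Rightarrow> real^'n"
  assumes "open S" "\<And>i. Ck_on n S (\<lambda>x. f x $ i)"
  shows "Ck_on n S f"
proof -
  have e: "f = (\<lambda>x. \<Sum>i\<in>UNIV. f x $ i *\<^sub>R axis i 1)"
    by (simp add: fun_eq_iff vec_eq_iff axis_def if_distrib cong: if_cong)
  show ?thesis
    by (subst e) (intro Ck_on_sum Ck_on_scaleR Ck_on_const assms)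
qed

lemma linear_vec_expand:
  assumes "linear (D :: real^'n \<Rightarrow> 'b::real_vector)"
  shows "D v = (\<Sum>i\<in>UNIV. (v $ i) *\<^sub>R D (axis i 1))"
proof -
  have "v = (\<Sum>i\<in>UNIV. (v $ i) *\<^sub>R axis i 1)"
    by (simp add: vec_eq_iff axis_def if_distrib cong: if_cong)
  then have "D v = D (\<Sum>i\<in>UNIV. (v $ i) *\<^sub>R axis i 1)" by simp
  also have "\<dots> = (\<Sum>i\<in>UNIV. (v $ i) *\<^sub>R D (axis i 1))"
    using assms by (simp add: linear_sum linear_scale)
  finally show ?thesis .
qed

text \<open>
  The chain rule, with the derivative of \<open>f\<close> expanded in the coordinates of its argument: the partial
  derivatives of \<open>f\<close>, composed with \<open>g\<close>, are of the form that the induction hypothesis covers.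
\<close>

lemma Ck_on_compose:
  fixes f :: "real^'n \<Rightarrow> 'b::real_normed_vector" and g :: "'a::real_normed_vector \<Rightarrow> real^'n"
  assumes S: "open S" and gS: "g ` S \<subseteq> T" and g: "Ck_on n S g" and f: "Ck_on n T f"
  shows "Ck_on n S (\<lambda>x. f (g x))"
  using f g
proof (induction n arbitrary: f)
  case 0
  then show ?case using gS by (auto intro: continuous_on_compose2)
next
  case (Suc n)
  let ?f' = "\<lambda>x v. \<Sum>i\<in>UNIV. (frechet_derivative g (at x) v $ i) *\<^sub>R frechet_derivative f (at (g x)) (axis i 1)"
  have "Ck_on n S (\<lambda>x. ?f' x v)" for v
    using Suc.prems Ck_on_Suc_imp[OF Suc.prems(2)]
    by (intro Ck_on_sum Ck_on_scaleR S Suc.IH Ck_on_bounded_linear_comp[OF bounded_linear_vec_nth]) auto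
  moreover have "((\<lambda>x. f (g x)) has_derivative ?f' x) (at x)" if "x \<in> S" for x
  proof -
    have gx: "g x \<in> T" using that gS by auto
    note f' = Ck_on_SucD[OF Suc.prems(1) gx]
    have d: "((\<lambda>x. f (g x)) has_derivative (\<lambda>v. frechet_derivative f (at (g x)) (frechet_derivative g (at x) v))) (at x)"
      using diff_chain_at[OF Ck_on_SucD[OF Suc.prems(2) that] f'] by (simp add: o_def)
    have e: "(\<lambda>v. frechet_derivative f (at (g x)) (frechet_derivative g (at x) v)) = ?f' x"
      by (intro ext linear_vec_expand has_derivative_linear[OF f'])
    show ?thesis using d unfolding e .
  qed
  ultimately show ?case by (intro Ck_on_SucI[OF S])
qed

section \<open>The smooth inverse function theorem\<close>

lemma cramer_inverse:
  fixes A :: "real^'n^'n"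
  assumes "det A \<noteq> 0" "A *v x = b"
  shows "x = (\<chi> k. det (\<chi> i j. if j = k then b $ i else A $ i $ j) / det A)"
  using cramer[OF assms(1)] assms(2) by blast

text \<open>
  The derivative of the inverse \<open>g\<close> at \<open>y\<close> solves a linear system whose coefficients are derivatives of
  \<open>f\<close> at \<open>g y\<close>.  By Cramer's rule the solution is a fixed smooth function evaluated at \<open>g y\<close>.  So if \<open>g\<close> is
  of class \<open>C\<^sup>n\<close>, its derivative is too, and \<open>g\<close> is of class \<open>C\<^sup>n\<^sup>+\<^sup>1\<close>.
\<close>

lemma smooth_inverse:
  fixes f g :: "real^'n \<Rightarrow> real^'n"
  assumes U: "open U" and V: "open V" and f: "smooth_on U f" and gV: "g ` V \<subseteq> U"
    and der: "\<And>y. y \<in> V \<Longrightarrow> (g has_derivative g' y) (at y)"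
    and inv: "\<And>y v. y \<in> V \<Longrightarrow> frechet_derivative f (at (g y)) (g' y v) = v"
  shows "smooth_on V g"
proof -
  let ?A = "\<lambda>x. matrix (frechet_derivative f (at x))"
  let ?h = "\<lambda>v x. (\<chi> k. det (\<chi> i j. if j = k then v $ i else ?A x $ i $ j) / det (?A x))"
  let ?U = "{x \<in> U. det (?A x) \<noteq> 0}"
  have Cf: "Ck_on n U f" for n using f by (simp add: smooth_on_def)
  have A: "Ck_on n U (\<lambda>x. ?A x $ i $ j)" for n i j
    using Ck_on_bounded_linear_comp[OF bounded_linear_vec_nth U, of n "\<lambda>x. frechet_derivative f (at x) (axis j 1)" i] Cf[of "Suc n"]
    by (simp add: matrix_def)
  have lin: "linear (frechet_derivative f (at x))" if "x \<in> U" for x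
    using Ck_on_SucD[OF Cf[of "Suc 0"] that] has_derivative_linear by blast
  have Aw: "?A x *v v = frechet_derivative f (at x) v" if "x \<in> U" for x v
    using lin[OF that] by (simp add: matrix_works)
  have cdet: "continuous_on U (\<lambda>x. det (?A x))"
    using Ck_on_imp_continuous_on[OF Ck_on_det[OF U A]] by blast
  have "open ?U"
    using continuous_open_preimage[OF cdet U, of "- {0}"] by (simp add: vimage_def Int_def open_Compl)
  have h: "Ck_on n ?U (?h v)" for n v
  proof (rule Ck_on_vec[OF \<open>open ?U\<close>])
    fix k
    have A': "Ck_on n ?U (\<lambda>x. ?A x $ i $ j)" for i j by (rule Ck_on_subset[OF A]) auto
    have 1: "Ck_on n ?U (\<lambda>x. det (\<chi> i j. if j = k then v $ i else ?A x $ i $ j))"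
    proof (rule Ck_on_det[OF \<open>open ?U\<close>])
      fix i j
      show "Ck_on n ?U (\<lambda>x. (\<chi> i j. if j = k then v $ i else ?A x $ i $ j) $ i $ j)"
        using A' Ck_on_const[OF \<open>open ?U\<close>] by (cases "j = k") auto
    qed
    have 2: "Ck_on n ?U (\<lambda>x. inverse (det (?A x)))"
      by (rule Ck_on_inverse[OF \<open>open ?U\<close> _ Ck_on_det[OF \<open>open ?U\<close> A']]) auto
    show "Ck_on n ?U (\<lambda>x. ?h v x $ k)"
      using Ck_on_mult[OF \<open>open ?U\<close> 1 2] by (simp add: divide_inverse)
  qed
  have gU: "g ` V \<subseteq> ?U"
  proof safe
    fix y assume y: "y \<in> V"
    then show gy: "g y \<in> U" using gV by auto
    assume 0: "det (?A (g y)) = 0"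
    have "surj ((*v) (?A (g y)))" by (metis Aw gy inv y surjI)
    then have "invertible (?A (g y))"
      by (simp add: invertible_right_inverse matrix_right_invertible_surjective)
    with 0 show False by (simp add: invertible_det_nz)
  qed
  have g': "g' y v = ?h v (g y)" if "y \<in> V" for y v
    using gU that by (intro cramer_inverse) (auto simp: Aw inv)
  have "Ck_on n V g" for n
  proof (induction n)
    case 0
    then show ?case using der by (auto intro!: continuous_at_imp_continuous_on intro: has_derivative_continuous)
  next
    case (Suc n)
    have "Ck_on n V (\<lambda>y. g' y v)" for v
      by (rule Ck_on_cong[OF V _ Ck_on_compose[OF V gU Suc.IH h]]) (simp add: g')
    then show ?case using der by (intro Ck_on_SucI[OF V])
  qed
  then show ?thesis by (simp add: smooth_on_def)
qed

lemma smooth_inverse_function: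
  fixes f :: "real^'n \<Rightarrow> real^'n"
  assumes f: "smooth_on UNIV f" and inj: "inj (frechet_derivative f (at x0))"
  obtains U V g where "open U" "x0 \<in> U" "open V" "homeomorphism U V f g" "smooth_on V g"
proof -
  let ?f' = "\<lambda>x. Blinfun (frechet_derivative f (at x))"
  have Cf: "Ck_on n UNIV f" for n using f by (simp add: smooth_on_def)
  have der: "(f has_derivative frechet_derivative f (at x)) (at x)" for x
    using Ck_on_SucD[OF Cf[of "Suc 0"]] by simp
  then have ap: "blinfun_apply (?f' x) = frechet_derivative f (at x)" for x
    by (intro bounded_linear_Blinfun_apply) (auto dest: has_derivative_bounded_linear)
  have "continuous_on UNIV ?f'"
    using Ck_on_imp_continuous_on Cf[of "Suc 0"]
    by (intro continuous_on_blinfun_componentwise) (auto simp: ap)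
  moreover obtain h where h: "linear h" "h \<circ> frechet_derivative f (at x0) = id"
    using linear_injective_left_inverse[OF _ inj] der has_derivative_linear by blast
  moreover have "Blinfun h o\<^sub>L ?f' x0 = id_blinfun"
    using h by (auto intro!: blinfun_eqI simp: ap bounded_linear_Blinfun_apply linear_conv_bounded_linear fun_eq_iff)
  ultimately obtain U V g g' where *: "open U" "x0 \<in> U" "open V" "homeomorphism U V f g"
    "\<And>y. y \<in> V \<Longrightarrow> (g has_derivative g' y) (at y)"
    "\<And>y. y \<in> V \<Longrightarrow> g' y = inv (blinfun_apply (?f' (g y)))"
    "\<And>y. y \<in> V \<Longrightarrow> bij (blinfun_apply (?f' (g y)))"
    using inverse_function_theorem[of UNIV f ?f' x0 "Blinfun h"] der ap
    by (metis UNIV_I open_UNIV)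
  have "smooth_on V g"
    by (rule smooth_inverse[OF open_UNIV *(3) f _ *(5)])
       (use *(6,7) in \<open>auto simp: ap bij_is_surj surj_f_inv_f\<close>)
  with * show ?thesis using that by blast
qed

section \<open>Local parametrizations of the level set\<close>

lemma grad_mat_derivative:
  assumes "f differentiable (at q)"
  shows "frechet_derivative f (at q) v = transpose (grad_mat f q) *v v"
proof -
  have d: "(f has_derivative frechet_derivative f (at q)) (at q)"
    using assms unfolding frechet_derivative_works .
  have c: "frechet_derivative (\<lambda>x. f x $ j) (at q) = (\<lambda>v. frechet_derivative f (at q) v $ j)" for j
    using bounded_linear.has_derivative[OF bounded_linear_vec_nth d, of j]
    by (rule frechet_derivative_at[symmetric])
  have "transpose (grad_mat f q) = matrix (frechet_derivative f (at q))"
    by (simp add: grad_mat_def transpose_def matrix_def grad_def c vec_eq_iff)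
  then show ?thesis using has_derivative_linear[OF d] by (simp add: matrix_works)
qed

lemma dim_kernel_surj:
  fixes C :: "real^'d^'m"
  assumes "surj ((*v) C)"
  shows "dim {v. C *v v = 0} = CARD('d) - CARD('m)"
proof -
  let ?R = "range ((*v) (transpose C))"
  have inj: "inj ((*v) (transpose C))"
    using assms by (metis matrix_left_invertible_injective matrix_right_invertible_surjective
        matrix_transpose_mul transpose_mat)
  have "dim ?R = CARD('m)"
    using dim_image_eq[of "(*v) (transpose C)" "UNIV :: (real^'m) set"] inj by simp
  moreover have "{v. C *v v = 0} = {y \<in> UNIV. \<forall>x\<in>?R. orthogonal x y}"
  proof -
    have "(\<forall>z. (transpose C *v z) \<bullet> y = 0) \<longleftrightarrow> C *v y = 0" for y
      unfolding inner_transpose by (metis inner_eq_zero_iff inner_zero_right)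
    then show ?thesis by (auto simp: orthogonal_def)
  qed
  moreover have "subspace ?R" by (intro linear_subspace_image) auto
  ultimately show ?thesis
    using dim_subspace_orthogonal_to_vectors[of ?R UNIV] by simp
qed

text \<open>
  Let the columns of \<open>A\<close> be an orthonormal basis of the tangent space at \<open>q0\<close> and those of \<open>?N\<close> the
  normal gradients there.  The map \<open>F q = A (A\<^sup>T q) + ?N (\<xi> q)\<close> straightens the level set: its derivative at
  \<open>q0\<close> is injective because the two summands have orthogonal ranges and kernels that meet only in zero, and \<open>\<xi>\<close> vanishes exactly where
  \<open>F\<close> takes values in the range of \<open>A\<close>.  The local inverse of \<open>F\<close> along that range is the parametrization,
  and the linear map \<open>A\<^sup>T\<close> is its inverse.
\<close>

lemma submfd_local_parametrization:
  fixes \<xi> :: "real^'d \<Rightarrow> real^'m"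
  assumes dims: "CARD('k::finite) = CARD('d) - CARD('m)"
    and \<xi>: "smooth_on UNIV \<xi>" and q0: "q0 \<in> submfd \<xi>"
    and surj: "surj ((*v) (transpose (grad_mat \<xi> q0)))"
  shows "\<exists>U (\<phi> :: real^'k \<Rightarrow> real^'d). local_parametrization (submfd \<xi>) U \<phi> \<and> q0 \<in> \<phi> ` U"
proof -
  let ?N = "grad_mat \<xi> q0"
  let ?T = "{v. transpose ?N *v v = 0}"
  have C\<xi>: "Ck_on n UNIV \<xi>" for n using \<xi> by (simp add: smooth_on_def)
  have d\<xi>: "(\<xi> has_derivative frechet_derivative \<xi> (at q)) (at q)" for q
    using Ck_on_SucD[OF C\<xi>[of "Suc 0"]] by simp
  have "subspace ?T" by (auto simp: subspace_def matrix_vector_right_distrib matrix_vector_mult_scaleR)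
  then obtain L :: "real^'k \<Rightarrow> real^'d" where L: "linear L" "range L = ?T" "\<And>x y. L x \<bullet> (mat 1 *v L y) = x \<bullet> y"
    using isometry_exists[of "mat 1" ?T, where 'k='k] dim_kernel_surj[OF surj] dims
    by (auto simp: sym_pos_def_def transpose_mat)
  define A where "A = matrix L"
  have LA: "L x = A *v x" for x unfolding A_def by (simp add: matrix_works L(1))
  have AA: "transpose A *v (A *v x) = x" for x
    using isometry_matrix[of A "mat 1"] L(3) by (simp add: LA matrix_vector_mul_assoc)
  have NA: "transpose ?N *v (A *v x) = 0" for x using L(2) by (auto simp: LA)
  have AN: "transpose A *v (?N *v y) = 0" for y
    by (rule transpose_annihilates[OF NA])
  have injN: "?N *v y = 0 \<Longrightarrow> y = 0" for y
  proof -
    assume *: "?N *v y = 0"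
    obtain z where z: "y = transpose ?N *v z" using surj by (metis surjD)
    have "y \<bullet> y = z \<bullet> (?N *v y)" by (subst z) (rule inner_transpose)
    with * show "y = 0" by simp
  qed
  define F where "F q = A *v (transpose A *v q) + ?N *v \<xi> q" for q
  have smF: "smooth_on UNIV F"
    unfolding smooth_on_def F_def
    by (intro allI Ck_on_add open_UNIV Ck_on_bounded_linear_comp[OF matrix_vector_mul_bounded_linear]
         Ck_on_bounded_linear[OF matrix_vector_mul_bounded_linear] C\<xi>)
  have dF: "(F has_derivative (\<lambda>v. A *v (transpose A *v v) + ?N *v (transpose ?N *v v))) (at q0)"
  proof -
    have "frechet_derivative \<xi> (at q0) = (\<lambda>v. transpose ?N *v v)"
      by (intro ext grad_mat_derivative) (use d\<xi> in \<open>auto simp: differentiable_def\<close>)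
    with d\<xi>[of q0] have "(\<xi> has_derivative ((*v) (transpose ?N))) (at q0)" by (simp only:)
    then show ?thesis unfolding F_def
      by (intro has_derivative_add bounded_linear.has_derivative[OF matrix_vector_mul_bounded_linear] has_derivative_ident)
  qed
  have injF: "inj (frechet_derivative F (at q0))"
    unfolding frechet_derivative_at[OF dF, symmetric]
  proof (subst linear_injective_0)
    show "linear (\<lambda>v. A *v (transpose A *v v) + ?N *v (transpose ?N *v v))"
      using dF has_derivative_linear by blast
    show "\<forall>h. A *v (transpose A *v h) + ?N *v (transpose ?N *v h) = 0 \<longrightarrow> h = 0"
    proof (intro allI impI)
      fix h assume h: "A *v (transpose A *v h) + ?N *v (transpose ?N *v h) = 0"
      have "transpose A *v (A *v (transpose A *v h) + ?N *v (transpose ?N *v h)) = transpose A *v h"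
        by (simp only: matrix_vector_right_distrib AA AN add_0_right)
      with h have Ah: "transpose A *v h = 0" by (simp only: matrix_vector_mult_0_right)
      with h have "?N *v (transpose ?N *v h) = 0" by (simp only: matrix_vector_mult_0_right add_0_left)
      then have "transpose ?N *v h = 0" by (rule injN)
      then obtain x where "h = A *v x" using L(2) LA by (metis (mono_tags) imageE mem_Collect_eq)
      with Ah AA show "h = 0" by (metis matrix_vector_mult_0_right)
    qed
  qed
  obtain U' V' G where G: "open U'" "q0 \<in> U'" "open V'" "homeomorphism U' V' F G" "smooth_on V' G"
    using smooth_inverse_function[OF smF injF] .
  define U where "U = {x. A *v x \<in> V'}"
  define \<phi> where "\<phi> x = G (A *v x)" for x
  have "open U" unfolding U_def
    by (rule open_vimage[unfolded vimage_def, OF G(3)]) (intro bounded_linear.continuous_on[OF matrix_vector_mul_bounded_linear] continuous_on_id)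
  have F\<phi>: "F (\<phi> x) = A *v x" "\<phi> x \<in> U'" if "x \<in> U" for x
    using that G(4) by (auto simp: U_def \<phi>_def homeomorphism_def)
  have inv: "transpose A *v \<phi> x = x" if "x \<in> U" for x
  proof -
    have "transpose A *v F (\<phi> x) = transpose A *v \<phi> x"
      by (simp only: F_def matrix_vector_right_distrib AA AN add_0_right)
    then show ?thesis using F\<phi>[OF that] AA by simp
  qed
  have \<phi>S: "\<phi> x \<in> submfd \<xi>" if "x \<in> U" for x
  proof -
    have "?N *v \<xi> (\<phi> x) = 0" using F\<phi>(1)[OF that] inv[OF that] by (simp add: F_def)
    then show ?thesis using injN by (simp add: submfd_def)
  qed
  have conv: "transpose A *v q \<in> U \<and> \<phi> (transpose A *v q) = q" if "q \<in> submfd \<xi> \<inter> U'" for q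
  proof -
    have "F q = A *v (transpose A *v q)" using that by (simp add: F_def submfd_def)
    moreover have "F q \<in> V'" "G (F q) = q" using that G(4) by (auto simp: homeomorphism_def)
    ultimately show ?thesis by (simp add: U_def \<phi>_def)
  qed
  have im: "\<phi> ` U = submfd \<xi> \<inter> U'"
    using conv F\<phi> \<phi>S by (auto intro!: rev_image_eqI)
  have sm: "smooth_on U \<phi>" unfolding smooth_on_def \<phi>_def
    using G(5) by (intro allI Ck_on_compose[OF \<open>open U\<close> _ Ck_on_bounded_linear[OF matrix_vector_mul_bounded_linear \<open>open U\<close>], where T=V'])
       (auto simp: U_def smooth_on_def)
  have d\<phi>: "(\<phi> has_derivative frechet_derivative \<phi> (at x)) (at x)" if "x \<in> U" for x
    by (rule smooth_on_has_derivative[OF sm that])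
  have inj: "inj (frechet_derivative \<phi> (at x))" if "x \<in> U" for x
  proof -
    have "((\<lambda>x. transpose A *v \<phi> x) has_derivative (\<lambda>v. transpose A *v frechet_derivative \<phi> (at x) v)) (at x)"
      by (intro bounded_linear.has_derivative[OF matrix_vector_mul_bounded_linear] d\<phi> that)
    then have "((\<lambda>x. x) has_derivative (\<lambda>v. transpose A *v frechet_derivative \<phi> (at x) v)) (at x)"
      by (rule has_derivative_transform_within_open[OF _ \<open>open U\<close> that inv])
    then have "(\<lambda>v. transpose A *v frechet_derivative \<phi> (at x) v) = (\<lambda>v. v)"
      using has_derivative_unique has_derivative_ident by blast
    then show ?thesis by (metis injI)
  qed
  have "homeomorphism U (\<phi> ` U) \<phi> (\<lambda>q. transpose A *v q)"
    unfolding homeomorphism_def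
    using sm inv by (auto simp: smooth_on_def image_image intro!: Ck_on_imp_continuous_on[of 0]
       bounded_linear.continuous_on[OF matrix_vector_mul_bounded_linear])
  moreover have "openin (top_of_set (submfd \<xi>)) (\<phi> ` U)"
    unfolding im using G(1) by (simp add: openin_open_Int)
  ultimately have "local_parametrization (submfd \<xi>) U \<phi>"
    unfolding local_parametrization_def using \<open>open U\<close> sm inj by auto
  moreover have "q0 \<in> \<phi> ` U" using G(2) q0 im by auto
  ultimately show ?thesis by blast
qed

text \<open>
  Countably many of the local parametrizations suffice by Lindeloef's theorem.
\<close>

lemma countable_atlas_exists:
  fixes \<xi> :: "real^'d \<Rightarrow> real^'m"
  assumes dims: "CARD('k::finite) = CARD('d) - CARD('m)"
    and \<xi>: "smooth_on UNIV \<xi>" and ne: "submfd \<xi> \<noteq> {}"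
    and surj: "\<And>q. q \<in> submfd \<xi> \<Longrightarrow> surj ((*v) (transpose (grad_mat \<xi> q)))"
  shows "\<exists>\<A> :: nat \<Rightarrow> (real^'k) set \<times> (real^'k \<Rightarrow> real^'d). countable_atlas (submfd \<xi>) \<A>"
proof -
  let ?S = "submfd \<xi>"
  define \<F> where "\<F> = (\<lambda>(U, \<phi>). \<phi> ` U) ` {(U, \<phi> :: real^'k \<Rightarrow> real^'d). local_parametrization ?S U \<phi>}"
  have FE: "\<exists>a. local_parametrization ?S (fst a) (snd a :: real^'k \<Rightarrow> real^'d) \<and> X = snd a ` fst a" if "X \<in> \<F>" for X
    using that unfolding \<F>_def by fastforce
  have FI: "\<phi> ` U \<in> \<F>" if "local_parametrization ?S U \<phi>" for U and \<phi> :: "real^'k \<Rightarrow> real^'d"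
    using that unfolding \<F>_def by force
  have op: "openin (top_of_set ?S) X" if "X \<in> \<F>" for X
    using FE[OF that] unfolding local_parametrization_def by blast
  obtain \<F>' where F': "\<F>' \<subseteq> \<F>" "countable \<F>'" "\<Union>\<F>' = \<Union>\<F>"
    using Lindelof_openin[OF op] by metis
  have cov: "\<Union>\<F> = ?S"
  proof
    show "\<Union>\<F> \<subseteq> ?S" using op openin_imp_subset by (metis Sup_least)
    show "?S \<subseteq> \<Union>\<F>"
    proof
      fix q assume "q \<in> ?S"
      then obtain U and \<phi> :: "real^'k \<Rightarrow> real^'d" where "local_parametrization ?S U \<phi>" "q \<in> \<phi> ` U"
        using submfd_local_parametrization[OF dims \<xi> _ surj] by blast
      with FI show "q \<in> \<Union>\<F>" by blast
    qed
  qed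
  have ne': "\<F>' \<noteq> {}" using F'(3) ne unfolding cov by (metis Union_empty)
  have "\<exists>a. local_parametrization ?S (fst a) (snd a :: real^'k \<Rightarrow> real^'d) \<and> from_nat_into \<F>' n = snd a ` fst a" for n
    using from_nat_into[OF ne', of n] F'(1) FE by blast
  then obtain \<A> :: "nat \<Rightarrow> (real^'k) set \<times> (real^'k \<Rightarrow> real^'d)" where
    A: "\<And>n. local_parametrization ?S (fst (\<A> n)) (snd (\<A> n))" "\<And>n. from_nat_into \<F>' n = snd (\<A> n) ` fst (\<A> n)"
    by metis
  have "\<Union>(range (from_nat_into \<F>')) = ?S"
    unfolding range_from_nat_into[OF ne' F'(2)] by (simp only: F'(3) cov)
  then have "?S = (\<Union>n. snd (\<A> n) ` fst (\<A> n))" by (simp only: A(2)[symmetric])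
  with A(1) show ?thesis unfolding countable_atlas_def by blast
qed

section \<open>Borel measurability of matrix operations\<close>

lemma borel_measurable_vec_lambda:
  fixes f :: "'a \<Rightarrow> 'b::euclidean_space^'n"
  assumes "\<And>i. (\<lambda>x. f x $ i) \<in> borel_measurable N"
  shows "f \<in> borel_measurable N"
proof (subst borel_measurable_euclidean_space, rule)
  fix b :: "'b^'n" assume "b \<in> Basis"
  then obtain i u where b: "b = axis i u" by (auto simp: Basis_vec_def)
  show "(\<lambda>x. f x \<bullet> b) \<in> borel_measurable N"
    unfolding b inner_axis by (intro borel_measurable_inner assms borel_measurable_const)
qed

lemma borel_measurable_nth [measurable]:
  fixes f :: "'a \<Rightarrow> 'b::euclidean_space^'n"
  assumes "f \<in> borel_measurable N"
  shows "(\<lambda>x. f x $ i) \<in> borel_measurable N"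
  by (rule measurable_compose[OF assms borel_measurable_continuous_onI[OF linear_continuous_on[OF bounded_linear_vec_nth]]])

lemma borel_measurable_matrix_vector_mult [measurable]:
  fixes A :: "'a \<Rightarrow> real^'n^'k"
  assumes [measurable]: "A \<in> borel_measurable N" "v \<in> borel_measurable N"
  shows "(\<lambda>x. A x *v v x) \<in> borel_measurable N"
  by (rule borel_measurable_vec_lambda) (simp add: matrix_vector_mult_def)

lemma borel_measurable_matrix_matrix_mult [measurable]:
  fixes A :: "'a \<Rightarrow> real^'n^'k" and B :: "'a \<Rightarrow> real^'l^'n"
  assumes [measurable]: "A \<in> borel_measurable N" "B \<in> borel_measurable N"
  shows "(\<lambda>x. A x ** B x) \<in> borel_measurable N"
  by (intro borel_measurable_vec_lambda) (simp add: matrix_matrix_mult_def)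

lemma borel_measurable_transpose [measurable]:
  fixes A :: "'a \<Rightarrow> real^'n^'k"
  assumes [measurable]: "A \<in> borel_measurable N"
  shows "(\<lambda>x. transpose (A x)) \<in> borel_measurable N"
  by (intro borel_measurable_vec_lambda) (simp add: transpose_def)

lemma borel_measurable_det [measurable]:
  fixes A :: "'a \<Rightarrow> real^'n^'n"
  assumes [measurable]: "A \<in> borel_measurable N"
  shows "(\<lambda>x. det (A x)) \<in> borel_measurable N"
  unfolding det_def by measurable

text \<open>
  Cramer's formula is a Borel function of matrix and right hand side without any case distinction.  For a
  singular matrix it gives an irrelevant value.
\<close>

definition cramer_solve :: "real^'n^'n \<Rightarrow> real^'n \<Rightarrow> real^'n" where
  "cramer_solve A b = (\<chi> k. det (\<chi> i j. if j = k then b $ i else A $ i $ j) / det A)"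

lemma cramer_solve:
  assumes "det A \<noteq> 0" shows "A *v x = b \<longleftrightarrow> x = cramer_solve A b"
  unfolding cramer_solve_def by (rule cramer[OF assms])

lemma borel_measurable_cramer_solve [measurable]:
  fixes A :: "'a \<Rightarrow> real^'n^'n"
  assumes [measurable]: "A \<in> borel_measurable N" "b \<in> borel_measurable N"
  shows "(\<lambda>x. cramer_solve (A x) (b x)) \<in> borel_measurable N"
proof (rule borel_measurable_vec_lambda)
  fix k
  have "(\<lambda>x. if j = k then b x $ i else A x $ i $ j) \<in> borel_measurable N" for i j
    by (cases "j = k") (simp_all add: borel_measurable_nth assms)
  then have "(\<lambda>x. \<chi> i j. if j = k then b x $ i else A x $ i $ j) \<in> borel_measurable N"
    by (intro borel_measurable_vec_lambda) (simp only: vec_lambda_beta)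
  from borel_measurable_divide[OF borel_measurable_det[OF this] borel_measurable_det[OF assms(1)]]
  show "(\<lambda>x. cramer_solve (A x) (b x) $ k) \<in> borel_measurable N"
    by (simp add: cramer_solve_def)
qed

section \<open>The constrained manifold\<close>

text \<open>
  The parameter \<open>k\<close> only carries the type that indexes the coordinates of the manifold.
\<close>

locale constrained_manifold =
  fixes M :: "real^'d^'d" and \<xi> :: "real^'d \<Rightarrow> real^'m" and k :: "'k::finite itself"
  assumes card_less: "CARD('m) < CARD('d)"
    and card_k: "CARD('k) = CARD('d) - CARD('m)"
    and M: "sym_pos_def M"
    and smooth_constraint: "smooth_on UNIV \<xi>"
    and gram_invertible: "\<And>q. q \<in> submfd \<xi> \<Longrightarrow> invertible (gram M \<xi> q)"
    and nonempty: "submfd \<xi> \<noteq> {}"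
begin

abbreviation "S \<equiv> submfd \<xi>"
abbreviation "Minv \<equiv> matrix_inv M"
abbreviation "N \<equiv> grad_mat \<xi>"

definition atlas :: "nat \<Rightarrow> (real^'k) set \<times> (real^'k \<Rightarrow> real^'d)" where
  "atlas = (SOME \<A>. countable_atlas S \<A>)"

definition "U n = fst (atlas n)"
definition "\<phi> n = snd (atlas n)"

lemma surj_normal:
  assumes "q \<in> S" shows "surj ((*v) (transpose (N q)))"
proof -
  have "transpose (N q) ** (Minv ** N q ** matrix_inv (gram M \<xi> q)) = gram M \<xi> q ** matrix_inv (gram M \<xi> q)"
    by (simp add: gram_def matrix_mul_assoc)
  also have "\<dots> = mat 1" by (rule invertible_matrix_inv[OF gram_invertible[OF assms]])
  finally show ?thesis using matrix_right_invertible_surjective by blast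
qed

lemma atlas: "countable_atlas S atlas"
  unfolding atlas_def
  by (rule someI_ex[of "countable_atlas S"], rule countable_atlas_exists[OF card_k smooth_constraint nonempty surj_normal])

lemma chart: "local_parametrization S (U n) (\<phi> n)"
  and cover: "S = (\<Union>n. \<phi> n ` U n)"
  using atlas unfolding countable_atlas_def U_def \<phi>_def by auto

lemma chart_open: "open (U n)"
  and chart_smooth: "smooth_on (U n) (\<phi> n)"
  and chart_image_open: "openin (top_of_set S) (\<phi> n ` U n)"
  using chart[of n] by (auto simp: local_parametrization_def)

lemma chart_derivative: "x \<in> U n \<Longrightarrow> (\<phi> n has_derivative frechet_derivative (\<phi> n) (at x)) (at x)"
  by (rule smooth_on_has_derivative[OF chart_smooth])

lemma chart_in: "x \<in> U n \<Longrightarrow> \<phi> n x \<in> S"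
  using cover by blast

definition "\<psi> n = (SOME \<psi>. homeomorphism (U n) (\<phi> n ` U n) (\<phi> n) \<psi>)"

lemma chart_homeomorphism: "homeomorphism (U n) (\<phi> n ` U n) (\<phi> n) (\<psi> n)"
  unfolding \<psi>_def using chart[of n] unfolding local_parametrization_def by (intro someI_ex[of "homeomorphism (U n) (\<phi> n ` U n) (\<phi> n)"]) blast

lemma chart_inverse [simp]: "x \<in> U n \<Longrightarrow> \<psi> n (\<phi> n x) = x"
  using chart_homeomorphism[of n] by (auto simp: homeomorphism_def)

lemma chart_continuous: "continuous_on (U n) (\<phi> n)" "continuous_on (\<phi> n ` U n) (\<psi> n)"
  using chart_homeomorphism[of n] by (auto simp: homeomorphism_def)

definition jac :: "nat \<Rightarrow> real^'k \<Rightarrow> real^'k^'d" where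
  "jac n x = matrix (frechet_derivative (\<phi> n) (at x))"

lemma jac: "x \<in> U n \<Longrightarrow> frechet_derivative (\<phi> n) (at x) = (\<lambda>v. jac n x *v v)"
  using has_derivative_linear[OF chart_derivative] by (simp add: jac_def fun_eq_iff matrix_works)

lemma inj_jac: "x \<in> U n \<Longrightarrow> inj ((*v) (jac n x))"
  using chart[of n] unfolding local_parametrization_def by (metis jac)

lemma continuous_on_jac: "continuous_on (U n) (jac n)"
proof -
  have "Ck_on 1 (U n) (\<phi> n)" using chart_smooth by (simp add: smooth_on_def)
  then have "continuous_on (U n) (\<lambda>x. frechet_derivative (\<phi> n) (at x) v)" for v by simp
  then have "continuous_on (U n) (\<lambda>x. \<chi> i j. frechet_derivative (\<phi> n) (at x) (axis j 1) $ i)"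
    by (intro continuous_on_vec_lambda continuous_intros)
  then show ?thesis by (simp add: jac_def[abs_def] matrix_def)
qed

lemma tangent: "x \<in> U n \<Longrightarrow> transpose (N (\<phi> n x)) *v (jac n x *v v) = 0"
proof -
  assume x: "x \<in> U n"
  have d: "(\<xi> has_derivative frechet_derivative \<xi> (at (\<phi> n x))) (at (\<phi> n x))"
    using smooth_on_has_derivative[OF smooth_constraint] by simp
  have "((\<lambda>y. \<xi> (\<phi> n y)) has_derivative (\<lambda>v. frechet_derivative \<xi> (at (\<phi> n x)) (frechet_derivative (\<phi> n) (at x) v))) (at x)"
    using diff_chain_at[OF chart_derivative[OF x] d] by (simp add: o_def)
  moreover have "\<xi> (\<phi> n y) = 0" if "y \<in> U n" for y using chart_in[OF that] by (simp add: submfd_def)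
  ultimately have "((\<lambda>y. 0) has_derivative (\<lambda>v. frechet_derivative \<xi> (at (\<phi> n x)) (frechet_derivative (\<phi> n) (at x) v))) (at x)"
    by (rule has_derivative_transform_within_open[OF _ chart_open x])
  then have "(\<lambda>v. frechet_derivative \<xi> (at (\<phi> n x)) (frechet_derivative (\<phi> n) (at x) v)) = (\<lambda>v. 0)"
    using has_derivative_unique has_derivative_const by blast
  then have "frechet_derivative \<xi> (at (\<phi> n x)) (jac n x *v v) = 0" by (metis jac[OF x])
  moreover have "\<xi> differentiable (at (\<phi> n x))" using d unfolding differentiable_def by blast
  ultimately show ?thesis by (simp only: grad_mat_derivative)
qed

subsection \<open>A Borel frame\<close>

text \<open>
  The measure on the manifold is assembled from disjoint pieces of charts, each point being claimed by the
  first chart that covers it.  The same choice yields a basis of each tangent space, the columns of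
  \<open>frame q\<close>, which depends on \<open>q\<close> in a Borel way over the whole manifold, although no continuous choice need
  exist.  All later densities are expressed in this frame.
\<close>

definition "idx q = (LEAST n. q \<in> \<phi> n ` U n)"
definition "piece n = {x \<in> U n. idx (\<phi> n x) = n}"
definition frame :: "real^'d \<Rightarrow> real^'k^'d" where "frame q = jac (idx q) (\<psi> (idx q) q)"
definition "gramian q = transpose (frame q) ** M ** frame q"
definition "vol q = sqrt (det (gramian q))"

lemma idx: "q \<in> S \<Longrightarrow> q \<in> \<phi> (idx q) ` U (idx q)"
  unfolding idx_def by (rule LeastI_ex) (use cover in auto)

lemma piece_alt: "piece n = {x \<in> U n. \<phi> n x \<notin> (\<Union>j<n. \<phi> j ` U j)}"
proof -
  have "idx (\<phi> n x) = n \<longleftrightarrow> \<phi> n x \<notin> (\<Union>j<n. \<phi> j ` U j)" if "x \<in> U n" for x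
  proof
    assume "idx (\<phi> n x) = n"
    then show "\<phi> n x \<notin> (\<Union>j<n. \<phi> j ` U j)" using not_less_Least unfolding idx_def by fastforce
  next
    assume "\<phi> n x \<notin> (\<Union>j<n. \<phi> j ` U j)"
    then show "idx (\<phi> n x) = n" unfolding idx_def
      by (intro Least_equality) (use that in \<open>auto simp: not_less[symmetric]\<close>)
  qed
  then show ?thesis by (auto simp: piece_def)
qed

lemma frame_eq: "x \<in> piece n \<Longrightarrow> frame (\<phi> n x) = jac n x"
  by (auto simp: piece_def frame_def)

lemma pieceE:
  assumes "q \<in> S"
  obtains x where "x \<in> piece (idx q)" "x \<in> U (idx q)" "\<phi> (idx q) x = q" "frame q = jac (idx q) x"
proof -
  obtain x where x: "x \<in> U (idx q)" "\<phi> (idx q) x = q" using idx[OF assms] by auto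
  then have "x \<in> piece (idx q)" by (simp add: piece_def)
  with x frame_eq that show ?thesis by metis
qed

lemma volume_density_eq: "x \<in> piece n \<Longrightarrow> volume_density M (\<phi> n) x = vol (\<phi> n x)"
  by (simp add: volume_density_def vol_def gramian_def frame_eq jac_def Let_def)

lemma inj_frame: "q \<in> S \<Longrightarrow> inj ((*v) (frame q))"
  by (metis pieceE inj_jac)

lemma det_gramian_pos: "q \<in> S \<Longrightarrow> 0 < det (gramian q)"
  unfolding gramian_def by (rule det_congruence_pos[OF M inj_frame])

lemma vol_pos: "q \<in> S \<Longrightarrow> 0 < vol q"
  by (simp add: vol_def det_gramian_pos)

lemma frame_tangent: "q \<in> S \<Longrightarrow> transpose (N q) *v (frame q *v v) = 0"
  by (metis pieceE tangent)

lemma frame_normal: "q \<in> S \<Longrightarrow> transpose (frame q) *v (N q *v l) = 0"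
  by (rule transpose_annihilates[OF frame_tangent])

lemma S_closed: "closed S"
proof -
  have "continuous_on UNIV \<xi>" using smooth_constraint Ck_on_imp_continuous_on by (auto simp: smooth_on_def)
  then show ?thesis unfolding submfd_def by (intro closed_Collect_eq continuous_on_const)
qed

lemma S_borel [measurable]: "S \<in> sets borel"
  using S_closed by (rule borel_closed)

lemma sets_S: "sets (restrict_space borel S) = {E \<in> sets borel. E \<subseteq> S}"
  by (auto simp: sets_restrict_space_iff)

lemma openin_borel: "openin (top_of_set S) X \<Longrightarrow> X \<in> sets borel"
  by (auto simp: openin_open)

lemma chart_image_borel [measurable]: "\<phi> n ` U n \<in> sets borel"
  by (rule openin_borel[OF chart_image_open])

lemma chart_vimage_borel: "B \<in> sets borel \<Longrightarrow> {x \<in> U n. \<phi> n x \<in> B} \<in> sets borel"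
proof -
  assume B: "B \<in> sets borel"
  have "\<phi> n \<in> borel_measurable (restrict_space borel (U n))"
    by (rule borel_measurable_continuous_on_restrict[OF chart_continuous(1)])
  from measurable_sets[OF this B] chart_open show ?thesis
    by (auto simp: sets_restrict_space_iff space_restrict_space vimage_def Int_def conj_commute)
qed

lemma piece_borel [measurable]: "piece n \<in> sets borel"
proof -
  have "piece n = {x \<in> U n. \<phi> n x \<in> - (\<Union>j<n. \<phi> j ` U j)}" by (auto simp: piece_alt)
  moreover have "- (\<Union>j<n. \<phi> j ` U j) \<in> sets borel" by measurable
  ultimately show ?thesis using chart_vimage_borel[of "- (\<Union>j<n. \<phi> j ` U j)"] by (simp only:)
qed

lemma chart_measurable: "(\<lambda>x. if x \<in> piece n then \<phi> n x else c) \<in> borel_measurable borel"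
  using piece_borel chart_continuous(1)
  by (intro borel_measurable_continuous_on_if continuous_on_const) (auto simp: piece_def intro: continuous_on_subset)

lemma idx_level: "{q \<in> S. idx q = n} = \<phi> n ` U n - (\<Union>j<n. \<phi> j ` U j)"
proof (intro subset_antisym subsetI)
  fix q assume q: "q \<in> {q \<in> S. idx q = n}"
  then have "q \<notin> \<phi> j ` U j" if "j < n" for j
    using that not_less_Least unfolding idx_def by blast
  with q idx[of q] show "q \<in> \<phi> n ` U n - (\<Union>j<n. \<phi> j ` U j)" by auto
next
  fix q assume q: "q \<in> \<phi> n ` U n - (\<Union>j<n. \<phi> j ` U j)"
  then obtain x where x: "x \<in> U n" "q = \<phi> n x" by auto
  with q have "x \<in> piece n" by (auto simp: piece_alt)
  then show "q \<in> {q \<in> S. idx q = n}" using x chart_in by (auto simp: piece_def)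
qed

lemma idx_level_borel [measurable]: "{q \<in> S. idx q = n} \<in> sets borel"
  unfolding idx_level by measurable

lemma measurable_frame [measurable]: "frame \<in> borel_measurable (restrict_space borel S)"
proof (rule measurable_piecewise_restrict[of "range (\<lambda>n. {q \<in> S. idx q = n})"])
  fix \<Omega> assume "\<Omega> \<in> range (\<lambda>n. {q \<in> S. idx q = n})"
  then obtain n where n: "\<Omega> = {q \<in> S. idx q = n}" by auto
  have \<Omega>: "\<Omega> \<in> sets borel" unfolding n by (rule idx_level_borel)
  then show "\<Omega> \<inter> space (restrict_space borel S) \<in> sets (restrict_space borel S)"
    by (auto simp: sets_S space_restrict_space n)
  have sub: "\<Omega> \<subseteq> \<phi> n ` U n" unfolding n idx_level by auto
  have "continuous_on \<Omega> (\<lambda>q. jac n (\<psi> n q))"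
    by (rule continuous_on_compose2[OF continuous_on_jac continuous_on_subset[OF chart_continuous(2) sub]])
       (use sub in auto)
  then have "continuous_on \<Omega> frame"
    by (rule continuous_on_eq) (auto simp: n frame_def)
  then have "frame \<in> borel_measurable (restrict_space borel \<Omega>)"
    by (rule borel_measurable_continuous_on_restrict)
  moreover have "S \<inter> \<Omega> = \<Omega>" using n by auto
  ultimately show "frame \<in> borel_measurable (restrict_space (restrict_space borel S) \<Omega>)"
    using \<Omega> by (subst restrict_restrict_space) auto
qed (auto simp: space_restrict_space)

lemma measurable_gramian [measurable]: "gramian \<in> borel_measurable (restrict_space borel S)"
  unfolding gramian_def[abs_def] by measurable

lemma measurable_vol [measurable]: "vol \<in> borel_measurable (restrict_space borel S)"
  unfolding vol_def[abs_def] by measurable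

subsection \<open>Integration over the manifold\<close>

abbreviation "\<sigma> \<equiv> position_measure k M \<xi>"

lemma nn_integral_parametrized:
  fixes g :: "nat \<times> (real^'k) \<Rightarrow> ennreal"
  assumes "\<And>n. (\<lambda>x. g (n, x)) \<in> borel_measurable borel"
  shows "(\<integral>\<^sup>+z. g z \<partial>(count_space UNIV \<Otimes>\<^sub>M lborel)) = (\<Sum>n. \<integral>\<^sup>+x. g (n, x) \<partial>lborel)"
proof -
  have "g \<in> borel_measurable (count_space UNIV \<Otimes>\<^sub>M lborel)"
    by (rule measurable_pair_measure_countable1) (use assms in auto)
  from lborel.nn_integral_fst[OF this, symmetric] show ?thesis
    by (simp add: nn_integral_count_space_nat)
qed

text \<open>
  The measure on the manifold is the image of a measure on countably many copies of the coordinate space.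
  This shows at once that the defining formula is countably additive, and how to integrate.  The
  value of \<open>param_map\<close> outside the pieces, where the density is zero, only has to lie on the manifold.
\<close>

definition "param_density = (\<lambda>(n, x). ennreal (volume_density M (\<phi> n) x) * indicator (piece n) x)"
definition "param_map = (\<lambda>(n, x). if x \<in> piece n then \<phi> n x else (SOME q. q \<in> S))"

lemma param_map_measurable: "param_map \<in> (count_space UNIV \<Otimes>\<^sub>M lborel) \<rightarrow>\<^sub>M restrict_space borel S"
proof (rule measurable_pair_measure_countable1)
  have "(SOME q. q \<in> S) \<in> S" using nonempty by (simp add: some_in_eq)
  moreover have "(\<lambda>x. param_map (n, x)) \<in> borel_measurable borel" for n
    using chart_measurable[of n] by (simp add: param_map_def)
  ultimately show "(\<lambda>x. param_map (n, x)) \<in> lborel \<rightarrow>\<^sub>M restrict_space borel S" for n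
    by (intro measurable_restrict_space2) (auto simp: param_map_def piece_def chart_in)
qed simp

lemma param_density_eq: "param_density (n, x) = ennreal (vol (param_map (n, x))) * indicator (piece n) x"
  by (auto simp: param_density_def param_map_def volume_density_eq indicator_def)

lemma param_density_measurable: "param_density \<in> borel_measurable (count_space UNIV \<Otimes>\<^sub>M lborel)"
proof (rule measurable_pair_measure_countable1)
  fix n
  have "(\<lambda>x. param_map (n, x)) \<in> lborel \<rightarrow>\<^sub>M restrict_space borel S"
    by (rule measurable_compose[OF _ param_map_measurable]) simp
  from measurable_compose[OF this measurable_vol]
  show "(\<lambda>x. param_density (n, x)) \<in> borel_measurable lborel"
    unfolding param_density_eq by measurable
qed simp

lemma position_measure_eq:
  "\<sigma> = distr (density (count_space UNIV \<Otimes>\<^sub>M lborel) param_density) (restrict_space borel S) param_map"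
  (is "_ = ?\<mu>")
proof -
  have "\<sigma> = measure_of S (sets (restrict_space borel S))
           (\<lambda>E. \<Sum>n. \<integral>\<^sup>+ x \<in> {x \<in> U n. \<phi> n x \<in> E - (\<Union>j<n. \<phi> j ` U j)}.
                       ennreal (volume_density M (\<phi> n) x) \<partial>lborel)"
    by (simp add: position_measure_def riemannian_measure_def Let_def U_def \<phi>_def atlas_def)
  also have "\<dots> = measure_of S (sets (restrict_space borel S)) (emeasure ?\<mu>)"
  proof (rule measure_of_eq)
    show "sets (restrict_space borel S) \<subseteq> Pow S" by (auto simp: sets_S)
    fix E assume "E \<in> sigma_sets S (sets (restrict_space borel S))"
    then have E: "E \<in> sets (restrict_space borel S)"
      using sets.sigma_sets_eq[of "restrict_space borel S"] by (simp add: space_restrict_space)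
    have Em: "(\<lambda>z. indicator E (param_map z) :: ennreal) \<in> borel_measurable (count_space UNIV \<Otimes>\<^sub>M lborel)"
      using E by (intro measurable_compose[OF param_map_measurable]) simp
    have m: "(\<lambda>x. param_density (n, x) * indicator E (param_map (n, x))) \<in> borel_measurable borel" for n
      using measurable_compose[OF _ borel_measurable_times_ennreal[OF param_density_measurable Em], of "\<lambda>x. (n, x)" lborel] by simp
    have "emeasure ?\<mu> E = (\<integral>\<^sup>+z. param_density z * indicator E (param_map z) \<partial>(count_space UNIV \<Otimes>\<^sub>M lborel))"
    proof -
      have "emeasure ?\<mu> E = (\<integral>\<^sup>+q. indicator E q \<partial>?\<mu>)" using E by simp
      also have "\<dots> = (\<integral>\<^sup>+z. param_density z * indicator E (param_map z) \<partial>(count_space UNIV \<Otimes>\<^sub>M lborel))"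
        using E Em param_map_measurable param_density_measurable
        by (subst nn_integral_distr) (auto intro!: nn_integral_density)
      finally show ?thesis .
    qed
    also have "\<dots> = (\<Sum>n. \<integral>\<^sup>+x. param_density (n, x) * indicator E (param_map (n, x)) \<partial>lborel)"
      by (rule nn_integral_parametrized[OF m])
    also have "\<dots> = (\<Sum>n. \<integral>\<^sup>+ x \<in> {x \<in> U n. \<phi> n x \<in> E - (\<Union>j<n. \<phi> j ` U j)}.
                       ennreal (volume_density M (\<phi> n) x) \<partial>lborel)"
      by (intro suminf_cong nn_integral_cong) (auto simp: param_density_def param_map_def piece_alt indicator_def)
    finally show "(\<Sum>n. \<integral>\<^sup>+ x \<in> {x \<in> U n. \<phi> n x \<in> E - (\<Union>j<n. \<phi> j ` U j)}.
                       ennreal (volume_density M (\<phi> n) x) \<partial>lborel) = emeasure ?\<mu> E" ..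
  qed
  also have "\<dots> = ?\<mu>"
    using measure_of_of_measure[of ?\<mu>] by (simp add: space_restrict_space)
  finally show ?thesis .
qed

lemma sets_position [measurable_cong, simp]: "sets \<sigma> = sets (restrict_space borel S)"
  and space_position [simp]: "space \<sigma> = S"
  by (simp_all add: position_measure_eq space_restrict_space)

lemma nn_integral_position:
  assumes f: "f \<in> borel_measurable (restrict_space borel S)"
  shows "(\<integral>\<^sup>+q. f q \<partial>\<sigma>) = (\<Sum>n. \<integral>\<^sup>+x. f (\<phi> n x) * ennreal (vol (\<phi> n x)) * indicator (piece n) x \<partial>lborel)"
proof -
  have fm: "(\<lambda>z. f (param_map z)) \<in> borel_measurable (count_space UNIV \<Otimes>\<^sub>M lborel)"
    by (rule measurable_compose[OF param_map_measurable f])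
  have m: "(\<lambda>x. param_density (n, x) * f (param_map (n, x))) \<in> borel_measurable borel" for n
    using measurable_compose[OF _ borel_measurable_times_ennreal[OF param_density_measurable fm], of "\<lambda>x. (n, x)" lborel] by simp
  have "(\<integral>\<^sup>+q. f q \<partial>\<sigma>) = (\<integral>\<^sup>+z. param_density z * f (param_map z) \<partial>(count_space UNIV \<Otimes>\<^sub>M lborel))"
    unfolding position_measure_eq
    using f fm param_map_measurable param_density_measurable
    by (subst nn_integral_distr) (auto intro!: nn_integral_density)
  also have "\<dots> = (\<Sum>n. \<integral>\<^sup>+x. param_density (n, x) * f (param_map (n, x)) \<partial>lborel)"
    by (rule nn_integral_parametrized[OF m])
  also have "\<dots> = (\<Sum>n. \<integral>\<^sup>+x. f (\<phi> n x) * ennreal (vol (\<phi> n x)) * indicator (piece n) x \<partial>lborel)"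
    by (intro suminf_cong nn_integral_cong)
       (auto simp: param_density_def param_map_def volume_density_eq indicator_def mult.commute)
  finally show ?thesis .
qed

subsection \<open>Integration over the cotangent spaces\<close>

abbreviation "T q \<equiv> cotangent_space M \<xi> q"
abbreviation "\<tau> q \<equiv> momentum_measure k M \<xi> q"

text \<open>
  The mass matrix carries the tangent space isometrically onto the cotangent space.  So the frame also
  coordinatizes the momenta, with the same Gram matrix.
\<close>

definition momentum :: "real^'d \<Rightarrow> real^'k \<Rightarrow> real^'d" where
  "momentum q v = M *v (frame q *v v)"

lemma momentum_matrix: "momentum q v = (M ** frame q) *v v"
  by (simp add: momentum_def matrix_vector_mul_assoc)

lemma inj_momentum: "q \<in> S \<Longrightarrow> inj ((*v) (M ** frame q))"
  using inj_frame[of q] M by (simp add: inj_def matrix_vector_mul_assoc[symmetric]) (metis matrix_inv_mult(4))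

lemma subspace_T: "subspace (T q)"
  by (auto simp: cotangent_space_def subspace_def matrix_vector_right_distrib matrix_vector_mult_scaleR)

lemma dim_T: "q \<in> S \<Longrightarrow> dim (T q) = CARD('k)"
proof -
  assume q: "q \<in> S"
  have "surj ((*v) (transpose (N q) ** Minv))"
    by (metis (no_types) M matrix_inv_mult(4) matrix_vector_mul_assoc q surjD surjI surj_normal surj_def)
  from dim_kernel_surj[OF this] show ?thesis by (simp add: cotangent_space_def card_k)
qed

lemma momentum_in_T: "q \<in> S \<Longrightarrow> momentum q v \<in> T q"
  using M by (simp add: cotangent_space_def momentum_def matrix_vector_mul_assoc[symmetric] frame_tangent)

lemma range_momentum: "q \<in> S \<Longrightarrow> range ((*v) (M ** frame q)) = T q"
proof -
  assume q: "q \<in> S"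
  have "dim (range ((*v) (M ** frame q))) = CARD('k)"
    using dim_image_eq[of "(*v) (M ** frame q)" "UNIV :: (real^'k) set"] inj_momentum[OF q] by simp
  then show ?thesis
    using subspace_T momentum_in_T[OF q] dim_T[OF q]
    by (intro subspace_dim_equal linear_subspace_image) (auto simp: momentum_matrix[symmetric])
qed

lemma gramian_momentum: "transpose (M ** frame q) ** Minv ** (M ** frame q) = gramian q"
proof -
  have "transpose (M ** frame q) ** Minv ** (M ** frame q) = transpose (frame q) ** transpose M ** (Minv ** M) ** frame q"
    by (simp add: matrix_transpose_mul matrix_mul_assoc)
  then show ?thesis using M by (simp add: gramian_def sym_pos_def_def)
qed

lemma sets_momentum_measure [simp]: "sets (\<tau> q) = sets (restrict_space borel (T q))"
  and space_momentum_measure [simp]: "space (\<tau> q) = T q"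
  by (simp_all add: momentum_measure_def subspace_measure_def space_restrict_space)

lemma nn_integral_momentum_measure:
  assumes q: "q \<in> S" and f: "f \<in> borel_measurable (restrict_space borel (T q))"
  shows "(\<integral>\<^sup>+p. f p \<partial>\<tau> q) = (\<integral>\<^sup>+v. f (momentum q v) * ennreal (vol q) \<partial>lborel)"
  unfolding momentum_measure_def
  by (subst nn_integral_subspace_measure[OF sym_pos_def_matrix_inv[OF M] inj_momentum[OF q] range_momentum[OF q] f])
     (simp add: gramian_momentum vol_def momentum_matrix)

subsection \<open>The Liouville measure\<close>

abbreviation "TS \<equiv> cotangent_bundle M \<xi>"
abbreviation "PS \<equiv> phase_space M \<xi>"
abbreviation "L \<equiv> liouville_measure k M \<xi>"

lemma space_PS [simp]: "space PS = TS"
  by (simp add: phase_space_def space_restrict_space)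

lemma TS_iff: "(q, p) \<in> TS \<longleftrightarrow> q \<in> S \<and> p \<in> T q"
  by (simp add: cotangent_bundle_def)

definition bundle_map :: "(real^'d) \<times> (real^'k) \<Rightarrow> (real^'d) dbl" where
  "bundle_map = (\<lambda>(q, v). (q, momentum q v))"

lemma measurable_bundle_map: "bundle_map \<in> (restrict_space borel S \<Otimes>\<^sub>M borel) \<rightarrow>\<^sub>M PS"
  unfolding phase_space_def
proof (rule measurable_restrict_space2)
  show "bundle_map \<in> space (restrict_space borel S \<Otimes>\<^sub>M borel) \<rightarrow> TS"
    by (auto simp: bundle_map_def TS_iff momentum_in_T space_pair_measure space_restrict_space)
  have [measurable]: "(\<lambda>z. fst z) \<in> (restrict_space borel S \<Otimes>\<^sub>M borel) \<rightarrow>\<^sub>M borel"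
    by (rule measurable_compose[OF measurable_fst]) (rule measurable_restrict_space1, simp)
  show "bundle_map \<in> borel_measurable (restrict_space borel S \<Otimes>\<^sub>M (borel :: (real^'k) measure))"
    unfolding bundle_map_def momentum_def[abs_def] case_prod_beta by measurable
qed

text \<open>
  Functions on phase space restrict to Borel functions on the fibers, and integrating over the fibers
  depends on the base point in a Borel way.  The spaces \<open>T q\<close> vary with \<open>q\<close>, so that the second fact has to
  be read off in the coordinates of the frame.
\<close>

lemma measurable_fiber:
  assumes q: "q \<in> S" and f: "f \<in> borel_measurable PS"
  shows "(\<lambda>p. f (q, p)) \<in> borel_measurable (restrict_space borel (T q))"
  by (rule measurable_compose[OF _ f], unfold phase_space_def, rule measurable_restrict_space2)
     (use q in \<open>auto simp: TS_iff space_restrict_space intro!: measurable_restrict_space1\<close>)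

lemma measurable_bundle_integral:
  assumes f: "f \<in> borel_measurable PS"
  shows "(\<lambda>q. \<integral>\<^sup>+v. f (q, momentum q v) * ennreal (vol q) \<partial>lborel) \<in> borel_measurable (restrict_space borel S)"
proof -
  have [measurable]: "(\<lambda>z. f (bundle_map z)) \<in> borel_measurable (restrict_space borel S \<Otimes>\<^sub>M lborel)"
    using measurable_compose[OF measurable_bundle_map f] by (simp cong: measurable_cong_sets)
  have "(\<lambda>z. f (bundle_map z) * ennreal (vol (fst z))) \<in> borel_measurable (restrict_space borel S \<Otimes>\<^sub>M lborel)"
    by measurable
  from lborel.borel_measurable_nn_integral_fst[OF this] show ?thesis
    by (simp add: bundle_map_def)
qed

lemma nn_integral_fiber:
  assumes "q \<in> S" "f \<in> borel_measurable PS"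
  shows "(\<integral>\<^sup>+p. f (q, p) \<partial>\<tau> q) = (\<integral>\<^sup>+v. f (q, momentum q v) * ennreal (vol q) \<partial>lborel)"
  by (rule nn_integral_momentum_measure[OF assms(1) measurable_fiber[OF assms]])

lemma measurable_fiber_integral:
  assumes f: "f \<in> borel_measurable PS"
  shows "(\<lambda>q. \<integral>\<^sup>+p. f (q, p) \<partial>\<tau> q) \<in> borel_measurable (restrict_space borel S)"
  using measurable_bundle_integral[OF f]
  by (subst measurable_cong[OF nn_integral_fiber[OF _ f]]) (auto simp: space_restrict_space)

text \<open>
  As for the manifold, the image of a product measure exhibits the defining set function as a measure and
  gives the iterated integral.
\<close>

lemma liouville_measure_eq:
  "L = distr (density (\<sigma> \<Otimes>\<^sub>M lborel) (\<lambda>z. ennreal (vol (fst z)))) PS bundle_map" (is "_ = ?\<mu>")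
  and nn_integral_liouville: "f \<in> borel_measurable PS \<Longrightarrow> (\<integral>\<^sup>+z. f z \<partial>L) = (\<integral>\<^sup>+q. \<integral>\<^sup>+p. f (q, p) \<partial>\<tau> q \<partial>\<sigma>)"
proof -
  have b: "bundle_map \<in> (\<sigma> \<Otimes>\<^sub>M lborel) \<rightarrow>\<^sub>M PS"
    using measurable_bundle_map by (simp cong: measurable_cong_sets)
  have int: "(\<integral>\<^sup>+z. f z \<partial>?\<mu>) = (\<integral>\<^sup>+q. \<integral>\<^sup>+p. f (q, p) \<partial>\<tau> q \<partial>\<sigma>)" if f: "f \<in> borel_measurable PS" for f
  proof -
    have [measurable]: "(\<lambda>z. f (bundle_map z)) \<in> borel_measurable (\<sigma> \<Otimes>\<^sub>M lborel)"
      by (rule measurable_compose[OF b f])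
    have "(\<integral>\<^sup>+z. f z \<partial>?\<mu>) = (\<integral>\<^sup>+z. ennreal (vol (fst z)) * f (bundle_map z) \<partial>(\<sigma> \<Otimes>\<^sub>M lborel))"
      using b f by (subst nn_integral_distr) (auto intro!: nn_integral_density)
    also have "\<dots> = (\<integral>\<^sup>+q. \<integral>\<^sup>+v. ennreal (vol (fst (q, v))) * f (bundle_map (q, v)) \<partial>lborel \<partial>\<sigma>)"
      by (rule lborel.nn_integral_fst[symmetric]) measurable
    also have "\<dots> = (\<integral>\<^sup>+q. \<integral>\<^sup>+p. f (q, p) \<partial>\<tau> q \<partial>\<sigma>)"
      by (intro nn_integral_cong) (simp add: nn_integral_fiber[OF _ f] bundle_map_def mult.commute)
    finally show ?thesis .
  qed
  have "L = measure_of TS (sets PS) (emeasure ?\<mu>)"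
    unfolding liouville_measure_def
  proof (rule measure_of_eq)
    show "sets PS \<subseteq> Pow TS" using sets.sets_into_space[of _ PS] by auto
    fix E assume "E \<in> sigma_sets TS (sets PS)"
    then have E: "E \<in> sets PS" using sets.sigma_sets_eq[of PS] by simp
    have "emeasure ?\<mu> E = (\<integral>\<^sup>+z. indicator E z \<partial>?\<mu>)" using E by simp
    also have "\<dots> = (\<integral>\<^sup>+q. \<integral>\<^sup>+p. indicator E (q, p) \<partial>\<tau> q \<partial>\<sigma>)" using E by (intro int) simp
    also have "\<dots> = (\<integral>\<^sup>+q. emeasure (\<tau> q) {p. (q, p) \<in> E} \<partial>\<sigma>)"
    proof (rule nn_integral_cong)
      fix q assume "q \<in> space \<sigma>"
      then have q: "q \<in> S" by simp
      have sub: "{p. (q, p) \<in> E} \<subseteq> T q" using sets.sets_into_space[OF E] by (auto simp: TS_iff)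
      have "(\<lambda>p. (q, p)) \<in> restrict_space borel (T q) \<rightarrow>\<^sub>M PS"
        unfolding phase_space_def using q
        by (intro measurable_restrict_space2) (auto simp: TS_iff space_restrict_space intro!: measurable_restrict_space1)
      from measurable_sets[OF this E] have "{p. (q, p) \<in> E} \<in> sets (\<tau> q)"
        using sub by (simp add: space_restrict_space vimage_def Int_absorb2)
      then have "emeasure (\<tau> q) {p. (q, p) \<in> E} = (\<integral>\<^sup>+p. indicator {p. (q, p) \<in> E} p \<partial>\<tau> q)" by simp
      also have "\<dots> = (\<integral>\<^sup>+p. indicator E (q, p) \<partial>\<tau> q)" by (simp add: indicator_def)
      finally show "(\<integral>\<^sup>+p. indicator E (q, p) \<partial>\<tau> q) = emeasure (\<tau> q) {p. (q, p) \<in> E}" ..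
    qed
    finally show "(\<integral>\<^sup>+q. emeasure (\<tau> q) {p. (q, p) \<in> E} \<partial>\<sigma>) = emeasure ?\<mu> E" ..
  qed
  also have "\<dots> = ?\<mu>"
    using measure_of_of_measure[of ?\<mu>] by simp
  finally show eq: "L = ?\<mu>" .
  show "f \<in> borel_measurable PS \<Longrightarrow> (\<integral>\<^sup>+z. f z \<partial>L) = (\<integral>\<^sup>+q. \<integral>\<^sup>+p. f (q, p) \<partial>\<tau> q \<partial>\<sigma>)"
    unfolding eq by (rule int)
qed

lemma sets_liouville [measurable_cong, simp]: "sets L = sets PS"
  and space_liouville [simp]: "space L = TS"
  by (simp_all add: liouville_measure_eq)

end

section \<open>The RATTLE map as the swap of two positions\<close>

locale rattle_system = constrained_manifold M \<xi> k
  for M :: "real^'d^'d" and \<xi> :: "real^'d \<Rightarrow> real^'m" and k :: "'k::finite itself" +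
  fixes V :: "real^'d \<Rightarrow> real" and D :: "(real^'d) dbl set"
    and \<Lambda> :: "(real^'d) dbl \<Rightarrow> real^'m" and h :: real
  assumes smooth_potential: "smooth_on UNIV V"
    and Z_nu_finite: "Z_nu k M \<xi> V < \<infinity>"
    and admissible: "admissible_multiplier M \<xi> D \<Lambda>"
    and timestep_pos: "0 < h"
begin

abbreviation "A \<equiv> rattle_domain M \<xi> V D h"
abbreviation "\<Psi> \<equiv> rattle M \<xi> V \<Lambda> h"
abbreviation "B \<equiv> reversible_set M \<xi> V D \<Lambda> h"
abbreviation "step \<equiv> unconstrained_step M V h"

lemma V_continuous: "continuous_on UNIV V"
  using smooth_potential Ck_on_imp_continuous_on by (auto simp: smooth_on_def)

lemma measurable_V [measurable]: "V \<in> borel_measurable borel"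
  using V_continuous by (rule borel_measurable_continuous_onI)

lemma grad_continuous: "continuous_on UNIV (grad V)"
proof -
  have "Ck_on 1 UNIV V" using smooth_potential by (simp add: smooth_on_def)
  then show ?thesis unfolding grad_def[abs_def] by (intro continuous_on_vec_lambda) simp
qed

lemma measurable_grad [measurable]: "grad V \<in> borel_measurable borel"
  using grad_continuous by (rule borel_measurable_continuous_onI)

lemma measurable_\<xi> [measurable]: "\<xi> \<in> borel_measurable borel"
  using smooth_constraint Ck_on_imp_continuous_on by (auto simp: smooth_on_def intro!: borel_measurable_continuous_onI)

lemma measurable_N [measurable]: "N \<in> borel_measurable borel"
proof (rule borel_measurable_continuous_onI)
  have C: "Ck_on 1 UNIV (\<lambda>x. \<xi> x $ j)" for j
    using smooth_constraint by (intro Ck_on_bounded_linear_comp[OF bounded_linear_vec_nth]) (auto simp: smooth_on_def)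
  then have "continuous_on UNIV (\<lambda>x. frechet_derivative (\<lambda>x. \<xi> x $ j) (at x) v)" for j v by simp
  then show "continuous_on UNIV N"
    unfolding grad_mat_def[abs_def] grad_def[abs_def] by (intro continuous_on_vec_lambda) simp
qed

lemma TS_borel [measurable]: "TS \<in> sets borel"
proof -
  have "TS = {z \<in> space borel. \<xi> (fst z) = 0 \<and> (transpose (N (fst z)) ** Minv) *v snd z = 0}"
    by (auto simp: cotangent_bundle_def submfd_def cotangent_space_def)
  also have "\<dots> \<in> sets borel"
    unfolding borel_prod[symmetric] by measurable
  finally show ?thesis .
qed

lemma sets_PS: "sets PS = {E \<in> sets borel. E \<subseteq> TS}"
  by (auto simp: phase_space_def sets_restrict_space_iff)

lemma measurable_PS_id: "(\<lambda>z. z) \<in> borel_measurable PS"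
  unfolding phase_space_def by (rule measurable_restrict_space1) simp

lemma measurable_PS_fst [measurable]: "fst \<in> borel_measurable PS"
  and measurable_PS_snd [measurable]: "snd \<in> borel_measurable PS"
  using measurable_compose[OF measurable_PS_id, of fst borel] measurable_compose[OF measurable_PS_id, of snd borel]
  by (simp_all add: borel_prod[symmetric])

subsection \<open>Projection onto the cotangent spaces\<close>

text \<open>
  The coordinates of the projection onto the cotangent space along the normal directions
  \<open>N q *v l\<close>.
\<close>

definition coord :: "real^'d \<Rightarrow> real^'d \<Rightarrow> real^'k" where
  "coord q y = cramer_solve (gramian q) (transpose (frame q) *v y)"

lemma coord_unique:
  assumes q: "q \<in> S" and y: "y = momentum q v + N q *v l"
  shows "coord q y = v"
proof -
  have "transpose (frame q) *v y = transpose (frame q) *v momentum q v"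
    by (simp only: y matrix_vector_right_distrib frame_normal[OF q] add_0_right)
  then have "gramian q *v v = transpose (frame q) *v y"
    by (simp add: gramian_def momentum_def matrix_vector_mul_assoc matrix_mul_assoc)
  then show ?thesis unfolding coord_def using cramer_solve[of "gramian q"] det_gramian_pos[OF q] by simp
qed

lemma coord_momentum [simp]: "q \<in> S \<Longrightarrow> coord q (momentum q v) = v"
  by (rule coord_unique[of _ _ _ 0]) auto

lemma momentum_ex: "q \<in> S \<Longrightarrow> p \<in> T q \<Longrightarrow> \<exists>v. p = momentum q v"
  using range_momentum[of q] by (auto simp: momentum_matrix)

lemma coord_matrix: "q \<in> S \<Longrightarrow> coord q y = (matrix_inv (gramian q) ** transpose (frame q)) *v y"
proof -
  assume q: "q \<in> S"
  have "sym_pos_def (gramian q)" unfolding gramian_def by (rule sym_pos_def_congruence[OF M inj_frame[OF q]])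
  then have "gramian q *v ((matrix_inv (gramian q) ** transpose (frame q)) *v y) = transpose (frame q) *v y"
    by (simp add: matrix_vector_mul_assoc[symmetric])
  then show ?thesis unfolding coord_def using cramer_solve[of "gramian q"] det_gramian_pos[OF q] by simp
qed

lemma multiplier_unique:
  assumes q: "q \<in> S" shows "\<exists>!l. y + N q *v l \<in> T q"
proof -
  have eq: "(y + N q *v l \<in> T q) \<longleftrightarrow> gram M \<xi> q *v l = - ((transpose (N q) ** Minv) *v y)" for l
    by (simp add: cotangent_space_def matrix_vector_right_distrib gram_def matrix_vector_mul_assoc add_eq_0_iff)
  have "det (gram M \<xi> q) \<noteq> 0" using gram_invertible[OF q] by (simp add: invertible_det_nz)
  then show ?thesis unfolding eq using cramer_solve[of "gram M \<xi> q"] by auto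
qed

subsection \<open>The map of pairs of positions\<close>

text \<open>
  With the discrete action \<open>(q1 - q)\<^sup>T M (q1 - q) / (2 h) - h (V q + V q1) / 2\<close>, the impulse is minus its
  gradient in \<open>q\<close>.  By the symmetry of the action, the impulse with the arguments exchanged is the gradient
  in \<open>q1\<close> with its sign reversed: this is where the momentum reversal of RATTLE enters.
\<close>

definition impulse :: "real^'d \<Rightarrow> real^'d \<Rightarrow> real^'d" where
  "impulse q q1 = (1 / h) *\<^sub>R (M *v (q1 - q)) + (h / 2) *\<^sub>R grad V q"

text \<open>
  The only phase space point over \<open>q\<close> from which RATTLE can arrive at \<open>q1\<close>: the Lagrange multipliers
  contribute normal vectors, which the projection removes.
\<close>

definition lift :: "(real^'d) dbl \<Rightarrow> (real^'d) dbl" where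
  "lift = (\<lambda>(q, q1). (q, momentum q (coord q (impulse q q1))))"

lemma fst_lift [simp]: "fst (lift (q, q1)) = q"
  by (simp add: lift_def)

lemma lift_eqI:
  assumes q: "q \<in> S" and p: "p \<in> T q" and i: "impulse q q1 = p + N q *v l"
  shows "lift (q, q1) = (q, p)"
proof -
  obtain v where v: "p = momentum q v" using momentum_ex[OF q p] by auto
  then have "coord q (impulse q q1) = v" using coord_unique[OF q] i by simp
  then show ?thesis by (simp add: lift_def v)
qed

lemma A_subset_TS: "A \<subseteq> TS"
  by (auto simp: rattle_domain_def)

text \<open>
  The half step momentum \<open>ph\<close> equals \<open>M (q1 - q) / h\<close>.  So the impulse at \<open>q\<close> is the initial momentum plus
  a normal vector, and the impulse at \<open>q1\<close> is the reversed final momentum plus a normal vector.  Seen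
  through \<open>lift\<close>, RATTLE exchanges the two positions.
\<close>

lemma rattle_lift:
  assumes z: "z \<in> A"
  shows "fst (\<Psi> z) \<in> S" (is ?S) and "lift (fst z, fst (\<Psi> z)) = z" and "\<Psi> z = lift (fst (\<Psi> z), fst z)"
proof -
  obtain q p where zqp: "z = (q, p)" by fastforce
  have q: "q \<in> S" and p: "p \<in> T q" and D: "(q, step (q, p)) \<in> D"
    using z by (auto simp: rattle_domain_def zqp TS_iff)
  define l where "l = (1 / h) *\<^sub>R \<Lambda> (q, step (q, p))"
  define ph where "ph = p - (h / 2) *\<^sub>R grad V q + N q *v l"
  define q1 where "q1 = q + h *\<^sub>R (Minv *v ph)"
  define l1 where "l1 = (THE l. ph - (h / 2) *\<^sub>R grad V q1 + N q1 *v l \<in> T q1)"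
  define p1 where "p1 = ph - (h / 2) *\<^sub>R grad V q1 + N q1 *v l1"
  have \<Psi>: "\<Psi> z = (q1, - p1)"
    unfolding zqp rattle_def Let_def prod.case l_def[symmetric] ph_def[symmetric] q1_def[symmetric]
      l1_def[symmetric] p1_def[symmetric] ..
  have q1: "q1 \<in> S"
  proof -
    have "step (q, p) + (Minv ** N q) *v \<Lambda> (q, step (q, p)) = q1"
      using timestep_pos
      by (simp add: q1_def ph_def l_def unconstrained_step_def matrix_vector_right_distrib matrix_vector_mul_assoc
          matrix_vector_mult_scaleR scaleR_add_right)
    then show ?thesis using admissible D unfolding admissible_multiplier_def Let_def by fastforce
  qed
  then show ?S by (simp add: \<Psi>)
  have ph: "(1 / h) *\<^sub>R (M *v (q1 - q)) = ph"
    using timestep_pos M by (simp add: q1_def matrix_vector_mult_scaleR)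
  show "lift (fst z, fst (\<Psi> z)) = z"
    unfolding zqp \<Psi>[unfolded zqp] fst_conv
    by (rule lift_eqI[OF q p, of _ l]) (simp add: impulse_def ph, simp add: ph_def)
  have "ph - (h / 2) *\<^sub>R grad V q1 + N q1 *v l1 \<in> T q1"
    unfolding l1_def by (rule theI'[OF multiplier_unique[OF q1]])
  from subspace_neg[OF subspace_T this] have p1: "- p1 \<in> T q1" unfolding p1_def .
  have "(1 / h) *\<^sub>R (M *v (q - q1)) = - ph"
  proof -
    have "M *v (q - q1) = - (M *v (q1 - q))" by (simp add: matrix_vector_mult_diff_distrib)
    with ph show ?thesis by simp
  qed
  then have "impulse q1 q = - p1 + N q1 *v l1"
    by (simp add: impulse_def p1_def)
  from lift_eqI[OF q1 p1 this] show "\<Psi> z = lift (fst (\<Psi> z), fst z)"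
    by (simp add: \<Psi>) (simp add: zqp)
qed

subsection \<open>Measurability\<close>

lemma measurable_restrict_S: "f \<in> Q \<rightarrow>\<^sub>M restrict_space borel S \<Longrightarrow> f \<in> borel_measurable Q"
  by (auto simp: measurable_restrict_space2_iff)

lemma measurable_coord:
  assumes q: "q \<in> Q \<rightarrow>\<^sub>M restrict_space borel S" and [measurable]: "y \<in> borel_measurable Q"
  shows "(\<lambda>x. coord (q x) (y x)) \<in> borel_measurable Q"
proof -
  have [measurable]: "(\<lambda>x. gramian (q x)) \<in> borel_measurable Q" "(\<lambda>x. frame (q x)) \<in> borel_measurable Q"
    by (rule measurable_compose[OF q measurable_gramian] measurable_compose[OF q measurable_frame])+
  show ?thesis unfolding coord_def by measurable
qed

lemma measurable_lift:
  assumes q: "q \<in> Q \<rightarrow>\<^sub>M restrict_space borel S" and q1: "q1 \<in> Q \<rightarrow>\<^sub>M restrict_space borel S"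
  shows "(\<lambda>x. lift (q x, q1 x)) \<in> Q \<rightarrow>\<^sub>M PS"
proof -
  note [measurable] = measurable_restrict_S[OF q] measurable_restrict_S[OF q1]
  have "(\<lambda>x. coord (q x) (impulse (q x) (q1 x))) \<in> borel_measurable Q"
    unfolding impulse_def by (rule measurable_coord[OF q]) measurable
  with q have "(\<lambda>x. (q x, coord (q x) (impulse (q x) (q1 x)))) \<in> Q \<rightarrow>\<^sub>M restrict_space borel S \<Otimes>\<^sub>M borel"
    by simp
  from measurable_compose[OF this measurable_bundle_map] show ?thesis
    by (simp add: lift_def bundle_map_def)
qed

lemma step_continuous: "continuous_on UNIV step"
  unfolding unconstrained_step_def case_prod_beta
  by (intro continuous_intros bounded_linear.continuous_on[OF matrix_vector_mul_bounded_linear]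
        continuous_on_compose2[OF grad_continuous]) auto

lemma \<Lambda>_continuous: "continuous_on D \<Lambda>"
  unfolding continuous_on_def
proof
  fix x assume x: "x \<in> D"
  have "C1_on_relopen D \<Lambda>" using admissible by (simp add: admissible_multiplier_def)
  then obtain W F where W: "open W" "x \<in> W" "Ck_on 1 W F" "\<forall>y\<in>W \<inter> D. F y = \<Lambda> y"
    using x unfolding C1_on_relopen_def by blast
  have "continuous_on (D \<inter> W) F" by (rule continuous_on_subset[OF Ck_on_imp_continuous_on[OF W(3)]]) simp
  then have "continuous_on (D \<inter> W) \<Lambda>" by (rule continuous_on_eq) (use W(4) in blast)
  then have "(\<Lambda> \<longlongrightarrow> \<Lambda> x) (at x within D \<inter> W)" using x W(2) unfolding continuous_on_def by blast
  moreover have "at x within D \<inter> W = at x within D" by (rule at_within_nhd[OF W(2,1)]) blast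
  ultimately show "(\<Lambda> \<longlongrightarrow> \<Lambda> x) (at x within D)" by simp
qed

lemma pair_step_continuous: "continuous_on UNIV (\<lambda>z. (fst z, step z))"
  by (intro continuous_on_Pair step_continuous continuous_on_fst continuous_on_id)

lemma A_alt: "A = {z \<in> TS. (fst z, step z) \<in> D}"
  by (auto simp: rattle_domain_def)

lemma A_sets [measurable]: "A \<in> sets PS"
proof -
  obtain O' where O': "open O'" "D = (S \<times> UNIV) \<inter> O'"
    using admissible unfolding admissible_multiplier_def openin_open by auto
  have "open ((\<lambda>z. (fst z, step z)) -` O')"
    using open_vimage[OF O'(1) pair_step_continuous] .
  moreover have "c \<in> D \<longleftrightarrow> fst c \<in> S \<and> c \<in> O'" for c by (subst O'(2)) (cases c, simp)
  then have "A = TS \<inter> (\<lambda>z. (fst z, step z)) -` O'" by (auto simp: A_alt TS_iff)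
  ultimately show ?thesis by (auto simp: sets_PS)
qed

text \<open>
  Extended to all of phase space by staying put, to have a Borel function with values on the manifold.
\<close>

definition "next_pos z = (if z \<in> A then fst (\<Psi> z) else fst z)"

lemma next_pos_in: "z \<in> TS \<Longrightarrow> next_pos z \<in> S"
  using rattle_lift(1)[of z] by (cases z) (auto simp: next_pos_def TS_iff)

lemma measurable_next_pos: "next_pos \<in> PS \<rightarrow>\<^sub>M restrict_space borel S"
proof (rule measurable_restrict_space2)
  show "next_pos \<in> space PS \<rightarrow> S" using next_pos_in by auto
  have "continuous_on A (\<lambda>z. \<Lambda> (fst z, step z))"
    by (rule continuous_on_compose2[OF \<Lambda>_continuous continuous_on_subset[OF pair_step_continuous]]) (auto simp: A_alt)
  then have "(\<lambda>z. \<Lambda> (fst z, step z)) \<in> borel_measurable (restrict_space borel A)"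
    by (rule borel_measurable_continuous_on_restrict)
  moreover have "A \<in> sets borel" using A_sets by (simp add: sets_PS)
  then have "restrict_space borel A = restrict_space PS A"
    unfolding phase_space_def by (subst restrict_restrict_space) (auto simp: Int_absorb1[OF A_subset_TS])
  ultimately have L: "(\<lambda>z. \<Lambda> (fst z, step z)) \<in> borel_measurable (restrict_space PS A)" by simp
  have [measurable]: "fst \<in> borel_measurable (restrict_space PS A)" "snd \<in> borel_measurable (restrict_space PS A)"
    by (auto intro: measurable_restrict_space1)
  have "(\<lambda>z. fst z + h *\<^sub>R (Minv *v (snd z - (h / 2) *\<^sub>R grad V (fst z) + N (fst z) *v ((1 / h) *\<^sub>R \<Lambda> (fst z, step z)))))
      \<in> borel_measurable (restrict_space PS A)"
    using L by measurable
  moreover have "fst (\<Psi> z) = fst z + h *\<^sub>R (Minv *v (snd z - (h / 2) *\<^sub>R grad V (fst z) + N (fst z) *v ((1 / h) *\<^sub>R \<Lambda> (fst z, step z))))" for z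
    by (cases z) (simp add: rattle_def Let_def)
  ultimately have "(\<lambda>z. fst (\<Psi> z)) \<in> borel_measurable (restrict_space PS A)" by (simp only:)
  then show "next_pos \<in> borel_measurable PS"
    unfolding next_pos_def[abs_def] using A_sets A_subset_TS
    by (subst measurable_If_restrict_space_iff)
       (auto intro: measurable_restrict_space1 simp: Int_absorb1 Collect_conj_eq)
qed

lemma measurable_PS_fst_S: "fst \<in> PS \<rightarrow>\<^sub>M restrict_space borel S"
  by (rule measurable_restrict_space2) (auto simp: TS_iff)

text \<open>
  RATTLE written through \<open>lift\<close>, whose measurability is evident, and made total by the identity.
\<close>

definition "\<Psi>' z = (if z \<in> A then lift (next_pos z, fst z) else z)"

lemma \<Psi>'_eq: "z \<in> A \<Longrightarrow> \<Psi>' z = \<Psi> z"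
  unfolding \<Psi>'_def next_pos_def using rattle_lift(3) by simp

lemma measurable_\<Psi>' [measurable]: "\<Psi>' \<in> PS \<rightarrow>\<^sub>M PS"
proof -
  have "(\<lambda>z. lift (next_pos z, fst z)) \<in> PS \<rightarrow>\<^sub>M PS"
    by (rule measurable_lift[OF measurable_next_pos measurable_PS_fst_S])
  then show ?thesis unfolding \<Psi>'_def[abs_def]
    using A_sets by (intro measurable_If_set measurable_ident) (auto simp: Int_absorb2[OF A_subset_TS])
qed

lemma B_alt: "B = {z \<in> A. \<Psi>' z \<in> A \<and> \<Psi>' (\<Psi>' z) = z}"
  by (auto simp: reversible_set_def \<Psi>'_eq)

lemma B_sets [measurable]: "B \<in> sets PS"
proof -
  have "(\<lambda>z. \<Psi>' (\<Psi>' z)) \<in> borel_measurable PS"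
    by (intro measurable_compose[OF _ measurable_PS_id] measurable_compose[OF measurable_\<Psi>' measurable_\<Psi>'])
  then have "{z \<in> space PS. \<Psi>' (\<Psi>' z) = z} \<in> sets PS"
    using measurable_PS_id by (rule measurable_equality_set)
  moreover have "\<Psi>' -` A \<inter> space PS \<in> sets PS" by (rule measurable_sets[OF measurable_\<Psi>' A_sets])
  moreover have "B = A \<inter> (\<Psi>' -` A \<inter> space PS) \<inter> {z \<in> space PS. \<Psi>' (\<Psi>' z) = z}"
    using A_subset_TS by (auto simp: B_alt)
  ultimately show ?thesis using A_sets by auto
qed

lemma B_subset: "B \<subseteq> A" "B \<subseteq> TS"
  using A_subset_TS by (auto simp: B_alt)

lemma rattle_B: "z \<in> B \<Longrightarrow> \<Psi> z \<in> B" "z \<in> B \<Longrightarrow> \<Psi> (\<Psi> z) = z"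
  by (auto simp: reversible_set_def)

subsection \<open>The set of reversible pairs\<close>

text \<open>
  The reversible set in the coordinates that are a pair of positions.  The condition on \<open>next_pos\<close> selects, for each
  point over \<open>q\<close>, the one position that RATTLE reaches.  Thus \<open>lift\<close> is a bijection from \<open>pairs\<close> onto \<open>B\<close>,
  even though other pairs of positions may have the same lift.
\<close>

definition pairs :: "(real^'d) dbl set" where
  "pairs = {c \<in> S \<times> S. lift c \<in> B \<and> next_pos (lift c) = snd c}"

lemma pairs_rattle:
  assumes "(q, q1) \<in> pairs" shows "\<Psi> (lift (q, q1)) = lift (q1, q)" "(q1, q) \<in> pairs"
proof -
  let ?z = "lift (q, q1)"
  have c: "q \<in> S" "q1 \<in> S" "?z \<in> B" "next_pos ?z = q1" using assms by (auto simp: pairs_def)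
  have zA: "?z \<in> A" "\<Psi> ?z \<in> A" using c(3) B_subset(1) rattle_B(1)[of ?z] by blast+
  have f: "fst (\<Psi> ?z) = q1" using c zA by (simp add: next_pos_def)
  then show *: "\<Psi> ?z = lift (q1, q)" using rattle_lift(3)[OF zA(1)] by simp
  have "next_pos (lift (q1, q)) = fst (\<Psi> (\<Psi> ?z))" using zA * by (simp add: next_pos_def)
  also have "\<dots> = q" using rattle_B(2)[OF c(3)] by simp
  finally show "(q1, q) \<in> pairs" using c rattle_B(1)[OF c(3)] * by (simp add: pairs_def)
qed

lemma pairs_sym: "(q, q1) \<in> pairs \<longleftrightarrow> (q1, q) \<in> pairs"
  using pairs_rattle(2) by blast

lemma pairs_sets: "pairs \<in> sets (restrict_space borel S \<Otimes>\<^sub>M restrict_space borel S)" (is "_ \<in> sets ?SS")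
proof -
  have l: "lift \<in> ?SS \<rightarrow>\<^sub>M PS"
    using measurable_lift[of fst ?SS snd] by simp
  have "lift -` B \<inter> space ?SS \<in> sets ?SS" by (rule measurable_sets[OF l B_sets])
  moreover have "{c \<in> space ?SS. next_pos (lift c) = snd c} \<in> sets ?SS"
    by (intro measurable_equality_set measurable_restrict_S[OF measurable_snd]
          measurable_compose[OF l measurable_restrict_S[OF measurable_next_pos]])
  moreover have "pairs = (lift -` B \<inter> space ?SS) \<inter> {c \<in> space ?SS. next_pos (lift c) = snd c}"
    by (auto simp: pairs_def space_pair_measure space_restrict_space)
  ultimately show ?thesis by auto
qed

subsection \<open>The change of variables in the fibers\<close>

text \<open>
  The density of the Liouville measure in the coordinates \<open>(q, q1)\<close> with respect to the product of the
  measure on the manifold with itself.  The matrix is that of the mixed second derivative of the discrete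
  action, up to sign and a factor \<open>h\<close>, in the two frames.  Exchanging \<open>q\<close> and \<open>q1\<close> transposes it: this symmetry is the reason
  for the invariance.
\<close>

definition "transfer_density q q1 = \<bar>det (transpose (frame q) ** M ** frame q1)\<bar> / (vol q * vol q1 * h ^ CARD('k))"

lemma transfer_density_sym: "transfer_density q q1 = transfer_density q1 q"
proof -
  have "transpose (transpose (frame q) ** M ** frame q1) = transpose (frame q1) ** M ** frame q"
    using M by (simp add: matrix_transpose_mul matrix_mul_assoc sym_pos_def_def)
  then have "det (transpose (frame q) ** M ** frame q1) = det (transpose (frame q1) ** M ** frame q)"
    by (metis det_transpose)
  then show ?thesis by (simp add: transfer_density_def mult_ac)
qed

lemma measurable_transfer_density:
  assumes q: "q \<in> Q \<rightarrow>\<^sub>M restrict_space borel S" and q1: "q1 \<in> Q \<rightarrow>\<^sub>M restrict_space borel S"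
  shows "(\<lambda>x. transfer_density (q x) (q1 x)) \<in> borel_measurable Q"
proof -
  note [measurable] = measurable_compose[OF q measurable_frame] measurable_compose[OF q1 measurable_frame]
    measurable_compose[OF q measurable_vol] measurable_compose[OF q1 measurable_vol]
  show ?thesis unfolding transfer_density_def by measurable
qed

lemma det_scaleR: "det (c *\<^sub>R (Q :: real^'n^'n)) = c ^ CARD('n) * det Q"
proof -
  have "c *\<^sub>R Q = (\<chi> i. c *s Q $ i)" by (simp add: vec_eq_iff)
  then show ?thesis using det_rows_mul[of "\<lambda>_. c" "\<lambda>i. Q $ i"] by simp
qed

text \<open>
  The map from the end position to the initial momentum, in the chart \<open>n\<close> of the end position and
  the frame of the initial one.
\<close>

definition "fiber_map q n x = coord q (impulse q (\<phi> n x))"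
definition "fiber_deriv q n x = (1 / h) *\<^sub>R (matrix_inv (gramian q) ** transpose (frame q) ** M ** jac n x)"

lemma fiber_map_derivative:
  assumes q: "q \<in> S" and x: "x \<in> U n"
  shows "(fiber_map q n has_derivative (\<lambda>v. fiber_deriv q n x *v v)) (at x)"
proof -
  let ?K = "matrix_inv (gramian q) ** transpose (frame q)"
  have "((\<lambda>x. ?K *v ((1 / h) *\<^sub>R (M *v (\<phi> n x - q)) + (h / 2) *\<^sub>R grad V q)) has_derivative
      (\<lambda>v. ?K *v ((1 / h) *\<^sub>R (M *v (frechet_derivative (\<phi> n) (at x) v - 0)) + 0))) (at x)"
    by (intro bounded_linear.has_derivative[OF matrix_vector_mul_bounded_linear] has_derivative_add
         has_derivative_scaleR_right has_derivative_diff has_derivative_const chart_derivative x)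
  moreover have "?K *v ((1 / h) *\<^sub>R (M *v (frechet_derivative (\<phi> n) (at x) v - 0)) + 0) = fiber_deriv q n x *v v" for v
    by (simp add: jac[OF x] fiber_deriv_def scaleR_matrix_vector_assoc[symmetric] matrix_vector_mult_scaleR
        matrix_vector_mul_assoc matrix_mul_assoc)
  ultimately show ?thesis
    by (simp only: fiber_map_def[abs_def] coord_matrix[OF q] impulse_def)
qed

lemma abs_det_fiber_deriv:
  assumes q: "q \<in> S" and x: "x \<in> piece n"
  shows "\<bar>det (fiber_deriv q n x)\<bar> * vol q = transfer_density q (\<phi> n x) * vol (\<phi> n x)"
proof -
  have x1: "\<phi> n x \<in> S" using x chart_in by (simp add: piece_def)
  have spd: "sym_pos_def (gramian q)" unfolding gramian_def by (rule sym_pos_def_congruence[OF M inj_frame[OF q]])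
  have "det (matrix_inv (gramian q)) * det (gramian q) = det (mat 1 :: real^'k^'k)"
    using matrix_inv_mult(2)[OF spd] by (metis det_mul)
  then have inv: "det (matrix_inv (gramian q)) = 1 / (vol q * vol q)"
    using det_gramian_pos[OF q] by (simp add: vol_def field_simps)
  let ?X = "det (transpose (frame q) ** M ** frame (\<phi> n x))"
  have "det (fiber_deriv q n x) = (1 / h) ^ CARD('k) * (det (matrix_inv (gramian q)) * ?X)"
    by (simp add: fiber_deriv_def det_scaleR frame_eq[OF x] matrix_mul_assoc[symmetric] det_mul)
  also have "\<dots> = ?X / (h ^ CARD('k) * (vol q * vol q))"
    unfolding inv by (simp add: power_one_over)
  finally have "\<bar>det (fiber_deriv q n x)\<bar> = \<bar>?X\<bar> / (h ^ CARD('k) * (vol q * vol q))"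
    using timestep_pos by (simp add: abs_divide abs_mult)
  then show ?thesis
    using vol_pos[OF q] vol_pos[OF x1] timestep_pos by (simp add: transfer_density_def divide_simps mult_ac)
qed

lemma momentum_inj: "q \<in> S \<Longrightarrow> momentum q v = momentum q v' \<Longrightarrow> v = v'"
  by (metis coord_momentum)

text \<open>
  For a fixed initial position \<open>q\<close>, the initial momentum is replaced by the end position.  The momenta
  are sorted by the piece of the manifold on which the trajectory ends; on each class the substitution
  \<open>fiber_map q n\<close> is injective and the change of variables formula applies.
\<close>

lemma nn_integral_fiber_change:
  assumes q: "q \<in> S" and f: "f \<in> borel_measurable PS"
  shows "(\<integral>\<^sup>+p. f (q, p) * indicator B (q, p) \<partial>\<tau> q)
       = (\<integral>\<^sup>+q1. f (lift (q, q1)) * ennreal (transfer_density q q1) * indicator pairs (q, q1) \<partial>\<sigma>)"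
proof -
  let ?z = "\<lambda>v. (q, momentum q v)"
  have z: "?z \<in> borel \<rightarrow>\<^sub>M PS"
    using measurable_compose[OF _ measurable_bundle_map, of "\<lambda>v. (q, v)" borel] q
    by (simp add: bundle_map_def space_restrict_space)
  have fB: "(\<lambda>z. f z * indicator B z) \<in> borel_measurable PS" using f by measurable
  define g where "g v = f (?z v) * indicator B (?z v) * ennreal (vol q)" for v
  have g: "g \<in> borel_measurable borel"
    unfolding g_def using measurable_compose[OF z fB] by measurable
  define Y where "Y n = {v. ?z v \<in> B \<and> idx (next_pos (?z v)) = n}" for n
  define X where "X n = {x \<in> piece n. (q, \<phi> n x) \<in> pairs}" for n
  have lift: "lift (q, \<phi> n x) = ?z (fiber_map q n x)" for n x
    by (simp add: lift_def fiber_map_def)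
  have im: "fiber_map q n ` X n = Y n" for n
  proof (intro subset_antisym subsetI)
    fix v assume "v \<in> fiber_map q n ` X n"
    then obtain x where x: "x \<in> X n" "v = fiber_map q n x" by auto
    then show "v \<in> Y n" by (auto simp: X_def Y_def pairs_def lift piece_def)
  next
    fix v assume v: "v \<in> Y n"
    let ?q1 = "next_pos (?z v)"
    have B: "?z v \<in> B" and A: "?z v \<in> A" and n: "idx ?q1 = n" using v B_subset by (auto simp: Y_def)
    have q1: "?q1 \<in> S" using B B_subset next_pos_in by auto
    obtain x where x: "x \<in> piece n" "\<phi> n x = ?q1" using pieceE[OF q1] n by metis
    have l: "lift (q, \<phi> n x) = ?z v" using rattle_lift(2)[OF A] A x(2) by (simp add: next_pos_def)
    then have "v = fiber_map q n x" using momentum_inj[OF q] unfolding lift by auto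
    moreover have "x \<in> X n" using x q q1 B l by (simp add: X_def pairs_def)
    ultimately show "v \<in> fiber_map q n ` X n" by blast
  qed
  have inj: "inj_on (fiber_map q n) (X n)" for n
  proof (rule inj_onI)
    fix x y assume xy: "x \<in> X n" "y \<in> X n" "fiber_map q n x = fiber_map q n y"
    then have "lift (q, \<phi> n x) = lift (q, \<phi> n y)" unfolding lift by simp
    with xy have "\<phi> n x = \<phi> n y" by (auto simp: X_def pairs_def)
    with xy show "x = y" using chart_inverse by (metis (no_types, lifting) X_def mem_Collect_eq piece_def)
  qed
  have X_sets: "X n \<in> sets borel" for n
  proof -
    have "{q1 \<in> S. (q, q1) \<in> pairs} \<in> sets (restrict_space borel S)"
      using sets_Pair1[OF pairs_sets, of q] by (simp add: vimage_def pairs_def conj_commute cong: conj_cong)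
    then have "{x \<in> U n. \<phi> n x \<in> {q1 \<in> S. (q, q1) \<in> pairs}} \<in> sets borel"
      by (intro chart_vimage_borel) (simp add: sets_S)
    moreover have "X n = piece n \<inter> {x \<in> U n. \<phi> n x \<in> {q1 \<in> S. (q, q1) \<in> pairs}}"
      by (auto simp: X_def piece_def chart_in)
    ultimately show ?thesis by auto
  qed
  have meas: "(\<lambda>x. indicator (X n) x * \<bar>det (matrix ((*v) (fiber_deriv q n x)))\<bar>) \<in> borel_measurable borel" for n
  proof -
    have "(\<lambda>x. if x \<in> X n then jac n x else 0) \<in> borel_measurable borel"
      using X_sets continuous_on_jac
      by (intro borel_measurable_continuous_on_if continuous_on_const) (auto simp: X_def piece_def intro: continuous_on_subset)
    then have "(\<lambda>x. indicator (X n) x * \<bar>det ((1 / h) *\<^sub>R (matrix_inv (gramian q) ** transpose (frame q) ** M ** (if x \<in> X n then jac n x else 0)))\<bar>) \<in> borel_measurable borel"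
      using X_sets by measurable
    also have "(\<lambda>x. indicator (X n) x * \<bar>det ((1 / h) *\<^sub>R (matrix_inv (gramian q) ** transpose (frame q) ** M ** (if x \<in> X n then jac n x else 0)))\<bar>)
       = (\<lambda>x. indicator (X n) x * \<bar>det (matrix ((*v) (fiber_deriv q n x)))\<bar>)"
      by (auto simp: fiber_deriv_def indicator_def)
    finally show ?thesis .
  qed
  have Y_sets: "Y n \<in> sets borel" for n
  proof -
    have 1: "{q \<in> S. idx q = n} \<in> sets (restrict_space borel S)"
      using idx_level_borel by (auto simp: sets_S)
    have "?z -` (B \<inter> (next_pos -` {q \<in> S. idx q = n} \<inter> space PS)) \<inter> space borel \<in> sets borel"
      by (rule measurable_sets[OF z]) (intro sets.Int B_sets measurable_sets[OF measurable_next_pos 1])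
    moreover have "Y n = ?z -` (B \<inter> (next_pos -` {q \<in> S. idx q = n} \<inter> space PS)) \<inter> space borel"
      using B_subset next_pos_in by (auto simp: Y_def)
    ultimately show ?thesis by simp
  qed
  have "(\<integral>\<^sup>+p. f (q, p) * indicator B (q, p) \<partial>\<tau> q) = (\<integral>\<^sup>+v. g v \<partial>lborel)"
    by (subst nn_integral_fiber[OF q fB]) (simp add: g_def[abs_def])
  also have "\<dots> = (\<integral>\<^sup>+v. (\<Sum>n. g v * indicator (Y n) v) \<partial>lborel)"
  proof (rule nn_integral_cong)
    fix v
    have disj: "disjoint_family Y" by (auto simp: disjoint_family_on_def Y_def)
    have "g v = g v * indicator (\<Union>n. Y n) v" by (auto simp: g_def Y_def indicator_def)
    also have "\<dots> = (\<Sum>n. g v * indicator (Y n) v)"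
      using suminf_indicator[OF disj, of v] by (metis ennreal_suminf_cmult)
    finally show "g v = (\<Sum>n. g v * indicator (Y n) v)" .
  qed
  also have "\<dots> = (\<Sum>n. \<integral>\<^sup>+v. g v * indicator (Y n) v \<partial>lborel)"
    using g Y_sets by (intro nn_integral_suminf) auto
  also have "\<dots> = (\<Sum>n. \<integral>\<^sup>+x. g (fiber_map q n x) * ennreal \<bar>det (matrix ((*v) (fiber_deriv q n x)))\<bar> * indicator (X n) x \<partial>lborel)"
  proof (rule suminf_cong)
    fix n
    have "(fiber_map q n has_derivative ((*v) (fiber_deriv q n x))) (at x within X n)" if "x \<in> X n" for x
      using fiber_map_derivative[OF q, of x n] that by (auto simp: X_def piece_def intro: has_derivative_at_withinI)
    from nn_integral_change_of_variables[OF X_sets _ this inj meas g]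
    show "(\<integral>\<^sup>+v. g v * indicator (Y n) v \<partial>lborel) = (\<integral>\<^sup>+x. g (fiber_map q n x) * ennreal \<bar>det (matrix ((*v) (fiber_deriv q n x)))\<bar> * indicator (X n) x \<partial>lborel)"
      unfolding im using Y_sets by simp
  qed
  also have "\<dots> = (\<Sum>n. \<integral>\<^sup>+x. (f (lift (q, \<phi> n x)) * ennreal (transfer_density q (\<phi> n x)) * indicator pairs (q, \<phi> n x)) * ennreal (vol (\<phi> n x)) * indicator (piece n) x \<partial>lborel)"
  proof (intro suminf_cong nn_integral_cong)
    fix n x
    show "g (fiber_map q n x) * ennreal \<bar>det (matrix ((*v) (fiber_deriv q n x)))\<bar> * indicator (X n) x
      = (f (lift (q, \<phi> n x)) * ennreal (transfer_density q (\<phi> n x)) * indicator pairs (q, \<phi> n x)) * ennreal (vol (\<phi> n x)) * indicator (piece n) x"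
    proof (cases "x \<in> X n")
      case True
      then have x: "x \<in> piece n" "(q, \<phi> n x) \<in> pairs" "?z (fiber_map q n x) \<in> B" by (auto simp: X_def pairs_def lift)
      have "ennreal (vol q) * ennreal \<bar>det (fiber_deriv q n x)\<bar> = ennreal (transfer_density q (\<phi> n x)) * ennreal (vol (\<phi> n x))"
        using abs_det_fiber_deriv[OF q x(1)] vol_pos[OF q] vol_pos[of "\<phi> n x"] x chart_in
        by (simp add: ennreal_mult'[symmetric] mult.commute piece_def ennreal_mult''[symmetric])
      then show ?thesis using True x by (simp add: g_def lift[symmetric] mult.assoc)
    next
      case False
      then show ?thesis by (auto simp: X_def)
    qed
  qed
  also have "\<dots> = (\<integral>\<^sup>+q1. f (lift (q, q1)) * ennreal (transfer_density q q1) * indicator pairs (q, q1) \<partial>\<sigma>)"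
  proof (rule nn_integral_position[symmetric])
    have c: "(\<lambda>q1. q) \<in> restrict_space borel S \<rightarrow>\<^sub>M restrict_space borel S" using q by (simp add: space_restrict_space)
    have i: "(\<lambda>q1. q1) \<in> restrict_space borel S \<rightarrow>\<^sub>M restrict_space borel S" by (rule measurable_ident_sets) simp
    have [measurable]: "(\<lambda>q1. f (lift (q, q1))) \<in> borel_measurable (restrict_space borel S)"
      "(\<lambda>q1. transfer_density q q1) \<in> borel_measurable (restrict_space borel S)"
      by (rule measurable_compose[OF measurable_lift[OF c i] f] measurable_transfer_density[OF c i])+
    have [measurable]: "(\<lambda>q1. indicator pairs (q, q1) :: ennreal) \<in> borel_measurable (restrict_space borel S)"
      by (rule measurable_compose[OF _ borel_measurable_indicator[OF pairs_sets]]) (use c in measurable)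
    show "(\<lambda>q1. f (lift (q, q1)) * ennreal (transfer_density q q1) * indicator pairs (q, q1)) \<in> borel_measurable (restrict_space borel S)"
      by measurable
  qed
  finally show ?thesis .
qed

text \<open>
  The positive function \<open>exp (- V q)\<close> has a finite integral.
\<close>

lemma sigma_finite_position: "sigma_finite_measure \<sigma>"
proof -
  have V: "V \<in> borel_measurable \<sigma>"
    using measurable_restrict_space1[OF measurable_V, of S] by (simp cong: measurable_cong_sets)
  have "finite_measure (density \<sigma> (\<lambda>q. ennreal (exp (- V q))))"
  proof (rule finite_measureI)
    have "emeasure (density \<sigma> (\<lambda>q. ennreal (exp (- V q)))) S = (\<integral>\<^sup>+q. ennreal (exp (- V q)) * indicator S q \<partial>\<sigma>)"
      using V sets.top[of \<sigma>] by (intro emeasure_density) auto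
    also have "\<dots> = Z_nu k M \<xi> V" unfolding Z_nu_def by (intro nn_integral_cong) simp
    finally show "emeasure (density \<sigma> (\<lambda>q. ennreal (exp (- V q)))) (space (density \<sigma> (\<lambda>q. ennreal (exp (- V q))))) \<noteq> \<infinity>"
      using Z_nu_finite by simp
  qed
  then interpret finite_measure "density \<sigma> (\<lambda>q. ennreal (exp (- V q)))" .
  have "sigma_finite_measure (density (density \<sigma> (\<lambda>q. ennreal (exp (- V q)))) (\<lambda>q. ennreal (exp (V q))))"
    using V by (subst sigma_finite_iff_density_finite') auto
  moreover have "density (density \<sigma> (\<lambda>q. ennreal (exp (- V q)))) (\<lambda>q. ennreal (exp (V q))) = density \<sigma> (\<lambda>_. 1)"
    using V by (subst density_density_eq) (auto simp: ennreal_mult[symmetric] exp_add[symmetric])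
  ultimately show ?thesis by (simp add: density_1)
qed

text \<open>
  In the coordinates \<open>(q, q1)\<close> the map is the exchange of two variables, the density is symmetric, and the
  product of the measure on the manifold with itself is symmetric by Fubini's theorem.
\<close>

theorem liouville_invariant:
  assumes f: "f \<in> borel_measurable PS"
  shows "(\<integral>\<^sup>+z. f (\<Psi> z) * indicator B z \<partial>L) = (\<integral>\<^sup>+z. f z * indicator B z \<partial>L)"
proof -
  interpret pair_sigma_finite \<sigma> \<sigma>
    using sigma_finite_position by (simp add: pair_sigma_finite_def)
  have eq: "(\<integral>\<^sup>+z. f z * indicator B z \<partial>L) = (\<integral>\<^sup>+q. \<integral>\<^sup>+q1. f (lift (q, q1)) * ennreal (transfer_density q q1) * indicator pairs (q, q1) \<partial>\<sigma> \<partial>\<sigma>)"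
    if f: "f \<in> borel_measurable PS" for f :: "(real^'d) dbl \<Rightarrow> ennreal"
  proof -
    have "(\<lambda>z. f z * indicator B z) \<in> borel_measurable PS" using f by measurable
    from nn_integral_liouville[OF this]
    have "(\<integral>\<^sup>+z. f z * indicator B z \<partial>L) = (\<integral>\<^sup>+q. \<integral>\<^sup>+p. f (q, p) * indicator B (q, p) \<partial>\<tau> q \<partial>\<sigma>)" .
    also have "\<dots> = (\<integral>\<^sup>+q. \<integral>\<^sup>+q1. f (lift (q, q1)) * ennreal (transfer_density q q1) * indicator pairs (q, q1) \<partial>\<sigma> \<partial>\<sigma>)"
      by (intro nn_integral_cong nn_integral_fiber_change[OF _ f]) simp
    finally show ?thesis .
  qed
  have f': "(\<lambda>z. f (\<Psi>' z)) \<in> borel_measurable PS" by (rule measurable_compose[OF measurable_\<Psi>' f])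
  have "(\<integral>\<^sup>+z. f (\<Psi> z) * indicator B z \<partial>L) = (\<integral>\<^sup>+z. f (\<Psi>' z) * indicator B z \<partial>L)"
    using B_subset by (intro nn_integral_cong) (auto simp: indicator_def \<Psi>'_eq)
  also have "\<dots> = (\<integral>\<^sup>+q. \<integral>\<^sup>+q1. f (\<Psi>' (lift (q, q1))) * ennreal (transfer_density q q1) * indicator pairs (q, q1) \<partial>\<sigma> \<partial>\<sigma>)"
    by (rule eq[OF f'])
  also have "\<dots> = (\<integral>\<^sup>+q. \<integral>\<^sup>+q1. f (lift (q1, q)) * ennreal (transfer_density q1 q) * indicator pairs (q1, q) \<partial>\<sigma> \<partial>\<sigma>)"
  proof (intro nn_integral_cong)
    fix q q1
    have "f (\<Psi>' (lift (q, q1))) = f (lift (q1, q))" if "(q, q1) \<in> pairs"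
      using pairs_rattle(1)[OF that] that B_subset by (auto simp: pairs_def \<Psi>'_eq)
    then show "f (\<Psi>' (lift (q, q1))) * ennreal (transfer_density q q1) * indicator pairs (q, q1)
        = f (lift (q1, q)) * ennreal (transfer_density q1 q) * indicator pairs (q1, q)"
      using transfer_density_sym[of q q1] pairs_sym[of q q1] by (auto simp: indicator_def)
  qed
  also have "\<dots> = (\<integral>\<^sup>+q. \<integral>\<^sup>+q1. f (lift (q, q1)) * ennreal (transfer_density q q1) * indicator pairs (q, q1) \<partial>\<sigma> \<partial>\<sigma>)"
  proof -
    let ?SS = "restrict_space borel S \<Otimes>\<^sub>M restrict_space borel S"
    have ms: "fst \<in> ?SS \<rightarrow>\<^sub>M restrict_space borel S" "snd \<in> ?SS \<rightarrow>\<^sub>M restrict_space borel S" by auto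
    have "(\<lambda>c. f (lift (fst c, snd c)) * ennreal (transfer_density (fst c) (snd c)) * indicator pairs c) \<in> borel_measurable ?SS"
      using measurable_compose[OF measurable_lift[OF ms] f] measurable_transfer_density[OF ms] pairs_sets by measurable
    then have "(\<lambda>c. f (lift c) * ennreal (transfer_density (fst c) (snd c)) * indicator pairs c) \<in> borel_measurable (\<sigma> \<Otimes>\<^sub>M \<sigma>)"
      by (simp cong: measurable_cong_sets sets_pair_measure_cong)
    then have m: "(\<lambda>(q, q1). f (lift (q, q1)) * ennreal (transfer_density q q1) * indicator pairs (q, q1)) \<in> borel_measurable (\<sigma> \<Otimes>\<^sub>M \<sigma>)"
      by (simp add: case_prod_unfold)
    show ?thesis by (rule Fubini'[OF m])
  qed
  also have "\<dots> = (\<integral>\<^sup>+z. f z * indicator B z \<partial>L)" by (rule eq[OF f, symmetric])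
  finally show ?thesis .
qed

end

section \<open>Invariance of the target measure\<close>

context rattle_system
begin

abbreviation "H \<equiv> hamiltonian M V"
abbreviation "\<Psi>r \<equiv> rattle_rev M \<xi> V D \<Lambda> h"
abbreviation "\<kappa> q \<equiv> momentum_kernel k M \<xi> q"

definition "kinetic p = (p \<bullet> (Minv *v p)) / 2"

lemma H_eq: "H (q, p) = V q + kinetic p"
  by (simp add: hamiltonian_def kinetic_def)

lemma measurable_kinetic [measurable]: "kinetic \<in> borel_measurable borel"
  unfolding kinetic_def[abs_def]
  by (intro borel_measurable_continuous_onI continuous_intros bounded_linear.continuous_on[OF matrix_vector_mul_bounded_linear]) auto

lemma measurable_H [measurable]: "H \<in> borel_measurable PS"
proof -
  have "(\<lambda>z. V (fst z) + kinetic (snd z)) \<in> borel_measurable PS" by measurable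
  also have "(\<lambda>z. V (fst z) + kinetic (snd z)) = H" by (auto simp: H_eq)
  finally show ?thesis .
qed

lemma measurable_\<Psi>r [measurable]: "\<Psi>r \<in> PS \<rightarrow>\<^sub>M PS"
proof -
  have "\<Psi>r = (\<lambda>z. if z \<in> B then \<Psi>' z else z)"
    using B_subset by (auto simp: rattle_rev_def \<Psi>'_eq fun_eq_iff)
  also have "\<dots> \<in> PS \<rightarrow>\<^sub>M PS"
    using B_sets B_subset by (intro measurable_If_set measurable_ident) (auto simp: Int_absorb2)
  finally show ?thesis .
qed

lemma \<Psi>r_in: "z \<in> TS \<Longrightarrow> \<Psi>r z \<in> TS"
  using measurable_space[OF measurable_\<Psi>r, of z] by simp

lemma \<Psi>r_involutive: "\<Psi>r (\<Psi>r z) = z"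
  using rattle_B[of z] by (auto simp: rattle_rev_def)

text \<open>
  The map with reverse projection check is RATTLE on \<open>B\<close>, which RATTLE leaves invariant, and the identity elsewhere.
\<close>

lemma liouville_\<Psi>r:
  assumes f: "f \<in> borel_measurable PS"
  shows "(\<integral>\<^sup>+z. f (\<Psi>r z) \<partial>L) = (\<integral>\<^sup>+z. f z \<partial>L)"
proof -
  have fr: "(\<lambda>z. f (\<Psi>r z)) \<in> borel_measurable PS" by (rule measurable_compose[OF measurable_\<Psi>r f])
  have split: "(\<integral>\<^sup>+z. g z \<partial>L) = (\<integral>\<^sup>+z. g z * indicator B z \<partial>L) + (\<integral>\<^sup>+z. g z * indicator (- B) z \<partial>L)"
    if g: "g \<in> borel_measurable PS" for g :: "(real^'d) dbl \<Rightarrow> ennreal"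
  proof -
    have "TS - B \<in> sets PS" using sets.compl_sets[OF B_sets] by simp
    then have "(\<lambda>z. g z * indicator (TS - B) z) \<in> borel_measurable PS" using g by measurable
    then have "(\<lambda>z. g z * indicator (- B) z) \<in> borel_measurable PS"
      by (rule measurable_cong[THEN iffD1, rotated]) (auto simp: indicator_def)
    moreover have "(\<lambda>z. g z * indicator B z) \<in> borel_measurable PS" using g by measurable
    ultimately have "(\<integral>\<^sup>+z. g z * indicator B z + g z * indicator (- B) z \<partial>L) = (\<integral>\<^sup>+z. g z * indicator B z \<partial>L) + (\<integral>\<^sup>+z. g z * indicator (- B) z \<partial>L)"
      by (intro nn_integral_add) (auto cong: measurable_cong_sets)
    moreover have "(\<integral>\<^sup>+z. g z * indicator B z + g z * indicator (- B) z \<partial>L) = (\<integral>\<^sup>+z. g z \<partial>L)"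
      by (intro nn_integral_cong) (auto simp: indicator_def)
    ultimately show ?thesis by simp
  qed
  have "(\<integral>\<^sup>+z. f (\<Psi>r z) * indicator B z \<partial>L) = (\<integral>\<^sup>+z. f (\<Psi> z) * indicator B z \<partial>L)"
    by (intro nn_integral_cong) (auto simp: indicator_def rattle_rev_def)
  also have "\<dots> = (\<integral>\<^sup>+z. f z * indicator B z \<partial>L)" by (rule liouville_invariant[OF f])
  finally have 1: "(\<integral>\<^sup>+z. f (\<Psi>r z) * indicator B z \<partial>L) = (\<integral>\<^sup>+z. f z * indicator B z \<partial>L)" .
  have 2: "(\<integral>\<^sup>+z. f (\<Psi>r z) * indicator (- B) z \<partial>L) = (\<integral>\<^sup>+z. f z * indicator (- B) z \<partial>L)"
    by (intro nn_integral_cong) (auto simp: indicator_def rattle_rev_def)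
  show ?thesis unfolding split[OF f] split[OF fr] 1 2 ..
qed

subsection \<open>The Metropolis step\<close>

definition "unif = uniform_measure lborel {0<..<1::real}"

lemma prob_space_unif: "prob_space unif"
  unfolding unif_def by (rule prob_space_uniform_measure) auto

lemma sets_unif [measurable_cong, simp]: "sets unif = sets borel"
  and space_unif [simp]: "space unif = UNIV"
  by (simp_all add: unif_def)

definition "accept z = min 1 (exp (- H (\<Psi>r z) + H z))"

lemma accept_bounds: "0 < accept z" "accept z \<le> 1"
  by (auto simp: accept_def)

lemma measurable_accept [measurable]: "accept \<in> borel_measurable PS"
  unfolding accept_def[abs_def] using measurable_compose[OF measurable_\<Psi>r measurable_H] by measurable

lemma unif_atMost:
  assumes "0 < a" shows "emeasure unif {..a} = ennreal (min 1 a)"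
proof -
  have "{0<..<1} \<inter> {..a} = (if a < 1 then {0<..a} else {0<..<1})" using assms by auto
  then show ?thesis using assms by (simp add: unif_def emeasure_uniform_measure min_def divide_ennreal_def)
qed

lemma unif_greaterThan:
  assumes "0 < a" shows "emeasure unif {a<..} = ennreal (1 - min 1 a)"
proof -
  have "{0<..<1} \<inter> {a<..} = (if a < 1 then {a<..<1} else {})" using assms by auto
  then show ?thesis using assms by (simp add: unif_def emeasure_uniform_measure min_def divide_ennreal_def)
qed

definition "metro_kernel z = unif \<bind> (\<lambda>u. return PS (metropolis H \<Psi>r u z))"

lemma metro_measurable: "z \<in> TS \<Longrightarrow> (\<lambda>u. metropolis H \<Psi>r u z) \<in> unif \<rightarrow>\<^sub>M PS"
  unfolding metropolis_def using \<Psi>r_in by (intro measurable_If measurable_const) (auto simp: less_eq_real_def[symmetric])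

lemma metro_kernel_eq: "z \<in> TS \<Longrightarrow> metro_kernel z = distr unif PS (\<lambda>u. metropolis H \<Psi>r u z)"
  unfolding metro_kernel_def by (rule bind_return_distr'[OF _ metro_measurable]) auto

lemma sets_metro_kernel: "z \<in> TS \<Longrightarrow> sets (metro_kernel z) = sets PS"
  by (simp add: metro_kernel_eq)

lemma prob_space_metro_kernel: "z \<in> TS \<Longrightarrow> prob_space (metro_kernel z)"
  unfolding metro_kernel_eq by (rule prob_space.prob_space_distr[OF prob_space_unif metro_measurable])

lemma emeasure_metro_kernel:
  assumes z: "z \<in> TS" and E: "E \<in> sets PS"
  shows "emeasure (metro_kernel z) E
    = ennreal (accept z) * indicator E (\<Psi>r z) + ennreal (1 - accept z) * indicator E z"
proof -
  define x where "x = - H (\<Psi>r z) + H z"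
  have "emeasure (metro_kernel z) E = (\<integral>\<^sup>+y. indicator E y \<partial>metro_kernel z)"
    using E z by (simp add: sets_metro_kernel)
  also have "\<dots> = (\<integral>\<^sup>+u. indicator E (metropolis H \<Psi>r u z) \<partial>unif)"
    unfolding metro_kernel_eq[OF z] using E by (intro nn_integral_distr metro_measurable z) auto
  also have "\<dots> = (\<integral>\<^sup>+u. indicator E (\<Psi>r z) * indicator {..exp x} u + indicator E z * indicator {exp x<..} u \<partial>unif)"
    by (intro nn_integral_cong) (auto simp: metropolis_def x_def indicator_def)
  also have "\<dots> = indicator E (\<Psi>r z) * emeasure unif {..exp x} + indicator E z * emeasure unif {exp x<..}"
    by (subst nn_integral_add) (auto simp: nn_integral_cmult_indicator)
  finally show ?thesis by (simp add: unif_atMost unif_greaterThan accept_def x_def mult.commute)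
qed

lemma measurable_emeasure_metro_kernel:
  assumes E: "E \<in> sets PS"
  shows "(\<lambda>z. emeasure (metro_kernel z) E) \<in> borel_measurable PS"
proof -
  have [measurable]: "(\<lambda>z. indicator E (\<Psi>r z) :: ennreal) \<in> borel_measurable PS"
    using E by (intro measurable_compose[OF measurable_\<Psi>r]) auto
  have "(\<lambda>z. ennreal (accept z) * indicator E (\<Psi>r z) + ennreal (1 - accept z) * indicator E z) \<in> borel_measurable PS"
    using E by measurable
  then show ?thesis
    by (rule measurable_cong[THEN iffD1, rotated]) (simp add: emeasure_metro_kernel[OF _ E])
qed

lemma measurable_metro_kernel: "metro_kernel \<in> PS \<rightarrow>\<^sub>M subprob_algebra PS"
  by (rule measurable_subprob_algebra)
     (auto simp: sets_metro_kernel measurable_emeasure_metro_kernel intro!: prob_space_imp_subprob_space prob_space_metro_kernel)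

text \<open>
  The accepted weight \<open>exp (- H z) * accept z\<close> is the smaller one of \<open>exp (- H z)\<close> and
  \<open>exp (- H (\<Psi>r z))\<close>.  It is therefore invariant under the involution \<open>\<Psi>r\<close>, which preserves the Liouville measure:
  the accepted mass that arrives in a set equals the one that starts from it.
\<close>

theorem metropolis_balance:
  assumes E: "E \<in> sets PS"
  shows "(\<integral>\<^sup>+z. ennreal (exp (- H z)) * c * emeasure (metro_kernel z) E \<partial>L)
       = (\<integral>\<^sup>+z. ennreal (exp (- H z)) * c * indicator E z \<partial>L)"
proof -
  let ?s = "\<lambda>z. ennreal (exp (- H z)) * c * ennreal (accept z)"
  let ?r = "\<lambda>z. ennreal (exp (- H z)) * c * ennreal (1 - accept z)"
  have sym: "?s (\<Psi>r z) = ?s z" for z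
  proof -
    have "exp (- H z) * accept z = min (exp (- H z)) (exp (- H (\<Psi>r z)))" for z
      by (simp add: accept_def min_mult_distrib_left exp_add[symmetric])
    from this[of z] this[of "\<Psi>r z"] have "exp (- H (\<Psi>r z)) * accept (\<Psi>r z) = exp (- H z) * accept z"
      by (simp add: \<Psi>r_involutive min.commute)
    then show ?thesis
      using accept_bounds[of z] accept_bounds[of "\<Psi>r z"]
      by (simp add: mult.assoc mult.commute[of c] ) (simp add: mult.assoc[symmetric] ennreal_mult[symmetric])
  qed
  have m: "(\<lambda>z. ?s z * indicator E z) \<in> borel_measurable PS" "(\<lambda>z. ?r z * indicator E z) \<in> borel_measurable PS"
    using E by measurable
  have m1: "(\<lambda>z. ?s z * indicator E (\<Psi>r z)) \<in> borel_measurable PS"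
    using measurable_compose[OF measurable_\<Psi>r m(1)] by (simp add: sym)
  have "(\<integral>\<^sup>+z. ennreal (exp (- H z)) * c * emeasure (metro_kernel z) E \<partial>L)
      = (\<integral>\<^sup>+z. ?s z * indicator E (\<Psi>r z) + ?r z * indicator E z \<partial>L)"
    by (intro nn_integral_cong) (simp add: emeasure_metro_kernel[OF _ E] distrib_left mult.assoc)
  also have "\<dots> = (\<integral>\<^sup>+z. ?s z * indicator E (\<Psi>r z) \<partial>L) + (\<integral>\<^sup>+z. ?r z * indicator E z \<partial>L)"
    using m m1 by (intro nn_integral_add) (auto cong: measurable_cong_sets)
  also have "(\<integral>\<^sup>+z. ?s z * indicator E (\<Psi>r z) \<partial>L) = (\<integral>\<^sup>+z. ?s z * indicator E z \<partial>L)"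
    using liouville_\<Psi>r[OF m(1)] by (simp add: sym)
  also have "\<dots> + (\<integral>\<^sup>+z. ?r z * indicator E z \<partial>L) = (\<integral>\<^sup>+z. ?s z * indicator E z + ?r z * indicator E z \<partial>L)"
    using m by (intro nn_integral_add[symmetric]) (auto cong: measurable_cong_sets)
  also have "\<dots> = (\<integral>\<^sup>+z. ennreal (exp (- H z)) * c * indicator E z \<partial>L)"
  proof (intro nn_integral_cong)
    fix z
    have "ennreal (accept z) + ennreal (1 - accept z) = 1"
      using accept_bounds[of z] by (simp add: ennreal_plus[symmetric] del: ennreal_plus)
    then have "ennreal (exp (- H z)) * c * (ennreal (accept z) + ennreal (1 - accept z)) * indicator E z
        = ennreal (exp (- H z)) * c * indicator E z" by simp
    then show "?s z * indicator E z + ?r z * indicator E z = ennreal (exp (- H z)) * c * indicator E z"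
      by (simp only: distrib_left distrib_right)
  qed
  finally show ?thesis .
qed

subsection \<open>The momentum refreshment\<close>

definition gauss :: real where "gauss = (2 * pi) powr ((real CARD('m) - real CARD('d)) / 2)"

lemma gauss_nonneg: "0 \<le> gauss"
  by (simp add: gauss_def)

lemma gauss_norm: "gauss * (2 * pi) powr (real CARD('k) / 2) = 1"
proof -
  have "real CARD('k) = real CARD('d) - real CARD('m)" using card_k card_less by simp
  then show ?thesis unfolding gauss_def powr_add[symmetric] by (simp add: field_simps)
qed

lemma kernel_eq: "\<kappa> q = density (\<tau> q) (\<lambda>p. ennreal (gauss * exp (- kinetic p)))"
  by (simp add: momentum_kernel_def gauss_def kinetic_def)

lemma measurable_kinetic_fiber [measurable]: "kinetic \<in> borel_measurable (\<tau> q)"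
  using measurable_restrict_space1[OF measurable_kinetic, of "T q"] by (simp cong: measurable_cong_sets)

lemma nn_integral_kinetic: "q \<in> S \<Longrightarrow> (\<integral>\<^sup>+p. ennreal (exp (- kinetic p)) \<partial>\<tau> q) = ennreal ((2 * pi) powr (real CARD('k) / 2))"
  using nn_integral_gaussian_subspace[OF sym_pos_def_matrix_inv[OF M] subspace_T dim_T, of q k]
  by (simp add: momentum_measure_def kinetic_def)

lemma sets_kernel_momentum: "sets (\<kappa> q) = sets (restrict_space borel (T q))"
  and space_kernel_momentum: "space (\<kappa> q) = T q"
  by (simp_all add: kernel_eq)

lemma nn_integral_kernel:
  assumes q: "q \<in> S" and f: "f \<in> borel_measurable PS"
  shows "(\<integral>\<^sup>+p. f (q, p) \<partial>\<kappa> q) = (\<integral>\<^sup>+p. ennreal (gauss * exp (- kinetic p)) * f (q, p) \<partial>\<tau> q)"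
proof -
  have "(\<lambda>p. f (q, p)) \<in> borel_measurable (\<tau> q)"
    using measurable_fiber[OF q f] by (simp cong: measurable_cong_sets)
  then show ?thesis unfolding kernel_eq by (intro nn_integral_density) measurable
qed

lemma prob_space_kernel: "q \<in> S \<Longrightarrow> prob_space (\<kappa> q)"
proof (rule prob_spaceI)
  assume q: "q \<in> S"
  have "emeasure (\<kappa> q) (T q) = (\<integral>\<^sup>+p. ennreal (gauss * exp (- kinetic p)) * indicator (T q) p \<partial>\<tau> q)"
    unfolding kernel_eq using sets.top[of "\<tau> q"] by (intro emeasure_density) auto
  also have "\<dots> = (\<integral>\<^sup>+p. ennreal gauss * ennreal (exp (- kinetic p)) \<partial>\<tau> q)"
    by (intro nn_integral_cong) (simp add: ennreal_mult gauss_def)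
  also have "\<dots> = ennreal gauss * ennreal ((2 * pi) powr (real CARD('k) / 2))"
    by (subst nn_integral_cmult) (simp_all add: nn_integral_kinetic[OF q])
  also have "\<dots> = 1" by (simp add: ennreal_mult[symmetric] gauss_norm gauss_nonneg)
  finally show "emeasure (\<kappa> q) (space (\<kappa> q)) = 1" by (simp add: space_kernel_momentum)
qed

lemma fiber_inclusion:
  assumes q: "q \<in> S" shows "(\<lambda>p. (q, p)) \<in> \<kappa> q \<rightarrow>\<^sub>M PS"
proof -
  have "(\<lambda>p. (q, p)) \<in> restrict_space borel (T q) \<rightarrow>\<^sub>M PS"
    unfolding phase_space_def using q
    by (intro measurable_restrict_space2) (auto simp: TS_iff space_restrict_space intro!: measurable_restrict_space1)
  then show ?thesis using sets_kernel_momentum by (simp cong: measurable_cong_sets)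
qed

abbreviation "K \<equiv> chmc_kernel k M \<xi> V D \<Lambda> h"

lemma K_eq: "K (q, p) = \<kappa> q \<bind> (\<lambda>p'. metro_kernel (q, p'))"
  by (simp add: chmc_kernel_def metro_kernel_def unif_def)

lemma metro_fiber: "q \<in> S \<Longrightarrow> (\<lambda>p'. metro_kernel (q, p')) \<in> \<kappa> q \<rightarrow>\<^sub>M subprob_algebra PS"
  by (rule measurable_compose[OF fiber_inclusion measurable_metro_kernel])

lemma T_nonempty: "T q \<noteq> {}"
  using subspace_0[OF subspace_T] by blast

lemma emeasure_K:
  assumes q: "q \<in> S" and E: "E \<in> sets PS"
  shows "emeasure (K (q, p)) E = (\<integral>\<^sup>+p'. ennreal (gauss * exp (- kinetic p')) * emeasure (metro_kernel (q, p')) E \<partial>\<tau> q)"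
  unfolding K_eq
  by (subst emeasure_bind[OF _ metro_fiber[OF q] E])
     (auto simp: space_kernel_momentum T_nonempty nn_integral_kernel[OF q measurable_emeasure_metro_kernel[OF E]])

lemma sets_K: "q \<in> S \<Longrightarrow> sets (K (q, p)) = sets PS"
  unfolding K_eq by (rule sets_bind) (auto simp: space_kernel_momentum T_nonempty TS_iff sets_metro_kernel)

lemma prob_space_K: "q \<in> S \<Longrightarrow> prob_space (K (q, p))"
  unfolding K_eq using prob_space_kernel[of q] metro_fiber[of q]
  by (intro prob_space.prob_space_bind[where S=PS])
     (auto simp: space_kernel_momentum TS_iff intro!: prob_space_metro_kernel AE_I2)

lemma measurable_weight [measurable]:
  assumes E: "E \<in> sets PS"
  shows "(\<lambda>z. ennreal (gauss * exp (- kinetic (snd z))) * emeasure (metro_kernel z) E) \<in> borel_measurable PS"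
  using measurable_emeasure_metro_kernel[OF E] by measurable

lemma measurable_K: "K \<in> PS \<rightarrow>\<^sub>M prob_algebra PS"
proof (rule measurable_prob_algebraI)
  show "prob_space (K z)" if "z \<in> space PS" for z
    using that prob_space_K by (cases z) (auto simp: TS_iff)
  show "K \<in> PS \<rightarrow>\<^sub>M subprob_algebra PS"
  proof (rule measurable_subprob_algebra)
    show "subprob_space (K z)" if "z \<in> space PS" for z
      using that by (cases z) (auto simp: TS_iff intro!: prob_space_imp_subprob_space prob_space_K)
    show "sets (K z) = sets PS" if "z \<in> space PS" for z
      using that by (cases z) (auto simp: TS_iff sets_K)
    fix E assume E: "E \<in> sets PS"
    have "(\<lambda>q. \<integral>\<^sup>+p'. ennreal (gauss * exp (- kinetic (snd (q, p')))) * emeasure (metro_kernel (q, p')) E \<partial>\<tau> q) \<in> borel_measurable (restrict_space borel S)"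
      by (rule measurable_fiber_integral[OF measurable_weight[OF E]])
    from measurable_compose[OF measurable_PS_fst_S this]
    have "(\<lambda>z. \<integral>\<^sup>+p'. ennreal (gauss * exp (- kinetic p')) * emeasure (metro_kernel (fst z, p')) E \<partial>\<tau> (fst z)) \<in> borel_measurable PS"
      by simp
    then show "(\<lambda>z. emeasure (K z) E) \<in> borel_measurable PS"
    proof (rule measurable_cong[THEN iffD1, rotated])
      fix z assume "z \<in> space PS"
      then show "(\<integral>\<^sup>+p'. ennreal (gauss * exp (- kinetic p')) * emeasure (metro_kernel (fst z, p')) E \<partial>\<tau> (fst z)) = emeasure (K z) E"
        by (cases z) (simp add: TS_iff emeasure_K[OF _ E])
    qed
  qed
qed

abbreviation "\<mu> \<equiv> target_measure k M \<xi> V"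

lemma sets_target [measurable_cong, simp]: "sets \<mu> = sets PS"
  and space_target [simp]: "space \<mu> = TS"
  by (simp_all add: target_measure_def)

lemma nn_integral_target:
  assumes f: "f \<in> borel_measurable PS"
  shows "(\<integral>\<^sup>+z. f z \<partial>\<mu>) = (\<integral>\<^sup>+z. ennreal (exp (- H z)) * inverse (Z_mu k M \<xi> V) * f z \<partial>L)"
  unfolding target_measure_def divide_ennreal_def using f
  by (intro nn_integral_density) (auto cong: measurable_cong_sets)

text \<open>
  Under the weight \<open>exp (- H)\<close> the momentum has the Gaussian law given the position, so that drawing it
  afresh changes nothing.  The kernel does not depend on the old momentum, which integrates to the Gaussian
  normalization.
\<close>

lemma refreshment_average:
  assumes E: "E \<in> sets PS"
  shows "(\<integral>\<^sup>+z. ennreal (exp (- H z)) * c * emeasure (K z) E \<partial>L)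
       = (\<integral>\<^sup>+z. ennreal (exp (- H z)) * c * emeasure (metro_kernel z) E \<partial>L)"
proof -
  have mK: "(\<lambda>z. emeasure (K z) E) \<in> borel_measurable PS"
    using measurable_compose[OF measurable_prob_algebraD[OF measurable_K] measurable_emeasure_subprob_algebra[OF E]] .
  have e: "(\<integral>\<^sup>+p. ennreal (exp (- H (q, p))) * c * emeasure (K (q, p)) E \<partial>\<tau> q)
      = (\<integral>\<^sup>+p. ennreal (exp (- H (q, p))) * c * emeasure (metro_kernel (q, p)) E \<partial>\<tau> q)" if q: "q \<in> S" for q
  proof -
    let ?e = "\<lambda>p. emeasure (metro_kernel (q, p)) E"
    let ?G = "\<integral>\<^sup>+p'. ennreal (exp (- kinetic p')) * ?e p' \<partial>\<tau> q"
    have [measurable]: "?e \<in> borel_measurable (\<tau> q)"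
      using measurable_fiber[OF q measurable_emeasure_metro_kernel[OF E]] by (simp cong: measurable_cong_sets)
    have K: "emeasure (K (q, p)) E = ennreal gauss * ?G" for p
    proof -
      have "emeasure (K (q, p)) E = (\<integral>\<^sup>+p'. ennreal gauss * (ennreal (exp (- kinetic p')) * ?e p') \<partial>\<tau> q)"
        unfolding emeasure_K[OF q E] by (intro nn_integral_cong) (simp add: ennreal_mult gauss_nonneg mult.assoc)
      then show ?thesis by (simp add: nn_integral_cmult)
    qed
    have H: "ennreal (exp (- H (q, p))) = ennreal (exp (- V q)) * ennreal (exp (- kinetic p))" for p
      by (simp add: H_eq exp_add[symmetric] ennreal_mult[symmetric])
    have "(\<integral>\<^sup>+p. ennreal (exp (- H (q, p))) * c * emeasure (K (q, p)) E \<partial>\<tau> q)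
        = (\<integral>\<^sup>+p. (ennreal (exp (- V q)) * c * (ennreal gauss * ?G)) * ennreal (exp (- kinetic p)) \<partial>\<tau> q)"
      unfolding K H by (intro nn_integral_cong) (simp add: mult_ac)
    also have "\<dots> = (ennreal (exp (- V q)) * c * (ennreal gauss * ?G)) * ennreal ((2 * pi) powr (real CARD('k) / 2))"
      by (subst nn_integral_cmult) (simp_all add: nn_integral_kinetic[OF q])
    also have "\<dots> = ennreal (exp (- V q)) * c * ?G * (ennreal gauss * ennreal ((2 * pi) powr (real CARD('k) / 2)))"
      by (simp only: mult_ac)
    also have "ennreal gauss * ennreal ((2 * pi) powr (real CARD('k) / 2)) = 1"
      by (simp add: ennreal_mult[symmetric] gauss_norm gauss_nonneg)
    also have "ennreal (exp (- V q)) * c * ?G * 1 = (\<integral>\<^sup>+p. (ennreal (exp (- V q)) * c) * (ennreal (exp (- kinetic p)) * ?e p) \<partial>\<tau> q)"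
      by (subst nn_integral_cmult) simp_all
    also have "\<dots> = (\<integral>\<^sup>+p. ennreal (exp (- H (q, p))) * c * ?e p \<partial>\<tau> q)"
      unfolding H by (intro nn_integral_cong) (simp add: mult_ac)
    finally show ?thesis .
  qed
  have "(\<integral>\<^sup>+z. ennreal (exp (- H z)) * c * emeasure (K z) E \<partial>L)
      = (\<integral>\<^sup>+q. \<integral>\<^sup>+p. ennreal (exp (- H (q, p))) * c * emeasure (K (q, p)) E \<partial>\<tau> q \<partial>\<sigma>)"
    by (rule nn_integral_liouville) (use mK in measurable)
  also have "\<dots> = (\<integral>\<^sup>+q. \<integral>\<^sup>+p. ennreal (exp (- H (q, p))) * c * emeasure (metro_kernel (q, p)) E \<partial>\<tau> q \<partial>\<sigma>)"
    by (intro nn_integral_cong e) simp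
  also have "\<dots> = (\<integral>\<^sup>+z. ennreal (exp (- H z)) * c * emeasure (metro_kernel z) E \<partial>L)"
    by (rule nn_integral_liouville[symmetric]) (use measurable_emeasure_metro_kernel[OF E] in measurable)
  finally show ?thesis .
qed

theorem invariant: "invariant_measure K \<mu>"
  unfolding invariant_measure_def markov_kernel_def
proof
  have alg: "prob_algebra \<mu> = prob_algebra PS"
    unfolding prob_algebra_def by (simp add: subprob_algebra_cong[OF sets_target])
  show mK: "K \<in> \<mu> \<rightarrow>\<^sub>M prob_algebra \<mu>"
    unfolding alg using measurable_K by (simp cong: measurable_cong_sets)
  have sK: "K \<in> \<mu> \<rightarrow>\<^sub>M subprob_algebra PS"
    using measurable_prob_algebraD[OF measurable_K] by (simp cong: measurable_cong_sets)
  obtain q p where "q \<in> S" "p \<in> T q" using nonempty T_nonempty by blast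
  then have "(q, p) \<in> TS" by (simp add: TS_iff)
  then have ne: "space \<mu> \<noteq> {}" by auto
  show "\<mu> \<bind> K = \<mu>"
  proof (rule measure_eqI)
    show s: "sets (\<mu> \<bind> K) = sets \<mu>"
      using ne by (subst sets_bind[of _ _ PS]) (auto simp: TS_iff sets_K)
    fix E assume "E \<in> sets (\<mu> \<bind> K)"
    then have E: "E \<in> sets PS" using s by simp
    have mE: "(\<lambda>z. emeasure (K z) E) \<in> borel_measurable PS"
      using measurable_compose[OF measurable_prob_algebraD[OF measurable_K] measurable_emeasure_subprob_algebra[OF E]] .
    have "emeasure (\<mu> \<bind> K) E = (\<integral>\<^sup>+z. emeasure (K z) E \<partial>\<mu>)" by (rule emeasure_bind[OF ne sK E])
    also have "\<dots> = (\<integral>\<^sup>+z. ennreal (exp (- H z)) * inverse (Z_mu k M \<xi> V) * emeasure (K z) E \<partial>L)"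
      by (rule nn_integral_target[OF mE])
    also have "\<dots> = (\<integral>\<^sup>+z. ennreal (exp (- H z)) * inverse (Z_mu k M \<xi> V) * emeasure (metro_kernel z) E \<partial>L)"
      by (rule refreshment_average[OF E])
    also have "\<dots> = (\<integral>\<^sup>+z. ennreal (exp (- H z)) * inverse (Z_mu k M \<xi> V) * indicator E z \<partial>L)"
      by (rule metropolis_balance[OF E])
    also have "\<dots> = (\<integral>\<^sup>+z. indicator E z \<partial>\<mu>)"
      using E by (intro nn_integral_target[symmetric]) simp
    also have "\<dots> = emeasure \<mu> E" using E by simp
    finally show "emeasure (\<mu> \<bind> K) E = emeasure \<mu> E" .
  qed
qed

end

theorem mainTheorem2:
  fixes M :: "real^'d^'d"
    and \<xi> :: "real^'d \<Rightarrow> real^'m"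
    and V :: "real^'d \<Rightarrow> real"
    and D :: "((real^'d) \<times> (real^'d)) set"
    and \<Lambda> :: "(real^'d) \<times> (real^'d) \<Rightarrow> real^'m"
    and \<Delta>t :: real
  assumes "CARD('m) < CARD('d)"
    and "CARD('k::finite) = CARD('d) - CARD('m)"
    and "sym_pos_def M"
    and "smooth_on UNIV \<xi>"
    and "\<exists>N. open N \<and> submfd \<xi> \<subseteq> N \<and> (\<forall>q\<in>N. invertible (gram M \<xi> q))"
    and "smooth_on UNIV V"
    and "0 < Z_nu TYPE('k) M \<xi> V" and "Z_nu TYPE('k) M \<xi> V < \<infinity>"
    and "admissible_multiplier M \<xi> D \<Lambda>"
    and "0 < \<Delta>t"
  shows "invariant_measure (chmc_kernel TYPE('k) M \<xi> V D \<Lambda> \<Delta>t) (target_measure TYPE('k) M \<xi> V)"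
proof -
  \<comment> \<open>On an empty level set \<open>Z_nu\<close> would vanish.\<close>
  have "submfd \<xi> \<noteq> {}"
  proof
    assume "submfd \<xi> = {}"
    then have "space (position_measure TYPE('k) M \<xi>) = {}"
      by (simp add: position_measure_def riemannian_measure_def Let_def space_measure_of_conv)
    then have "Z_nu TYPE('k) M \<xi> V = 0" by (simp add: Z_nu_def nn_integral_empty)
    with assms(7) show False by simp
  qed
  with assms interpret rattle_system M \<xi> "TYPE('k)" V D \<Lambda> \<Delta>t
    by unfold_locales auto
  show ?thesis by (rule invariant)
qed

end
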